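(* Let $(H_\omega)_{\omega\in\Omega}$ be an ergodic family of Jacobi operators on $\ell^2(\mathbb{Z};\mathbb{C})$ generated by $(a,b,T)$ on $(\Omega,\mathcal F,\mathbb P)$ with $|\mathbb{E}_\omega\log|a||<\infty$, and let $L(E)$ denote its Lyapunov exponent. For each $\omega$ let $\mathrm{d}\mu_{\omega,s}$ be the singular (pure point plus singular continuous) component, with respect to Lebesgue measure, of some spectral measure of $H_\omega$ (that is, of the spectral measure $\mu_{\omega,\phi_\omega}$ of $H_\omega$ associated with some vector $\phi_\omega\in\ell^2(\mathbb{Z};\mathbb{C})$). Then for $\mathbb{P}$-a.e. $\omega$ and $\omega'$ (i.e. for $\mathbb P\otimes\mathbb P$-a.e. pair $(\omega,\omega')$), the measures $\mathrm{d}\mu_{\omega,s}$ and $\mathrm{d}\mu_{\omega',s}$ are mutually singular on the set of positive Lyapunov exponent $\{E\in\mathbb{R}: L(E)>0\}$, i.e. their restrictions to this set are mutually singular.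
   Context: Jacobi operators: given bounded sequences $(a_n)_{n\in\mathbb{Z}}$ in $\mathbb{C}$ with $|a_n|>0$ for all $n$, and $(b_n)_{n\in\mathbb{Z}}$ in $\mathbb{R}$, the Jacobi operator $H$ is the bounded self-adjoint operator on $\ell^2(\mathbb{Z};\mathbb{C})$ given by $(H\psi)_n=b_n\psi_n+a_n\psi_{n+1}+\overline{a_{n-1}}\psi_{n-1}$. No positive lower bound on $|a_n|$ is assumed. Ergodic family of Jacobi operators: $(\Omega,\mathcal F,\mathbb P)$ is a probability space, $T:\Omega\to\Omega$ is an invertible measure-preserving ergodic map, and $a:\Omega\to\mathbb{C}$, $b:\Omega\to\mathbb{R}$ are random variables with $|\mathbb{E}_\omega\log|a||<\infty$, bounded so that the sequences below are bounded. Put $a_n(\omega)=a(T^n\omega)$, $b_n(\omega)=b(T^n\omega)$, and let $H_\omega$ be the operator above with these sequences. The assumptions imply that for $\mathbb P$-a.e. $\omega$ one has $a_n(\omega)\ne0$ for all $n$; only such $\omega$ are considered. Lyapunov exponent: for $z\in\mathbb{C}$ let $B_n(\omega,z)=\frac1{a_n(\omega)}\begin{pmatrix} z-b_n(\omega) & -\overline{a_{n-1}(\omega)}\\ a_n(\omega)&0\end{pmatrix}$ be the one-step transfer matrix of $H_\omega\psi=z\psi$, and $L(z)=\lim_{n\to\infty}\frac1n\mathbb{E}_\omega\log\|B_{n-1}(\omega,z)\cdots B_0(\omega,z)\|$. *)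

theory Defs
  imports "HOL-Probability.Probability"
begin

section \<open>The Hilbert space of square-summable sequences\<close>

definition ell2 :: "(int \<Rightarrow> complex) set" where
  "ell2 = {\<psi>. (\<lambda>n. (cmod (\<psi> n))\<^sup>2) summable_on UNIV}"

definition ell2_inner :: "(int \<Rightarrow> complex) \<Rightarrow> (int \<Rightarrow> complex) \<Rightarrow> complex" where
  "ell2_inner \<phi> \<psi> = (\<Sum>\<^sub>\<infinity>n. cnj (\<phi> n) * \<psi> n)"

section \<open>Spectral measures of bounded self-adjoint operators\<close>

text \<open>Operators are functions on all sequences, of which only the restriction to \<^const>\<open>ell2\<close>
  matters.\<close>

definition orthogonal_projection :: "((int \<Rightarrow> complex) \<Rightarrow> (int \<Rightarrow> complex)) \<Rightarrow> bool" where
  "orthogonal_projection P \<longleftrightarrow>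
     (\<forall>\<phi>\<in>ell2. P \<phi> \<in> ell2) \<and>
     (\<forall>\<phi>\<in>ell2. \<forall>\<psi>\<in>ell2. \<forall>c d. P (\<lambda>n. c * \<phi> n + d * \<psi> n) = (\<lambda>n. c * P \<phi> n + d * P \<psi> n)) \<and>
     (\<forall>\<phi>\<in>ell2. P (P \<phi>) = P \<phi>) \<and>
     (\<forall>\<phi>\<in>ell2. \<forall>\<psi>\<in>ell2. ell2_inner (P \<phi>) \<psi> = ell2_inner \<phi> (P \<psi>))"

definition projection_valued_measure ::
    "(real set \<Rightarrow> (int \<Rightarrow> complex) \<Rightarrow> (int \<Rightarrow> complex)) \<Rightarrow> bool" where
  "projection_valued_measure E \<longleftrightarrow>
     (\<forall>B\<in>sets borel. orthogonal_projection (E B)) \<and>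
     (\<forall>\<phi>\<in>ell2. E UNIV \<phi> = \<phi>) \<and>
     (\<forall>B\<in>sets borel. \<forall>C\<in>sets borel. \<forall>\<phi>\<in>ell2. E (B \<inter> C) \<phi> = E B (E C \<phi>)) \<and>
     (\<forall>C::nat \<Rightarrow> real set. range C \<subseteq> sets borel \<longrightarrow> disjoint_family C \<longrightarrow>
        (\<forall>\<phi>\<in>ell2. \<forall>\<psi>\<in>ell2.
           (\<lambda>i. ell2_inner \<phi> (E (C i) \<psi>)) sums ell2_inner \<phi> (E (\<Union>i. C i) \<psi>)))"

definition pvm_measure ::
    "(real set \<Rightarrow> (int \<Rightarrow> complex) \<Rightarrow> (int \<Rightarrow> complex)) \<Rightarrow> (int \<Rightarrow> complex) \<Rightarrow> real measure" where
  "pvm_measure E \<phi> = measure_of UNIV (sets borel) (\<lambda>B. ennreal (Re (ell2_inner \<phi> (E B \<phi>))))"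

text \<open>\<open>A = \<integral> x dE(x)\<close>, read through its quadratic form, for a projection-valued measure \<open>E\<close> of
  bounded support. By the spectral theorem such an \<open>E\<close> exists and is unique (on Borel sets and
  \<^const>\<open>ell2\<close>) for every bounded self-adjoint operator \<open>A\<close>. Bounded support makes every integrand
  below integrable, so that the totalised integral causes no spurious solutions.\<close>

definition spectral_resolution ::
    "((int \<Rightarrow> complex) \<Rightarrow> (int \<Rightarrow> complex)) \<Rightarrow>
     (real set \<Rightarrow> (int \<Rightarrow> complex) \<Rightarrow> (int \<Rightarrow> complex)) \<Rightarrow> bool" where
  "spectral_resolution A E \<longleftrightarrow>
     projection_valued_measure E \<and>
     (\<exists>R. \<forall>\<phi>\<in>ell2. E {-R..R} \<phi> = \<phi>) \<and>
     (\<forall>\<phi>\<in>ell2. ell2_inner \<phi> (A \<phi>) = complex_of_real (\<integral>x. x \<partial>pvm_measure E \<phi>))"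

definition is_spectral_measure ::
    "((int \<Rightarrow> complex) \<Rightarrow> (int \<Rightarrow> complex)) \<Rightarrow> (int \<Rightarrow> complex) \<Rightarrow> real measure \<Rightarrow> bool" where
  "is_spectral_measure A \<phi> \<mu> \<longleftrightarrow>
     \<phi> \<in> ell2 \<and> (\<exists>E. spectral_resolution A E \<and> \<mu> = pvm_measure E \<phi>)"

section \<open>Mutual singularity and the singular component\<close>

text \<open>Mutual singularity of the restrictions of \<open>M\<close> and \<open>N\<close> to \<open>S\<close>. Membership in
  \<^const>\<open>null_sets\<close> includes measurability, so this is never true merely because \<^const>\<open>emeasure\<close>
  vanishes on non-measurable sets.\<close>

definition mutually_singular_on :: "'a set \<Rightarrow> 'a measure \<Rightarrow> 'a measure \<Rightarrow> bool" where
  "mutually_singular_on S M N \<longleftrightarrow> (\<exists>A. S \<inter> A \<in> null_sets M \<and> S - A \<in> null_sets N)"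

text \<open>\<open>\<nu>\<close> is the singular part in the Lebesgue decomposition of \<open>\<mu>\<close>.\<close>

definition is_singular_component :: "real measure \<Rightarrow> real measure \<Rightarrow> bool" where
  "is_singular_component \<mu> \<nu> \<longleftrightarrow>
     sets \<nu> = sets borel \<and> mutually_singular_on UNIV lborel \<nu> \<and>
     (\<exists>\<alpha>. sets \<alpha> = sets borel \<and> absolutely_continuous lborel \<alpha> \<and>
          (\<forall>B\<in>sets borel. emeasure \<mu> B = emeasure \<alpha> B + emeasure \<nu> B))"

section \<open>Jacobi operators and transfer matrices\<close>

definition jacobi_op ::
    "(int \<Rightarrow> complex) \<Rightarrow> (int \<Rightarrow> real) \<Rightarrow> (int \<Rightarrow> complex) \<Rightarrow> (int \<Rightarrow> complex)" where
  "jacobi_op a b \<psi> =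
     (\<lambda>n. complex_of_real (b n) * \<psi> n + a n * \<psi> (n + 1) + cnj (a (n - 1)) * \<psi> (n - 1))"

definition one_step_matrix ::
    "(int \<Rightarrow> complex) \<Rightarrow> (int \<Rightarrow> real) \<Rightarrow> complex \<Rightarrow> int \<Rightarrow> complex^2^2" where
  "one_step_matrix a b z n =
     (\<chi> i j. (1 / a n) *
        (vector [vector [z - complex_of_real (b n), - cnj (a (n - 1))],
                 vector [a n, 0]] :: complex^2^2) $ i $ j)"

primrec transfer_matrix ::
    "(int \<Rightarrow> complex) \<Rightarrow> (int \<Rightarrow> real) \<Rightarrow> complex \<Rightarrow> nat \<Rightarrow> complex^2^2" where
  "transfer_matrix a b z 0 = mat 1"
| "transfer_matrix a b z (Suc n) = one_step_matrix a b z (int n) ** transfer_matrix a b z n"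

section \<open>Ergodic families\<close>

definition int_iterate :: "'w measure \<Rightarrow> ('w \<Rightarrow> 'w) \<Rightarrow> int \<Rightarrow> 'w \<Rightarrow> 'w" where
  "int_iterate M T n =
     (if 0 \<le> n then T ^^ nat n else inv_into (space M) T ^^ nat (- n))"

definition orbit_seq :: "'w measure \<Rightarrow> ('w \<Rightarrow> 'w) \<Rightarrow> ('w \<Rightarrow> 'c) \<Rightarrow> 'w \<Rightarrow> int \<Rightarrow> 'c" where
  "orbit_seq M T f \<omega> n = f (int_iterate M T n \<omega>)"

definition ergodic_jacobi_op ::
    "'w measure \<Rightarrow> ('w \<Rightarrow> 'w) \<Rightarrow> ('w \<Rightarrow> complex) \<Rightarrow> ('w \<Rightarrow> real) \<Rightarrow> 'w \<Rightarrow>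
     (int \<Rightarrow> complex) \<Rightarrow> (int \<Rightarrow> complex)" where
  "ergodic_jacobi_op M T a b \<omega> = jacobi_op (orbit_seq M T a \<omega>) (orbit_seq M T b \<omega>)"

text \<open>The matrix norm is the operator norm for the Euclidean norm on \<open>complex^2\<close>.\<close>

definition lyapunov_exponent ::
    "'w measure \<Rightarrow> ('w \<Rightarrow> 'w) \<Rightarrow> ('w \<Rightarrow> complex) \<Rightarrow> ('w \<Rightarrow> real) \<Rightarrow> complex \<Rightarrow> real" where
  "lyapunov_exponent M T a b z =
     lim (\<lambda>n. (1 / real n) *
       (\<integral>\<omega>. ln (onorm ((*v) (transfer_matrix (orbit_seq M T a \<omega>) (orbit_seq M T b \<omega>) z n))) \<partial>M))"

text \<open>In \<open>\<real>\<close> one has \<open>ln 0 = 0\<close>, whereas mathematically \<open>log 0 = -\<infinity>\<close>. Finiteness of the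
  expectation of \<open>log |a|\<close> therefore means integrability together with \<open>a \<noteq> 0\<close> almost surely.\<close>

locale ergodic_jacobi_family = prob_space M
  for M :: "'w measure" +
  fixes T :: "'w \<Rightarrow> 'w" and a :: "'w \<Rightarrow> complex" and b :: "'w \<Rightarrow> real"
  assumes T_bij: "bij_betw T (space M) (space M)"
    and T_measurable: "T \<in> measurable M M"
    and T_inv_measurable: "inv_into (space M) T \<in> measurable M M"
    and T_preserving: "distr M M T = M"
    and T_ergodic: "\<And>A. A \<in> sets M \<Longrightarrow> T -` A \<inter> space M = A \<Longrightarrow> prob A = 0 \<or> prob A = 1"
    and a_measurable: "a \<in> borel_measurable M"
    and b_measurable: "b \<in> borel_measurable M"
    and a_bounded: "bounded (a ` space M)"
    and b_bounded: "bounded (b ` space M)"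
    and a_nonzero: "AE \<omega> in M. a \<omega> \<noteq> 0"
    and log_a_integrable: "integrable M (\<lambda>\<omega>. ln (cmod (a \<omega>)))"

end

theory Submission
  imports Defs "HOL-Real_Asymp.Real_Asymp"
begin

text \<open>
  Call an energy \<open>x\<close> resonant for \<open>\<omega>\<close> if \<open>H\<^sub>\<omega> u = x u\<close> has a nonzero solution of at most
  quadratic growth.
  By Schnol's theorem every spectral measure of \<open>H\<^sub>\<omega>\<close> is carried by the resonant energies: dividing
  the matrix elements of the spectral resolution by a dominating scalar measure yields generalised
  eigenfunctions. If \<open>L(x) > 0\<close>, then \<open>x\<close> is resonant for almost no \<open>\<omega>\<close>. Indeed, otherwise by
  ergodicity \<open>x\<close> is resonant almost surely; the solution is then under control at all but a small
  proportion of the sites of the orbit, and reduction of order turns this into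
  \<open>E log \<parallel>B\<^bsub>n-1\<^esub> \<cdots> B\<^sub>0\<parallel> = o(n)\<close>, that is \<open>L(x) = 0\<close>. By Fubini, for almost every pair
  the spectral measures of \<open>H\<^bsub>\<omega>'\<^esub>\<close> do not charge the resonant energies of \<open>\<omega>\<close> in \<open>{L > 0}\<close>.
  This applies to the whole spectral measures, hence to their singular components. As the vectors
  are arbitrary functions of \<open>\<omega>\<close>, Fubini is applied to the spectral measures of the standard basis
  vectors, which depend measurably on \<open>\<omega>\<close> since their moments do.
\<close>

section \<open>Square-summable sequences and projection-valued measures\<close>

text \<open>A quadratically bounded solution may decay exponentially, and then it says nothing
  against L(x) > 0. Stationarity excludes decay: if \<open>tempered\<close> holds with constant K at
  a site i of the orbit, then the global solution v satisfies |v(j)| <= K (1 + (j - i)^2) |v(i)| for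
  all j, in particular for j = 0, so v(i) is bounded below as well as above. This requires one
  constant that serves every quadratically bounded solution. As |a| has no positive lower bound, a
  single step may cost an arbitrarily large factor C / |a_n|, and it is not enough that the bad
  sites are rare. The logarithm of the factor is integrable, so dominated convergence makes the
  expected cost of the bad sites small as K grows. Reduction of order turns two-sided control of v
  into an upper bound for all solutions. The matching lower bound comes from the determinant of the
  matrix product, of modulus |a_{-1}| / |a_{n-1}|, whose logarithm has mean zero. The quadratic
  growth itself stems from the summable weights 1 / (1 + k^2) in the dominating measure.\<close>

lemma ell2_summable:
  assumes "\<phi> \<in> ell2" "\<psi> \<in> ell2"
  shows "(\<lambda>n. cnj (\<phi> n) * \<psi> n) summable_on UNIV"
proof -
  have "(\<lambda>n. (cmod (\<phi> n))\<^sup>2 + (cmod (\<psi> n))\<^sup>2) summable_on UNIV"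
    using assms by (intro summable_on_add) (auto simp: ell2_def)
  moreover have "norm (cnj (\<phi> n) * \<psi> n) \<le> (cmod (\<phi> n))\<^sup>2 + (cmod (\<psi> n))\<^sup>2" for n
  proof -
    have "0 \<le> cmod (\<phi> n) * cmod (\<psi> n)" by simp
    then show ?thesis
      using sum_squares_bound[of "cmod (\<phi> n)" "cmod (\<psi> n)"] unfolding norm_mult complex_mod_cnj by linarith
  qed
  ultimately have "(\<lambda>n. norm (cnj (\<phi> n) * \<psi> n)) summable_on UNIV"
    by (intro Infinite_Sum.abs_summable_on_comparison_test'[of "\<lambda>n. (cmod (\<phi> n))\<^sup>2 + (cmod (\<psi> n))\<^sup>2"]) auto
  then show ?thesis by (rule Infinite_Sum.abs_summable_summable)
qed

lemma ell2_lincomb: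
  assumes "\<phi> \<in> ell2" "\<psi> \<in> ell2"
  shows "(\<lambda>n. c * \<phi> n + d * \<psi> n) \<in> ell2"
proof -
  have "(\<lambda>n. 2 * (cmod c)\<^sup>2 * (cmod (\<phi> n))\<^sup>2 + 2 * (cmod d)\<^sup>2 * (cmod (\<psi> n))\<^sup>2) summable_on UNIV"
    using assms by (intro summable_on_add summable_on_cmult_right) (auto simp: ell2_def)
  moreover have "norm ((cmod (c * \<phi> n + d * \<psi> n))\<^sup>2)
      \<le> 2 * (cmod c)\<^sup>2 * (cmod (\<phi> n))\<^sup>2 + 2 * (cmod d)\<^sup>2 * (cmod (\<psi> n))\<^sup>2" for n
  proof -
    have "cmod (c * \<phi> n + d * \<psi> n) \<le> cmod c * cmod (\<phi> n) + cmod d * cmod (\<psi> n)"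
      using norm_triangle_ineq[of "c * \<phi> n" "d * \<psi> n"] by (simp add: norm_mult)
    then have "(cmod (c * \<phi> n + d * \<psi> n))\<^sup>2 \<le> (cmod c * cmod (\<phi> n) + cmod d * cmod (\<psi> n))\<^sup>2"
      by (intro power_mono) auto
    also have "\<dots> \<le> 2 * (cmod c * cmod (\<phi> n))\<^sup>2 + 2 * (cmod d * cmod (\<psi> n))\<^sup>2"
      using sum_squares_bound[of "cmod c * cmod (\<phi> n)" "cmod d * cmod (\<psi> n)"]
      by (simp add: power2_sum)
    finally show ?thesis by (simp add: power_mult_distrib)
  qed
  ultimately have "(\<lambda>n. norm ((cmod (c * \<phi> n + d * \<psi> n))\<^sup>2)) summable_on UNIV"
    by (intro Infinite_Sum.abs_summable_on_comparison_test'[where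
       g="\<lambda>n. 2 * (cmod c)\<^sup>2 * (cmod (\<phi> n))\<^sup>2 + 2 * (cmod d)\<^sup>2 * (cmod (\<psi> n))\<^sup>2"]) auto
  then show ?thesis unfolding ell2_def mem_Collect_eq by (rule Infinite_Sum.abs_summable_summable)
qed

lemma ell2_add_scaled: "\<phi> \<in> ell2 \<Longrightarrow> \<psi> \<in> ell2 \<Longrightarrow> (\<lambda>n. \<phi> n + d * \<psi> n) \<in> ell2"
  using ell2_lincomb[of \<phi> \<psi> 1 d] by simp

lemma ell2_inner_lincomb_right:
  assumes "\<eta> \<in> ell2" "\<phi> \<in> ell2" "\<psi> \<in> ell2"
  shows "ell2_inner \<eta> (\<lambda>n. c * \<phi> n + d * \<psi> n) = c * ell2_inner \<eta> \<phi> + d * ell2_inner \<eta> \<psi>"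
proof -
  have "ell2_inner \<eta> (\<lambda>n. c * \<phi> n + d * \<psi> n)
      = (\<Sum>\<^sub>\<infinity>n. c * (cnj (\<eta> n) * \<phi> n) + d * (cnj (\<eta> n) * \<psi> n))"
    unfolding ell2_inner_def by (rule infsum_cong) (simp add: algebra_simps)
  also have "\<dots> = (\<Sum>\<^sub>\<infinity>n. c * (cnj (\<eta> n) * \<phi> n)) + (\<Sum>\<^sub>\<infinity>n. d * (cnj (\<eta> n) * \<psi> n))"
    by (intro infsum_add summable_on_cmult_right ell2_summable assms)
  finally show ?thesis
    unfolding ell2_inner_def by (simp add: infsum_cmult_right')
qed

lemma ell2_inner_commute: "ell2_inner \<phi> \<psi> = cnj (ell2_inner \<psi> \<phi>)"
  unfolding ell2_inner_def infsum_cnj[symmetric] by (rule infsum_cong) simp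

lemma ell2_inner_lincomb_left:
  assumes "\<eta> \<in> ell2" "\<phi> \<in> ell2" "\<psi> \<in> ell2"
  shows "ell2_inner (\<lambda>n. c * \<phi> n + d * \<psi> n) \<eta> = cnj c * ell2_inner \<phi> \<eta> + cnj d * ell2_inner \<psi> \<eta>"
  by (subst (1 2 3) ell2_inner_commute, subst ell2_inner_lincomb_right[OF assms]) simp

lemma ell2_inner_self: 
  assumes "\<phi> \<in> ell2"
  shows "ell2_inner \<phi> \<phi> = of_real (\<Sum>\<^sub>\<infinity>n. (cmod (\<phi> n))\<^sup>2)"
proof -
  have "ell2_inner \<phi> \<phi> = (\<Sum>\<^sub>\<infinity>n. of_real ((cmod (\<phi> n))\<^sup>2))"
    unfolding ell2_inner_def by (rule infsum_cong) (metis complex_norm_square mult.commute)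
  also have "\<dots> = of_real (\<Sum>\<^sub>\<infinity>n. (cmod (\<phi> n))\<^sup>2)"
    using assms by (intro infsumI has_sum_of_real has_sum_infsum) (simp add: ell2_def)
  finally show ?thesis .
qed

lemma ell2_inner_self_ge0: "\<phi> \<in> ell2 \<Longrightarrow> Re (ell2_inner \<phi> \<phi>) \<ge> 0"
  by (simp add: ell2_inner_self infsum_nonneg)

lemma ell2_inner_self_eq0D:
  assumes "\<phi> \<in> ell2" "ell2_inner \<phi> \<phi> = 0"
  shows "\<phi> n = 0"
proof -
  have "(\<Sum>\<^sub>\<infinity>n. (cmod (\<phi> n))\<^sup>2) = 0"
    using assms by (simp add: ell2_inner_self)
  then have "(cmod (\<phi> n))\<^sup>2 = 0"
    using assms(1) by (intro nonneg_infsum_le_0D[of "\<lambda>n. (cmod (\<phi> n))\<^sup>2" UNIV n]) (auto simp: ell2_def)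
  then show ?thesis by simp
qed

definition unit_seq :: "int \<Rightarrow> int \<Rightarrow> complex" where
  "unit_seq m n = (if n = m then 1 else 0)"

lemma unit_seq_ell2 [simp]: "unit_seq m \<in> ell2"
proof -
  have "(\<lambda>n. (cmod (unit_seq m n))\<^sup>2) summable_on UNIV \<longleftrightarrow> (\<lambda>n. (cmod (unit_seq m n))\<^sup>2) summable_on {m}"
    by (rule summable_on_cong_neutral) (auto simp: unit_seq_def)
  then show ?thesis by (simp add: ell2_def)
qed

lemma ell2_inner_unit_left [simp]: "ell2_inner (unit_seq m) \<psi> = \<psi> m"
proof -
  have "ell2_inner (unit_seq m) \<psi> = (\<Sum>\<^sub>\<infinity>n\<in>{m}. cnj (unit_seq m n) * \<psi> n)"
    unfolding ell2_inner_def by (rule infsum_cong_neutral) (auto simp: unit_seq_def)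
  then show ?thesis by (simp add: unit_seq_def)
qed

section \<open>Projection-valued measures and their scalar spectral measures\<close>

locale pvm =
  fixes E :: "real set \<Rightarrow> (int \<Rightarrow> complex) \<Rightarrow> (int \<Rightarrow> complex)"
  assumes E: "projection_valued_measure E"
begin

lemma E_ell2 [simp]: "B \<in> sets borel \<Longrightarrow> \<phi> \<in> ell2 \<Longrightarrow> E B \<phi> \<in> ell2"
  using E by (auto simp: projection_valued_measure_def orthogonal_projection_def)

lemma E_linear: "B \<in> sets borel \<Longrightarrow> \<phi> \<in> ell2 \<Longrightarrow> \<psi> \<in> ell2 \<Longrightarrow>
    E B (\<lambda>n. c * \<phi> n + d * \<psi> n) = (\<lambda>n. c * E B \<phi> n + d * E B \<psi> n)"
  using E by (auto simp: projection_valued_measure_def orthogonal_projection_def)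

lemma E_sym: "B \<in> sets borel \<Longrightarrow> \<phi> \<in> ell2 \<Longrightarrow> \<psi> \<in> ell2 \<Longrightarrow>
    ell2_inner (E B \<phi>) \<psi> = ell2_inner \<phi> (E B \<psi>)"
  using E unfolding projection_valued_measure_def orthogonal_projection_def by blast

lemma E_UNIV: "\<phi> \<in> ell2 \<Longrightarrow> E UNIV \<phi> = \<phi>"
  using E by (auto simp: projection_valued_measure_def)

lemma E_Int: "B \<in> sets borel \<Longrightarrow> C \<in> sets borel \<Longrightarrow> \<phi> \<in> ell2 \<Longrightarrow> E B (E C \<phi>) = E (B \<inter> C) \<phi>"
  using E unfolding projection_valued_measure_def by simp

lemma E_sums: "range C \<subseteq> sets borel \<Longrightarrow> disjoint_family C \<Longrightarrow> \<phi> \<in> ell2 \<Longrightarrow> \<psi> \<in> ell2 \<Longrightarrow>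
    (\<lambda>i. ell2_inner \<phi> (E (C i) \<psi>)) sums ell2_inner \<phi> (E (\<Union>i::nat. C i) \<psi>)"
  using E unfolding projection_valued_measure_def by blast

definition form :: "(int \<Rightarrow> complex) \<Rightarrow> (int \<Rightarrow> complex) \<Rightarrow> real set \<Rightarrow> complex" where
  "form \<phi> \<psi> B = ell2_inner \<phi> (E B \<psi>)"

lemma form_self:
  assumes "B \<in> sets borel" "\<phi> \<in> ell2"
  shows "form \<phi> \<phi> B = ell2_inner (E B \<phi>) (E B \<phi>)"
  using E_Int[of B B \<phi>] assms by (simp add: E_sym form_def)

lemma form_self_real:
  assumes "B \<in> sets borel" "\<phi> \<in> ell2"
  shows "form \<phi> \<phi> B = of_real (Re (form \<phi> \<phi> B))" "Re (form \<phi> \<phi> B) \<ge> 0"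
  using assms by (simp_all add: form_self ell2_inner_self_ge0) (simp add: ell2_inner_self)

lemma form_lincomb_right:
  assumes "B \<in> sets borel" "\<eta> \<in> ell2" "\<phi> \<in> ell2" "\<psi> \<in> ell2"
  shows "form \<eta> (\<lambda>n. c * \<phi> n + d * \<psi> n) B = c * form \<eta> \<phi> B + d * form \<eta> \<psi> B"
  using assms by (simp add: form_def E_linear ell2_inner_lincomb_right)

lemma form_lincomb_left:
  assumes "B \<in> sets borel" "\<eta> \<in> ell2" "\<phi> \<in> ell2" "\<psi> \<in> ell2"
  shows "form (\<lambda>n. c * \<phi> n + d * \<psi> n) \<eta> B = cnj c * form \<phi> \<eta> B + cnj d * form \<psi> \<eta> B"
  using assms by (simp add: form_def ell2_inner_lincomb_left)

lemma form_add_scaled: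
  assumes "B \<in> sets borel" "\<phi> \<in> ell2" "\<psi> \<in> ell2"
  shows "form (\<lambda>n. \<phi> n + \<zeta> * \<psi> n) (\<lambda>n. \<phi> n + \<zeta> * \<psi> n) B
     = form \<phi> \<phi> B + \<zeta> * form \<phi> \<psi> B + cnj \<zeta> * form \<psi> \<phi> B + cnj \<zeta> * \<zeta> * form \<psi> \<psi> B"
proof -
  have *: "(\<lambda>n. \<phi> n + \<zeta> * \<psi> n) = (\<lambda>n. 1 * \<phi> n + \<zeta> * \<psi> n)" by simp
  have "(\<lambda>n. 1 * \<phi> n + \<zeta> * \<psi> n) \<in> ell2" by (intro ell2_lincomb assms)
  then show ?thesis
    unfolding * using assms
    by (simp only: form_lincomb_left form_lincomb_right complex_cnj_one) (simp add: algebra_simps)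
qed

lemma sets_pvm_measure [simp, measurable_cong]: "sets (pvm_measure E \<phi>) = sets borel"
  unfolding pvm_measure_def by (metis sets.sets_measure_of_eq space_borel)

lemma space_pvm_measure [simp]: "space (pvm_measure E \<phi>) = UNIV"
  by (simp add: sets_eq_imp_space_eq[OF sets_pvm_measure])

lemma emeasure_pvm_measure:
  assumes "B \<in> sets borel" "\<phi> \<in> ell2"
  shows "emeasure (pvm_measure E \<phi>) B = ennreal (Re (form \<phi> \<phi> B))"
proof -
  let ?f = "\<lambda>B. ennreal (Re (ell2_inner \<phi> (E B \<phi>)))"
  have "E {} \<phi> = (\<lambda>n. 0)"
  proof -
    have "form \<phi> \<phi> {} = 0"
    proof -
      \<comment> \<open>The projection of the empty set is not zero by definition. Additivity over
        empty sets gives a convergent constant series, whose term must vanish.\<close>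
      have "(\<lambda>i::nat. form \<phi> \<phi> {}) sums form \<phi> \<phi> {}"
        using E_sums[of "\<lambda>i. {}" \<phi> \<phi>] assms by (simp add: form_def disjoint_family_on_def)
      then show ?thesis
        by (metis sums_summable summable_const_iff)
    qed
    then have "ell2_inner (E {} \<phi>) (E {} \<phi>) = 0" using assms form_self[of "{}" \<phi>] by simp
    then show ?thesis using ell2_inner_self_eq0D[of "E {} \<phi>"] assms by auto
  qed
  then have "positive (sets borel) ?f" by (simp add: positive_def ell2_inner_def)
  moreover have "countably_additive (sets borel) ?f"
  proof (rule countably_additiveI)
    fix A :: "nat \<Rightarrow> real set" assume A: "range A \<subseteq> sets borel" "disjoint_family A"
    have "(\<lambda>i. Re (ell2_inner \<phi> (E (A i) \<phi>))) sums Re (ell2_inner \<phi> (E (\<Union>i. A i) \<phi>))"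
      using E_sums[OF A assms(2,2)] by (rule sums_Re)
    moreover have "Re (ell2_inner \<phi> (E (A i) \<phi>)) \<ge> 0" for i
      using form_self_real(2)[of "A i" \<phi>] A assms by (auto simp: form_def)
    ultimately show "(\<Sum>i. ?f (A i)) = ?f (\<Union>i. A i)"
      by (rule suminf_ennreal_eq[rotated])
  qed
  moreover have "sigma_algebra UNIV (sets (borel :: real measure))"
    using sets.sigma_algebra_axioms[of "borel :: real measure"] by simp
  ultimately show ?thesis
    unfolding pvm_measure_def form_def
    by (intro emeasure_measure_of_sigma) (use assms in auto)
qed

lemma finite_measure_pvm: "\<phi> \<in> ell2 \<Longrightarrow> finite_measure (pvm_measure E \<phi>)"
  by (rule finite_measureI) (simp add: emeasure_pvm_measure)

lemma measure_pvm_measure: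
  assumes "B \<in> sets borel" "\<phi> \<in> ell2"
  shows "measure (pvm_measure E \<phi>) B = Re (form \<phi> \<phi> B)"
  using form_self_real[of B \<phi>] assms by (simp add: measure_def emeasure_pvm_measure)

lemma pvm_measure_unit_total: "emeasure (pvm_measure E (unit_seq m)) UNIV = 1"
  by (simp add: emeasure_pvm_measure form_def E_UNIV) (simp add: unit_seq_def)

text \<open>\<open>E B\<close> annihilates every basis vector, and by symmetry the coordinate
  \<open>m\<close> of \<open>E B \<phi>\<close> is the inner product of
  \<open>E B (unit_seq m)\<close> with \<open>\<phi>\<close>. This carries null sets from the
  countably many basis vectors to arbitrary vectors.\<close>

lemma pvm_measure_absolutely_continuous:
  assumes B: "B \<in> sets borel" and 0: "\<And>m. emeasure (pvm_measure E (unit_seq m)) B = 0"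
    and \<phi>: "\<phi> \<in> ell2"
  shows "emeasure (pvm_measure E \<phi>) B = 0"
proof -
  have "E B (unit_seq m) = (\<lambda>n. 0)" for m
  proof -
    have "form (unit_seq m) (unit_seq m) B = 0"
      using 0[of m] B form_self_real[of B "unit_seq m"] by (simp add: emeasure_pvm_measure ennreal_eq_0_iff)
    then have "ell2_inner (E B (unit_seq m)) (E B (unit_seq m)) = 0"
      using form_self[of B "unit_seq m"] B by simp
    then show ?thesis using ell2_inner_self_eq0D[of "E B (unit_seq m)"] B by auto
  qed
  then have "E B \<phi> m = 0" for m
    using E_sym[OF B, of "unit_seq m" \<phi>] \<phi> ell2_inner_unit_left[of m "E B \<phi>"]
    by (simp add: ell2_inner_def del: ell2_inner_unit_left)
  then have "E B \<phi> = (\<lambda>m. 0)" by auto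
  then show ?thesis using B \<phi> by (simp add: emeasure_pvm_measure form_def ell2_inner_def)
qed

end

lemma ell2_bounded_mult:
  assumes "\<And>n. cmod (c n) \<le> C" "\<psi> \<in> ell2"
  shows "(\<lambda>n. c n * \<psi> n) \<in> ell2"
proof -
  have "(\<lambda>n. C\<^sup>2 * (cmod (\<psi> n))\<^sup>2) summable_on UNIV"
    using assms by (intro summable_on_cmult_right) (auto simp: ell2_def)
  moreover have "norm ((cmod (c n * \<psi> n))\<^sup>2) \<le> C\<^sup>2 * (cmod (\<psi> n))\<^sup>2" for n
    using assms(1)[of n] by (auto simp: norm_mult power_mult_distrib intro!: mult_right_mono power_mono)
  ultimately have "(\<lambda>n. norm ((cmod (c n * \<psi> n))\<^sup>2)) summable_on UNIV"
    by (intro Infinite_Sum.abs_summable_on_comparison_test'[where g="\<lambda>n. C\<^sup>2 * (cmod (\<psi> n))\<^sup>2"]) auto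
  then show ?thesis unfolding ell2_def mem_Collect_eq by (rule Infinite_Sum.abs_summable_summable)
qed

lemma ell2_shift:
  assumes "\<psi> \<in> ell2"
  shows "(\<lambda>n. \<psi> (n + k)) \<in> ell2"
proof -
  have "bij_betw (\<lambda>n. n + k) (UNIV :: int set) UNIV"
    by (intro bij_betw_byWitness[where f'="\<lambda>n. n - k"]) auto
  from summable_on_reindex_bij_betw[OF this, of "\<lambda>n. (cmod (\<psi> n))\<^sup>2"] assms
  show ?thesis by (simp add: ell2_def)
qed

lemma jacobi_op_ell2:
  assumes "\<And>n. cmod (a n) \<le> C" "\<And>n. \<bar>b n\<bar> \<le> C" "\<psi> \<in> ell2"
  shows "jacobi_op a b \<psi> \<in> ell2"
proof -
  have 1: "(\<lambda>n. complex_of_real (b n) * \<psi> n) \<in> ell2"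
    using assms by (intro ell2_bounded_mult[where C=C]) auto
  have 2: "(\<lambda>n. a n * \<psi> (n + 1)) \<in> ell2"
    using assms by (intro ell2_bounded_mult[where C=C] ell2_shift) auto
  have 3: "(\<lambda>n. cnj (a (n - 1)) * \<psi> (n - 1)) \<in> ell2"
    using assms ell2_shift[of \<psi> "-1"] by (intro ell2_bounded_mult[where C=C]) auto
  show ?thesis
    using ell2_lincomb[OF ell2_lincomb[OF 1 2, of 1 1] 3, of 1 1] by (simp add: jacobi_op_def)
qed

lemma jacobi_op_linear:
  "jacobi_op a b (\<lambda>n. c * \<phi> n + d * \<psi> n) = (\<lambda>n. c * jacobi_op a b \<phi> n + d * jacobi_op a b \<psi> n)"
  by (auto simp: jacobi_op_def algebra_simps)

section \<open>Densities with respect to a dominating measure\<close>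

context pvm
begin

text \<open>The sum of the basis spectral measures with weight \<open>1 / (1 + k^2)\<close>, the
  integers being enumerated as \<open>k\<close> and \<open>- k\<close> (so 0 occurs twice). The
  weights are summable, hence the measure is finite; their inverses become the growth bound of the
  eigenfunctions.\<close>

definition dominating_measure :: "real measure" where
  "dominating_measure = measure_of UNIV (sets borel) (\<lambda>B. \<integral>\<^sup>+k. ennreal (1 / (1 + (real k)\<^sup>2)) *
     (emeasure (pvm_measure E (unit_seq (int k))) B + emeasure (pvm_measure E (unit_seq (- int k))) B)
     \<partial>count_space UNIV)"

lemma sets_dominating_measure [simp, measurable_cong]: "sets dominating_measure = sets borel"
  unfolding dominating_measure_def
  by (rule sets.sets_measure_of_eq[of "borel :: real measure", unfolded space_borel])

lemma space_dominating_measure [simp]: "space dominating_measure = UNIV"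
  by (simp add: sets_eq_imp_space_eq[OF sets_dominating_measure])

lemma emeasure_dominating_measure:
  assumes "B \<in> sets borel"
  shows "emeasure dominating_measure B = (\<integral>\<^sup>+k. ennreal (1 / (1 + (real k)\<^sup>2)) *
     (emeasure (pvm_measure E (unit_seq (int k))) B + emeasure (pvm_measure E (unit_seq (- int k))) B)
     \<partial>count_space UNIV)" (is "_ = ?f B")
proof -
  have "positive (sets borel) ?f" by (simp add: positive_def)
  moreover have "countably_additive (sets borel) ?f"
  proof (rule countably_additiveI)
    fix A :: "nat \<Rightarrow> real set" assume A: "range A \<subseteq> sets borel" "disjoint_family A"
    have "emeasure (pvm_measure E \<phi>) (\<Union>i. A i) = (\<Sum>i. emeasure (pvm_measure E \<phi>) (A i))" for \<phi>
      using A by (intro suminf_emeasure[symmetric]) auto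
    then have "?f (\<Union>i. A i) = (\<integral>\<^sup>+k. (\<Sum>i. ennreal (1 / (1 + (real k)\<^sup>2)) *
     (emeasure (pvm_measure E (unit_seq (int k))) (A i) + emeasure (pvm_measure E (unit_seq (- int k))) (A i)))
     \<partial>count_space UNIV)"
      by (simp add: suminf_add[symmetric] ennreal_suminf_cmult)
    also have "\<dots> = (\<Sum>i. ?f (A i))" by (intro nn_integral_suminf) simp
    finally show "(\<Sum>i. ?f (A i)) = ?f (\<Union>i. A i)" by simp
  qed
  moreover have "sigma_algebra UNIV (sets (borel :: real measure))"
    using sets.sigma_algebra_axioms[of "borel :: real measure"] by simp
  ultimately show ?thesis
    unfolding dominating_measure_def by (intro emeasure_measure_of_sigma) (use assms in auto)
qed

lemma finite_dominating_measure: "finite_measure dominating_measure"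
proof (rule finite_measureI)
  have "summable (\<lambda>k. 1 / (1 + (real k)\<^sup>2))"
  proof (rule summable_comparison_test')
    show "summable (\<lambda>k. inverse ((real k)\<^sup>2))" by (rule inverse_power_summable) simp
    show "norm (1 / (1 + (real k)\<^sup>2)) \<le> inverse ((real k)\<^sup>2)" if "k \<ge> 1" for k
      using that by (simp add: divide_simps add_pos_nonneg)
  qed
  then have *: "summable (\<lambda>k. 2 / (1 + (real k)\<^sup>2))" using summable_mult[of _ 2] by fastforce
  have "emeasure dominating_measure UNIV = (\<integral>\<^sup>+k. ennreal (2 / (1 + (real k)\<^sup>2)) \<partial>count_space UNIV)"
  proof -
    have "ennreal (1 / (1 + (real k)\<^sup>2)) * (1 + 1) = ennreal (2 / (1 + (real k)\<^sup>2))" for k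
    proof -
      have "ennreal (1 / (1 + (real k)\<^sup>2)) * (1 + 1) = ennreal (1 / (1 + (real k)\<^sup>2)) * ennreal 2" by simp
      also have "\<dots> = ennreal (1 / (1 + (real k)\<^sup>2) * 2)" by (subst ennreal_mult'') auto
      finally show ?thesis by simp
    qed
    then show ?thesis by (simp add: emeasure_dominating_measure pvm_measure_unit_total)
  qed
  also have "\<dots> \<noteq> \<infinity>"
    unfolding nn_integral_count_space_nat by (subst suminf_ennreal2[OF _ *]) auto
  finally show "emeasure dominating_measure (space dominating_measure) \<noteq> \<infinity>" by simp
qed

sublocale dom: finite_measure dominating_measure
  by (rule finite_dominating_measure)

text \<open>A single term of the defining sum, multiplied by the inverse of its weight.\<close>

lemma dominating_measure_ge:
  assumes "B \<in> sets borel"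
  shows "emeasure (pvm_measure E (unit_seq n)) B \<le> ennreal (1 + (real_of_int n)\<^sup>2) * emeasure dominating_measure B"
proof -
  let ?w = "1 / (1 + (real_of_int n)\<^sup>2)"
  let ?g = "\<lambda>k. ennreal (1 / (1 + (real k)\<^sup>2)) *
     (emeasure (pvm_measure E (unit_seq (int k))) B + emeasure (pvm_measure E (unit_seq (- int k))) B)"
  have w: "(real (nat \<bar>n\<bar>))\<^sup>2 = (real_of_int n)\<^sup>2" by simp
  have "ennreal ?w * emeasure (pvm_measure E (unit_seq n)) B \<le> ?g (nat \<bar>n\<bar>)"
    unfolding w by (cases "n \<ge> 0") (auto intro!: mult_left_mono simp: add_increasing add_increasing2)
  also have "\<dots> \<le> emeasure dominating_measure B"
    unfolding emeasure_dominating_measure[OF assms] by (rule nn_integral_ge_point) simp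
  finally have "ennreal (1 + (real_of_int n)\<^sup>2) * (ennreal ?w * emeasure (pvm_measure E (unit_seq n)) B)
     \<le> ennreal (1 + (real_of_int n)\<^sup>2) * emeasure dominating_measure B"
    by (intro mult_left_mono) auto
  moreover have "ennreal (1 + (real_of_int n)\<^sup>2) * ennreal ?w = 1"
  proof -
    have "1 + (real_of_int n)\<^sup>2 > 0" by (simp add: add_pos_nonneg)
    then have "(1 + (real_of_int n)\<^sup>2) * ?w = 1" by simp
    then show ?thesis by (subst ennreal_mult''[symmetric]) (auto simp: zero_le_divide_iff)
  qed
  ultimately show ?thesis by (simp add: mult.assoc[symmetric])
qed

lemma absolutely_continuous_dominating:
  assumes "\<phi> \<in> ell2"
  shows "absolutely_continuous dominating_measure (pvm_measure E \<phi>)"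
  unfolding absolutely_continuous_def
proof
  fix B assume B: "B \<in> null_sets dominating_measure"
  then have "B \<in> sets borel" by (auto simp: null_sets_def)
  moreover have "emeasure (pvm_measure E (unit_seq m)) B = 0" for m
    using dominating_measure_ge[of B m] B by (auto simp: null_sets_def)
  ultimately show "B \<in> null_sets (pvm_measure E \<phi>)"
    using pvm_measure_absolutely_continuous[of B \<phi>] assms by (auto simp: null_sets_def)
qed

lemma density_exists:
  assumes "\<phi> \<in> ell2"
  shows "\<exists>D \<in> borel_measurable borel. (\<forall>x. 0 \<le> D x) \<and>
     density dominating_measure (\<lambda>x. ennreal (D x)) = pvm_measure E \<phi>"
proof -
  note ac = absolutely_continuous_dominating[OF assms]
  obtain D where D: "D \<in> borel_measurable dominating_measure"
    "AE x in dominating_measure. RN_deriv dominating_measure (pvm_measure E \<phi>) x = ennreal (D x)"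
    "\<And>x. 0 \<le> D x"
    using dom.real_RN_deriv[OF finite_measure_pvm[OF assms] ac] by auto
  have "density dominating_measure (\<lambda>x. ennreal (D x))
      = density dominating_measure (RN_deriv dominating_measure (pvm_measure E \<phi>))"
    using D by (intro density_cong) auto
  also have "\<dots> = pvm_measure E \<phi>" by (rule dom.density_RN_deriv[OF ac]) simp
  finally have "density dominating_measure (\<lambda>x. ennreal (D x)) = pvm_measure E \<phi>" .
  moreover have "D \<in> borel_measurable borel"
    using D(1) by (simp cong: measurable_cong_sets)
  ultimately show ?thesis using D(3) by auto
qed

text \<open>Radon-Nikodym derivatives are classes modulo null sets; a real representative,
  nonnegative everywhere, is fixed once so that it can be evaluated at an energy
  \<open>x\<close>.\<close>

definition dens :: "(int \<Rightarrow> complex) \<Rightarrow> real \<Rightarrow> real" where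
  "dens \<phi> = (SOME D. D \<in> borel_measurable borel \<and> (\<forall>x. 0 \<le> D x) \<and>
     density dominating_measure (\<lambda>x. ennreal (D x)) = pvm_measure E \<phi>)"

lemma dens:
  assumes "\<phi> \<in> ell2"
  shows dens_measurable: "dens \<phi> \<in> borel_measurable borel" 
    and dens_nonneg: "0 \<le> dens \<phi> x"
    and density_dens: "density dominating_measure (\<lambda>x. ennreal (dens \<phi> x)) = pvm_measure E \<phi>"
proof -
  have "dens \<phi> \<in> borel_measurable borel \<and> (\<forall>x. 0 \<le> dens \<phi> x) \<and>
     density dominating_measure (\<lambda>x. ennreal (dens \<phi> x)) = pvm_measure E \<phi>"
    using density_exists[OF assms] unfolding dens_def Bex_def by (rule someI_ex)
  then show "dens \<phi> \<in> borel_measurable borel" "0 \<le> dens \<phi> x"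
    "density dominating_measure (\<lambda>x. ennreal (dens \<phi> x)) = pvm_measure E \<phi>" by auto
qed

lemma integrable_pvm_measure:
  fixes f :: "real \<Rightarrow> real"
  assumes "\<phi> \<in> ell2" "f \<in> borel_measurable borel"
  shows "integrable (pvm_measure E \<phi>) f \<longleftrightarrow> integrable dominating_measure (\<lambda>x. dens \<phi> x * f x)"
  using assms dens_measurable[OF assms(1)] dens_nonneg[OF assms(1)]
  by (subst density_dens[symmetric]) (auto simp: integrable_density)

lemma integral_pvm_measure:
  fixes f :: "real \<Rightarrow> real"
  assumes "\<phi> \<in> ell2" "f \<in> borel_measurable borel"
  shows "integral\<^sup>L (pvm_measure E \<phi>) f = (\<integral>x. dens \<phi> x * f x \<partial>dominating_measure)"
  using assms dens_measurable[OF assms(1)] dens_nonneg[OF assms(1)]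
  by (subst density_dens[symmetric]) (auto simp: integral_density)

lemma integrable_dens: "\<phi> \<in> ell2 \<Longrightarrow> integrable dominating_measure (dens \<phi>)"
  using integrable_pvm_measure[of \<phi> "\<lambda>x. 1"] finite_measure.integrable_const[OF finite_measure_pvm, of \<phi> "1 :: real"]
  by simp

lemma set_integral_dens:
  assumes "\<phi> \<in> ell2" "B \<in> sets borel"
  shows "(LINT x:B|dominating_measure. complex_of_real (dens \<phi> x)) = form \<phi> \<phi> B"
proof -
  have "measure (pvm_measure E \<phi>) B = integral\<^sup>L (pvm_measure E \<phi>) (indicator B)"
    using assms by simp
  also have "\<dots> = (\<integral>x. dens \<phi> x * indicator B x \<partial>dominating_measure)"
    using assms by (intro integral_pvm_measure) auto
  finally have "Re (form \<phi> \<phi> B) = (\<integral>x. dens \<phi> x * indicator B x \<partial>dominating_measure)"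
    using assms by (simp add: measure_pvm_measure)
  then have "form \<phi> \<phi> B = (\<integral>x. complex_of_real (dens \<phi> x * indicator B x) \<partial>dominating_measure)"
    using form_self_real(1)[of B \<phi>] assms by (simp only: integral_complex_of_real)
  also have "\<dots> = (LINT x:B|dominating_measure. complex_of_real (dens \<phi> x))"
    unfolding set_lebesgue_integral_def by (intro Bochner_Integration.integral_cong) (auto simp: indicator_def)
  finally show ?thesis by simp
qed

text \<open>The density of the complex measure \<open>form \<phi> \<psi>\<close>, assembled by
  polarization from four densities of positive measures.\<close>

definition cdens :: "(int \<Rightarrow> complex) \<Rightarrow> (int \<Rightarrow> complex) \<Rightarrow> real \<Rightarrow> complex" where
  "cdens \<phi> \<psi> x = (\<Sum>\<zeta>\<in>{1, -1, \<i>, -\<i>}. cnj \<zeta> * of_real (dens (\<lambda>n. \<phi> n + \<zeta> * \<psi> n) x)) / 4"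

text \<open>Over the four fourth roots of unity the sums of \<open>cnj \<zeta>\<close>, of its
  square and of \<open>\<zeta>\<close> vanish, so only the mixed term survives. The abstract
  \<open>q\<close> and \<open>B\<close> allow the use both for \<open>form\<close> and for the
  matrix elements of the operator.\<close>

lemma polarization:
  fixes q :: "(int \<Rightarrow> complex) \<Rightarrow> complex" and B :: "(int \<Rightarrow> complex) \<Rightarrow> (int \<Rightarrow> complex) \<Rightarrow> complex"
  assumes "\<And>\<zeta>. q (\<lambda>n. \<phi> n + \<zeta> * \<psi> n) = B \<phi> \<phi> + \<zeta> * B \<phi> \<psi> + cnj \<zeta> * B \<psi> \<phi> + cnj \<zeta> * \<zeta> * B \<psi> \<psi>"
  shows "(\<Sum>\<zeta>\<in>{1, -1, \<i>, -\<i>}. cnj \<zeta> * q (\<lambda>n. \<phi> n + \<zeta> * \<psi> n)) / 4 = B \<phi> \<psi>"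
proof -
  have "1 \<noteq> \<i>" "1 \<noteq> -\<i>" "-1 \<noteq> \<i>" by (auto simp: complex_eq_iff)
  then show ?thesis unfolding assms by (simp add: complex_eq_iff algebra_simps)
qed

lemma integrable_cdens:
  assumes "\<phi> \<in> ell2" "\<psi> \<in> ell2"
  shows "integrable dominating_measure (cdens \<phi> \<psi>)"
proof -
  have "integrable dominating_measure (dens (\<lambda>n. \<phi> n + \<zeta> * \<psi> n))" for \<zeta>
    by (intro integrable_dens ell2_add_scaled assms)
  then have "integrable dominating_measure (\<lambda>x. (\<Sum>\<zeta>\<in>{1, -1, \<i>, -\<i>}. cnj \<zeta> * of_real (dens (\<lambda>n. \<phi> n + \<zeta> * \<psi> n) x)) / 4)"
    by (intro Bochner_Integration.integrable_divide Bochner_Integration.integrable_sum 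
      integrable_mult_right integrable_of_real)
  then show ?thesis unfolding cdens_def[abs_def] .
qed

lemma set_integral_cdens:
  assumes "\<phi> \<in> ell2" "\<psi> \<in> ell2" "B \<in> sets borel"
  shows "(LINT x:B|dominating_measure. cdens \<phi> \<psi> x) = form \<phi> \<psi> B"
proof -
  have *: "integrable dominating_measure (\<lambda>x. indicator B x *\<^sub>R complex_of_real (dens (\<lambda>n. \<phi> n + \<zeta> * \<psi> n) x))" for \<zeta>
    using assms by (intro integrable_mult_indicator integrable_of_real integrable_dens ell2_add_scaled) auto
  have "(LINT x:B|dominating_measure. cdens \<phi> \<psi> x) = (\<integral>x. (\<Sum>\<zeta>\<in>{1, -1, \<i>, -\<i>}. 
      cnj \<zeta> * (indicator B x *\<^sub>R of_real (dens (\<lambda>n. \<phi> n + \<zeta> * \<psi> n) x))) / 4 \<partial>dominating_measure)"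
    unfolding set_lebesgue_integral_def cdens_def
    by (intro Bochner_Integration.integral_cong) (auto simp: scaleR_sum_right algebra_simps)
  also have "\<dots> = (\<integral>x. (\<Sum>\<zeta>\<in>{1, -1, \<i>, -\<i>}. 
      cnj \<zeta> * (indicator B x *\<^sub>R of_real (dens (\<lambda>n. \<phi> n + \<zeta> * \<psi> n) x))) \<partial>dominating_measure) / 4"
    by simp
  also have "\<dots> = (\<Sum>\<zeta>\<in>{1, -1, \<i>, -\<i>}. cnj \<zeta> * 
     (LINT x:B|dominating_measure. complex_of_real (dens (\<lambda>n. \<phi> n + \<zeta> * \<psi> n) x))) / 4"
    unfolding set_lebesgue_integral_def
    by (simp only: Bochner_Integration.integral_sum[OF integrable_mult_right[OF *]] integral_mult_right_zero)
  also have "\<dots> = (\<Sum>\<zeta>\<in>{1, -1, \<i>, -\<i>}. cnj \<zeta> * form (\<lambda>n. \<phi> n + \<zeta> * \<psi> n) (\<lambda>n. \<phi> n + \<zeta> * \<psi> n) B) / 4"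
    using assms by (intro arg_cong[where f="\<lambda>x. x / 4"] sum.cong refl) (simp add: set_integral_dens ell2_add_scaled)
  also have "\<dots> = form \<phi> \<psi> B"
    using assms by (intro polarization[where q="\<lambda>\<phi>. form \<phi> \<phi> B" and B="\<lambda>\<phi> \<psi>. form \<phi> \<psi> B"] form_add_scaled) 
  finally show ?thesis .
qed

lemma AE_eq_cdensI:
  assumes "\<phi> \<in> ell2" "\<psi> \<in> ell2" "integrable dominating_measure g"
    and "\<And>B. B \<in> sets borel \<Longrightarrow> (LINT x:B|dominating_measure. g x) = form \<phi> \<psi> B"
  shows "AE x in dominating_measure. g x = cdens \<phi> \<psi> x"
  using assms by (intro dom.density_unique_banach integrable_cdens) (simp_all add: set_integral_cdens)

lemma cdens_self:
  assumes "\<phi> \<in> ell2"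
  shows "AE x in dominating_measure. complex_of_real (dens \<phi> x) = cdens \<phi> \<phi> x"
  using assms by (intro AE_eq_cdensI integrable_of_real integrable_dens set_integral_dens)

text \<open>Parallelogram law: the four positive densities inside \<open>cdens\<close> add up to 4
  times the right-hand side. This takes the place of Cauchy-Schwarz.\<close>

lemma norm_cdens_le:
  assumes "\<phi> \<in> ell2" "\<psi> \<in> ell2"
  shows "AE x in dominating_measure. cmod (cdens \<phi> \<psi> x) \<le> dens \<phi> x + dens \<psi> x"
proof -
  let ?S = "{1, -1, \<i>, -\<i>}"
  have ne: "1 \<noteq> \<i>" "1 \<noteq> -\<i>" "-1 \<noteq> \<i>" by (auto simp: complex_eq_iff)
  let ?D = "\<lambda>x. \<Sum>\<zeta>\<in>?S. complex_of_real (dens (\<lambda>n. \<phi> n + \<zeta> * \<psi> n) x)"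
  have i: "integrable dominating_measure (\<lambda>x. complex_of_real (dens (\<lambda>n. \<phi> n + \<zeta> * \<psi> n) x))" for \<zeta>
    using assms by (intro integrable_of_real integrable_dens ell2_add_scaled) auto
  have "AE x in dominating_measure. ?D x = 4 * (complex_of_real (dens \<phi> x) + complex_of_real (dens \<psi> x))"
  proof (rule dom.density_unique_banach)
    show "integrable dominating_measure ?D" by (intro Bochner_Integration.integrable_sum i)
    show "integrable dominating_measure (\<lambda>x. 4 * (complex_of_real (dens \<phi> x) + complex_of_real (dens \<psi> x)))"
      using assms by (intro integrable_mult_right Bochner_Integration.integrable_add integrable_of_real integrable_dens)
    fix B assume "B \<in> sets dominating_measure"
    then have B: "B \<in> sets borel" by simp
    have "(LINT x:B|dominating_measure. ?D x) = (\<Sum>\<zeta>\<in>?S. LINT x:B|dominating_measure. complex_of_real (dens (\<lambda>n. \<phi> n + \<zeta> * \<psi> n) x))"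
      unfolding set_lebesgue_integral_def scaleR_sum_right using B
      by (intro Bochner_Integration.integral_sum integrable_mult_indicator i) auto
    also have "\<dots> = (\<Sum>\<zeta>\<in>?S. form (\<lambda>n. \<phi> n + \<zeta> * \<psi> n) (\<lambda>n. \<phi> n + \<zeta> * \<psi> n) B)"
      using assms B by (intro sum.cong refl) (simp add: set_integral_dens ell2_add_scaled)
    also have "\<dots> = 4 * (form \<phi> \<phi> B + form \<psi> \<psi> B)"
      using ne unfolding form_add_scaled[OF B assms] by (simp add: complex_eq_iff algebra_simps)
    also have "\<dots> = (LINT x:B|dominating_measure. 4 * (complex_of_real (dens \<phi> x) + complex_of_real (dens \<psi> x)))"
      using assms B by (subst set_integral_mult_right, subst set_integral_add)
        (simp_all add: set_integral_dens set_integrable_def integrable_mult_indicator integrable_of_real integrable_dens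
            del: scaleR_conv_of_real)
    finally show "(LINT x:B|dominating_measure. ?D x)
      = (LINT x:B|dominating_measure. 4 * (complex_of_real (dens \<phi> x) + complex_of_real (dens \<psi> x)))" .
  qed
  then show ?thesis
  proof eventually_elim
    case (elim x)
    have "cmod (cdens \<phi> \<psi> x) \<le> (\<Sum>\<zeta>\<in>?S. cmod (cnj \<zeta> * of_real (dens (\<lambda>n. \<phi> n + \<zeta> * \<psi> n) x))) / 4"
      unfolding cdens_def norm_divide by (simp add: divide_right_mono norm_sum del: sum.insert)
    also have "\<dots> = (\<Sum>\<zeta>\<in>?S. dens (\<lambda>n. \<phi> n + \<zeta> * \<psi> n) x) / 4"
      using dens_nonneg[OF ell2_add_scaled[OF assms]] ne by (simp add: norm_mult del: of_real_add)
    also have "(\<Sum>\<zeta>\<in>?S. dens (\<lambda>n. \<phi> n + \<zeta> * \<psi> n) x) = 4 * (dens \<phi> x + dens \<psi> x)"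
    proof -
      have "complex_of_real (\<Sum>\<zeta>\<in>?S. dens (\<lambda>n. \<phi> n + \<zeta> * \<psi> n) x) = complex_of_real (4 * (dens \<phi> x + dens \<psi> x))"
        using elim by (simp del: sum.insert)
      then show ?thesis by (simp only: of_real_eq_iff)
    qed
    finally show ?case by simp
  qed
qed

text \<open>\<open>dominating_measure_ge\<close> holds on every Borel set and therefore passes to
  densities.\<close>

lemma dens_unit_le: "AE x in dominating_measure. dens (unit_seq n) x \<le> 1 + (real_of_int n)\<^sup>2"
proof -
  let ?c = "1 + (real_of_int n)\<^sup>2"
  have "AE x in dominating_measure. 0 \<le> ?c - dens (unit_seq n) x"
  proof (rule dom.density_nonneg)
    show "integrable dominating_measure (\<lambda>x. ?c - dens (unit_seq n) x)"
      by (intro Bochner_Integration.integrable_diff integrable_dens dom.integrable_const) simp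
    fix B assume "B \<in> sets dominating_measure"
    then have B: "B \<in> sets borel" by simp
    have "complex_of_real (LINT x:B|dominating_measure. dens (unit_seq n) x) = form (unit_seq n) (unit_seq n) B"
      using set_integral_dens[of "unit_seq n" B] B unfolding set_lebesgue_integral_def
      by (simp only: scaleR_conv_of_real of_real_mult[symmetric] integral_complex_of_real unit_seq_ell2) simp
    then have "(LINT x:B|dominating_measure. dens (unit_seq n) x) = Re (form (unit_seq n) (unit_seq n) B)"
      by (metis Re_complex_of_real)
    moreover have "Re (form (unit_seq n) (unit_seq n) B) \<le> ?c * measure dominating_measure B"
    proof -
      have "ennreal (Re (form (unit_seq n) (unit_seq n) B)) \<le> ennreal (?c * measure dominating_measure B)"
        using dominating_measure_ge[OF B, of n] B
        by (simp add: emeasure_pvm_measure dom.emeasure_eq_measure ennreal_mult)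
      then show ?thesis by (subst (asm) ennreal_le_iff) (auto intro!: mult_nonneg_nonneg)
    qed
    ultimately show "0 \<le> (LINT x:B|dominating_measure. ?c - dens (unit_seq n) x)"
    proof -
      have "integrable dominating_measure (\<lambda>x. indicat_real B x *\<^sub>R dens (unit_seq n) x)"
        using B by (intro integrable_mult_indicator integrable_dens) auto
      moreover have "integrable dominating_measure (indicat_real B)"
        using B by (intro integrable_real_indicator) (auto simp: less_top[symmetric])
      moreover assume "(LINT x:B|dominating_measure. dens (unit_seq n) x) = Re (form (unit_seq n) (unit_seq n) B)"
        "Re (form (unit_seq n) (unit_seq n) B) \<le> ?c * measure dominating_measure B"
      ultimately show ?thesis
        using B by (subst set_integral_diff)
          (auto simp: set_integrable_def set_lebesgue_integral_def mult.commute)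
    qed
  qed
  then show ?thesis by simp
qed

end

text \<open>The matrix element of the \<open>k\<close>-th power of the Jacobi operator between basis
  vectors \<open>n\<close> and \<open>m\<close>. The recursion exhibits it as a polynomial in
  finitely many coefficients and their conjugates, which makes it measurable in \<omega>
  later.\<close>

primrec jacobi_moment :: "(int \<Rightarrow> complex) \<Rightarrow> (int \<Rightarrow> real) \<Rightarrow> nat \<Rightarrow> int \<Rightarrow> int \<Rightarrow> complex" where
  "jacobi_moment a b 0 n m = (if n = m then 1 else 0)"
| "jacobi_moment a b (Suc k) n m = of_real (b n) * jacobi_moment a b k n m
     + a n * jacobi_moment a b k (n + 1) m + cnj (a (n - 1)) * jacobi_moment a b k (n - 1) m"

lemma norm_jacobi_moment_le:
  assumes "\<And>n. cmod (a n) \<le> C" "\<And>n. \<bar>b n\<bar> \<le> C"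
  shows "cmod (jacobi_moment a b k n m) \<le> (3 * C) ^ k"
proof (induction k arbitrary: n)
  case (Suc k)
  have "0 \<le> C" using assms(2)[of 0] by linarith
  then have *: "cmod (c * jacobi_moment a b k i m) \<le> C * (3 * C) ^ k" if "cmod c \<le> C" for c i
    unfolding norm_mult using that Suc[of i] by (intro mult_mono) auto
  have "cmod (jacobi_moment a b (Suc k) n m) \<le> cmod (of_real (b n) * jacobi_moment a b k n m)
     + cmod (a n * jacobi_moment a b k (n + 1) m) + cmod (cnj (a (n - 1)) * jacobi_moment a b k (n - 1) m)"
    by (simp add: norm_triangle_le)
  also have "\<dots> \<le> C * (3 * C) ^ k + C * (3 * C) ^ k + C * (3 * C) ^ k"
    using assms by (intro add_mono *) auto
  finally show ?case by (simp add: algebra_simps)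
qed auto

section \<open>Generalised eigenfunctions, moments and support of spectral measures of a Jacobi
  operator\<close>

locale jacobi_resolution = pvm E
  for E :: "real set \<Rightarrow> (int \<Rightarrow> complex) \<Rightarrow> (int \<Rightarrow> complex)" +
  fixes a :: "int \<Rightarrow> complex" and b :: "int \<Rightarrow> real" and C :: real
  assumes resolution: "spectral_resolution (jacobi_op a b) E"
    and a_le: "\<And>n. cmod (a n) \<le> C" and b_le: "\<And>n. \<bar>b n\<bar> \<le> C"
begin

abbreviation "J \<equiv> jacobi_op a b"

lemma J_ell2 [simp]: "\<phi> \<in> ell2 \<Longrightarrow> J \<phi> \<in> ell2"
  using a_le b_le by (rule jacobi_op_ell2)

lemma bounded_support: "\<exists>R. AE x in dominating_measure. \<bar>x\<bar> \<le> R"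
proof -
  obtain R where R: "\<And>\<phi>. \<phi> \<in> ell2 \<Longrightarrow> E {-R..R} \<phi> = \<phi>"
    using resolution by (auto simp: spectral_resolution_def)
  have "emeasure (pvm_measure E \<phi>) (- {-R..R}) = 0" if \<phi>: "\<phi> \<in> ell2" for \<phi>
  proof -
    have "form \<phi> \<phi> (- {-R..R}) = form \<phi> \<phi> {}"
      using E_Int[of "- {-R..R}" "{-R..R}" \<phi>] \<phi> by (simp add: form_def R borel_comp)
    then have "emeasure (pvm_measure E \<phi>) (- {-R..R}) = emeasure (pvm_measure E \<phi>) {}"
      using \<phi> by (simp only: emeasure_pvm_measure borel_comp atLeastAtMost_borel sets.empty_sets)
    then show ?thesis by simp
  qed
  then have "emeasure dominating_measure (- {-R..R}) = 0"
    by (simp add: emeasure_dominating_measure borel_comp)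
  then have "- {-R..R} \<in> null_sets dominating_measure" by (simp add: null_sets_def borel_comp)
  then have "AE x in dominating_measure. x \<notin> - {-R..R}" by (rule AE_not_in)
  then show ?thesis by (intro exI[of _ R]) auto
qed

lemma integrable_times_power:
  fixes g :: "real \<Rightarrow> complex"
  assumes "integrable dominating_measure g"
  shows "integrable dominating_measure (\<lambda>x. of_real (x ^ k) * g x)"
proof -
  obtain R where R: "AE x in dominating_measure. \<bar>x\<bar> \<le> R" using bounded_support by auto
  show ?thesis
  proof (rule Bochner_Integration.integrable_bound)
    show "integrable dominating_measure (\<lambda>x. R ^ k *\<^sub>R g x)" using assms by simp
    show "AE x in dominating_measure. norm (of_real (x ^ k) * g x) \<le> norm (R ^ k *\<^sub>R g x)"
      using R by eventually_elim (auto simp: norm_mult norm_power power_abs abs_mult intro!: mult_right_mono power_mono)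
    show "(\<lambda>x. of_real (x ^ k) * g x) \<in> borel_measurable dominating_measure"
      using borel_measurable_integrable[OF assms] by measurable
  qed
qed

lemma integral_times_dens:
  assumes "\<phi> \<in> ell2"
  shows "ell2_inner \<phi> (J \<phi>) = (\<integral>x. of_real x * of_real (dens \<phi> x) \<partial>dominating_measure)"
proof -
  have "ell2_inner \<phi> (J \<phi>) = complex_of_real (\<integral>x. x \<partial>pvm_measure E \<phi>)"
    using resolution assms by (simp add: spectral_resolution_def)
  also have "(\<integral>x. x \<partial>pvm_measure E \<phi>) = (\<integral>x. x * dens \<phi> x \<partial>dominating_measure)"
    using assms by (simp add: integral_pvm_measure mult.commute)
  also have "complex_of_real \<dots> = (\<integral>x. of_real x * of_real (dens \<phi> x) \<partial>dominating_measure)"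
    by (simp only: integral_complex_of_real of_real_mult[symmetric])
  finally show ?thesis .
qed

text \<open>The spectral resolution is given only through its quadratic form; polarization recovers
  the off-diagonal elements.\<close>

lemma integral_times_cdens:
  assumes "\<phi> \<in> ell2" "\<psi> \<in> ell2"
  shows "ell2_inner \<phi> (J \<psi>) = (\<integral>x. of_real x * cdens \<phi> \<psi> x \<partial>dominating_measure)"
proof -
  have i: "integrable dominating_measure (\<lambda>x. complex_of_real x * of_real (dens (\<lambda>n. \<phi> n + \<zeta> * \<psi> n) x))" for \<zeta>
    using integrable_times_power[OF integrable_of_real[OF integrable_dens[OF ell2_add_scaled[OF assms, of \<zeta>]]], of 1]
    by simp
  have "(\<integral>x. of_real x * cdens \<phi> \<psi> x \<partial>dominating_measure) = (\<integral>x. (\<Sum>\<zeta>\<in>{1, -1, \<i>, -\<i>}. 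
      cnj \<zeta> * (of_real x * of_real (dens (\<lambda>n. \<phi> n + \<zeta> * \<psi> n) x))) / 4 \<partial>dominating_measure)"
    unfolding cdens_def
    by (intro Bochner_Integration.integral_cong refl) (simp add: sum_distrib_left algebra_simps del: sum.insert)
  also have "\<dots> = (\<integral>x. (\<Sum>\<zeta>\<in>{1, -1, \<i>, -\<i>}. 
      cnj \<zeta> * (of_real x * of_real (dens (\<lambda>n. \<phi> n + \<zeta> * \<psi> n) x))) \<partial>dominating_measure) / 4"
    by simp
  also have "\<dots> = (\<Sum>\<zeta>\<in>{1, -1, \<i>, -\<i>}. cnj \<zeta> * 
      (\<integral>x. of_real x * of_real (dens (\<lambda>n. \<phi> n + \<zeta> * \<psi> n) x) \<partial>dominating_measure)) / 4"
    by (simp only: Bochner_Integration.integral_sum[OF integrable_mult_right[OF i]] integral_mult_right_zero)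
  also have "\<dots> = (\<Sum>\<zeta>\<in>{1, -1, \<i>, -\<i>}. cnj \<zeta> * ell2_inner (\<lambda>n. \<phi> n + \<zeta> * \<psi> n) (J (\<lambda>n. \<phi> n + \<zeta> * \<psi> n))) / 4"
    using assms by (intro arg_cong[where f="\<lambda>x. x / 4"] sum.cong refl) (simp add: integral_times_dens ell2_add_scaled)
  also have "\<dots> = ell2_inner \<phi> (J \<psi>)"
  proof (rule polarization[where q="\<lambda>\<phi>. ell2_inner \<phi> (J \<phi>)" and B="\<lambda>\<phi> \<psi>. ell2_inner \<phi> (J \<psi>)"])
    fix \<zeta>
    have *: "(\<lambda>n. \<phi> n + \<zeta> * \<psi> n) = (\<lambda>n. 1 * \<phi> n + \<zeta> * \<psi> n)" by simp
    have "(\<lambda>n. 1 * \<phi> n + \<zeta> * \<psi> n) \<in> ell2" by (intro ell2_lincomb assms)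
    then show "ell2_inner (\<lambda>n. \<phi> n + \<zeta> * \<psi> n) (J (\<lambda>n. \<phi> n + \<zeta> * \<psi> n)) = ell2_inner \<phi> (J \<phi>)
      + \<zeta> * ell2_inner \<phi> (J \<psi>) + cnj \<zeta> * ell2_inner \<psi> (J \<phi>) + cnj \<zeta> * \<zeta> * ell2_inner \<psi> (J \<psi>)"
      unfolding * jacobi_op_linear using assms
      by (simp only: ell2_inner_lincomb_left ell2_inner_lincomb_right ell2_lincomb J_ell2 complex_cnj_one)
        (simp add: algebra_simps)
  qed
  finally show ?thesis by simp
qed

text \<open>Cutting the density off to \<open>B\<close> amounts to applying \<open>E B\<close> to
  the vector, since projections of Borel sets multiply by intersection. It allows the operator
  identity to be localised to arbitrary Borel sets.\<close>

lemma cdens_restrict: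
  assumes "\<phi> \<in> ell2" "\<psi> \<in> ell2" "B \<in> sets borel"
  shows "AE x in dominating_measure. indicat_real B x *\<^sub>R cdens \<phi> \<psi> x = cdens \<phi> (E B \<psi>) x"
proof (rule AE_eq_cdensI)
  show "integrable dominating_measure (\<lambda>x. indicat_real B x *\<^sub>R cdens \<phi> \<psi> x)"
    using assms by (intro integrable_mult_indicator integrable_cdens) auto
  fix D :: "real set" assume D: "D \<in> sets borel"
  have "(LINT x:D|dominating_measure. indicat_real B x *\<^sub>R cdens \<phi> \<psi> x)
      = (LINT x:D \<inter> B|dominating_measure. cdens \<phi> \<psi> x)"
    unfolding set_lebesgue_integral_def by (intro Bochner_Integration.integral_cong) (auto simp: indicator_def)
  also have "\<dots> = form \<phi> (E B \<psi>) D"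
    using assms D by (simp add: set_integral_cdens form_def E_Int)
  finally show "(LINT x:D|dominating_measure. indicat_real B x *\<^sub>R cdens \<phi> \<psi> x) = form \<phi> (E B \<psi>) D" .
qed (intro assms E_ell2)+

text \<open>The densities \<open>cdens (unit_seq n) \<psi> x\<close>, as functions of \<open>n\<close>, are the generalised
  eigenfunctions at the energy \<open>x\<close>.\<close>

lemma cdens_jacobi:
  assumes \<psi>: "\<psi> \<in> ell2"
  shows "AE x in dominating_measure. J (\<lambda>n. cdens (unit_seq n) \<psi> x) n = of_real x * cdens (unit_seq n) \<psi> x"
  unfolding jacobi_op_def
proof (rule dom.density_unique_banach)
  let ?c = "\<lambda>n x. cdens (unit_seq n) \<psi> x"
  have i: "integrable dominating_measure (?c n)" for n
    using \<psi> by (intro integrable_cdens) auto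
  show "integrable dominating_measure (\<lambda>x. of_real (b n) * ?c n x + a n * ?c (n + 1) x + cnj (a (n - 1)) * ?c (n - 1) x)"
    by (intro Bochner_Integration.integrable_add integrable_mult_right i)
  show "integrable dominating_measure (\<lambda>x. of_real x * ?c n x)"
    using integrable_times_power[OF i, of 1] by simp
  fix B assume "B \<in> sets dominating_measure"
  then have B: "B \<in> sets borel" by simp
  have ib: "integrable dominating_measure (\<lambda>x. indicat_real B x *\<^sub>R ?c n x)" for n
    using B by (intro integrable_mult_indicator i) auto
  have "(LINT x:B|dominating_measure. of_real (b n) * ?c n x + a n * ?c (n + 1) x + cnj (a (n - 1)) * ?c (n - 1) x)
    = (\<integral>x. of_real (b n) * (indicat_real B x *\<^sub>R ?c n x) + a n * (indicat_real B x *\<^sub>R ?c (n + 1) x)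
         + cnj (a (n - 1)) * (indicat_real B x *\<^sub>R ?c (n - 1) x) \<partial>dominating_measure)"
    unfolding set_lebesgue_integral_def
    by (intro Bochner_Integration.integral_cong) (auto simp: algebra_simps)
  also have "\<dots> = of_real (b n) * form (unit_seq n) \<psi> B + a n * form (unit_seq (n + 1)) \<psi> B
      + cnj (a (n - 1)) * form (unit_seq (n - 1)) \<psi> B"
    using ib set_integral_cdens[OF unit_seq_ell2 \<psi> B] unfolding set_lebesgue_integral_def
    by (simp only: Bochner_Integration.integral_add Bochner_Integration.integrable_add integrable_mult_right integral_mult_right_zero)
  \<comment> \<open>The numbers \<open>form (unit_seq n) \<psi> B\<close> are the coordinates of the
    sequence \<open>E B \<psi>\<close>, so the three terms combine to coordinate \<open>n\<close> of
    \<open>J\<close> applied to it.\<close>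
  also have "\<dots> = ell2_inner (unit_seq n) (J (E B \<psi>))"
    by (simp add: form_def jacobi_op_def)
  also have "\<dots> = (\<integral>x. of_real x * cdens (unit_seq n) (E B \<psi>) x \<partial>dominating_measure)"
    by (intro integral_times_cdens unit_seq_ell2 E_ell2 \<psi> B)
  also have "\<dots> = (\<integral>x. of_real x * (indicat_real B x *\<^sub>R ?c n x) \<partial>dominating_measure)"
  proof (rule integral_cong_AE)
    show "(\<lambda>x. of_real x * cdens (unit_seq n) (E B \<psi>) x) \<in> borel_measurable dominating_measure"
      using borel_measurable_integrable[OF integrable_cdens[OF unit_seq_ell2 E_ell2[OF B \<psi>]], of n] by measurable
    show "(\<lambda>x. of_real x * (indicat_real B x *\<^sub>R ?c n x)) \<in> borel_measurable dominating_measure"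
      using borel_measurable_integrable[OF ib, of n] by measurable
    show "AE x in dominating_measure. of_real x * cdens (unit_seq n) (E B \<psi>) x = of_real x * (indicat_real B x *\<^sub>R ?c n x)"
      using cdens_restrict[OF unit_seq_ell2 \<psi> B, of n] by eventually_elim simp
  qed
  also have "\<dots> = (LINT x:B|dominating_measure. of_real x * ?c n x)"
    unfolding set_lebesgue_integral_def by (intro Bochner_Integration.integral_cong) auto
  finally show "(LINT x:B|dominating_measure. of_real (b n) * ?c n x + a n * ?c (n + 1) x + cnj (a (n - 1)) * ?c (n - 1) x)
    = (LINT x:B|dominating_measure. of_real x * ?c n x)" .
qed

text \<open>Guarantees a nonzero eigenfunction: the set where all basis densities vanish is null for
  each basis spectral measure, hence for their weighted sum.\<close>

lemma AE_dens_nonzero: "AE x in dominating_measure. \<exists>m. dens (unit_seq m) x \<noteq> 0"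
proof -
  let ?B = "{x. \<forall>m. dens (unit_seq m) x = 0}"
  have [measurable]: "dens (unit_seq m) \<in> borel_measurable borel" for m by (rule dens_measurable) simp
  have B: "?B \<in> sets borel" by measurable
  have "emeasure (pvm_measure E (unit_seq m)) ?B = 0" for m
  proof -
    have "form (unit_seq m) (unit_seq m) ?B = (\<integral>x. 0 \<partial>dominating_measure)"
      unfolding set_integral_dens[OF unit_seq_ell2 B, symmetric] set_lebesgue_integral_def
      by (intro Bochner_Integration.integral_cong refl) (auto simp: indicator_def)
    then show ?thesis using B by (simp add: emeasure_pvm_measure)
  qed
  then have "emeasure dominating_measure ?B = 0" using B by (simp add: emeasure_dominating_measure)
  then have "?B \<in> null_sets dominating_measure" using B by (simp add: null_sets_def)
  then have "AE x in dominating_measure. x \<notin> ?B" by (rule AE_not_in)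
  then show ?thesis by simp
qed

text \<open>The eigenfunction is a column \<open>m\<close> of the matrix of densities at
  \<open>x\<close>, with \<open>m\<close> depending on \<open>x\<close> and chosen so that the
  diagonal entry \<open>dens (unit_seq m) x\<close> is nonzero. Only countably many
  almost-everywhere statements, indexed by \<open>n\<close> and \<open>m\<close>, are
  intersected.\<close>

lemma AE_generalized_eigenfunction:
  "AE x in dominating_measure. \<exists>u K. (\<exists>n. u n \<noteq> 0) \<and> J u = (\<lambda>n. of_real x * u n) \<and>
     (\<forall>n. cmod (u n) \<le> K * (1 + (real_of_int n)\<^sup>2))"
proof -
  let ?\<delta> = unit_seq
  have "AE x in dominating_measure. (\<forall>n m. J (\<lambda>n. cdens (?\<delta> n) (?\<delta> m) x) n = of_real x * cdens (?\<delta> n) (?\<delta> m) x)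
     \<and> (\<forall>n m. cmod (cdens (?\<delta> n) (?\<delta> m) x) \<le> dens (?\<delta> n) x + dens (?\<delta> m) x)
     \<and> (\<forall>n. dens (?\<delta> n) x \<le> 1 + (real_of_int n)\<^sup>2) \<and> (\<forall>n. complex_of_real (dens (?\<delta> n) x) = cdens (?\<delta> n) (?\<delta> n) x)
     \<and> (\<exists>m. dens (?\<delta> m) x \<noteq> 0)"
    unfolding AE_all_countable AE_conj_iff
    by (intro conjI allI cdens_jacobi norm_cdens_le dens_unit_le cdens_self AE_dens_nonzero unit_seq_ell2)
  then show ?thesis
  proof eventually_elim
    case (elim x)
    then obtain m where m: "dens (?\<delta> m) x \<noteq> 0" by blast
    define u where "u = (\<lambda>n. cdens (?\<delta> n) (?\<delta> m) x)"
    have "u m \<noteq> 0" using elim m by (metis u_def of_real_eq_0_iff)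
    moreover have "J u = (\<lambda>n. of_real x * u n)" using elim unfolding u_def by blast
    moreover have "cmod (u n) \<le> (2 + (real_of_int m)\<^sup>2) * (1 + (real_of_int n)\<^sup>2)" for n
    proof -
      have "cmod (u n) \<le> (1 + (real_of_int n)\<^sup>2) + (1 + (real_of_int m)\<^sup>2)"
        using elim unfolding u_def by (meson add_mono order_trans)
      also have "\<dots> \<le> (2 + (real_of_int m)\<^sup>2) * (1 + (real_of_int n)\<^sup>2)"
        by (simp add: algebra_simps)
      finally show ?thesis .
    qed
    ultimately show ?case by blast
  qed
qed

text \<open>Schnol's theorem in contrapositive form, so that measurability is a question about
  \<open>B\<close> only.\<close>

lemma emeasure_pvm_generalized_eigenvalues:
  assumes B: "B \<in> sets borel" and \<phi>: "\<phi> \<in> ell2"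
    and no: "\<And>x u K n. x \<in> B \<Longrightarrow> J u = (\<lambda>n. of_real x * u n) \<Longrightarrow>
       (\<And>i. cmod (u i) \<le> K * (1 + (real_of_int i)\<^sup>2)) \<Longrightarrow> u n = 0"
  shows "emeasure (pvm_measure E \<phi>) B = 0"
proof -
  have "AE x in dominating_measure. x \<notin> B"
    using AE_generalized_eigenfunction
  proof eventually_elim
    case (elim x)
    then obtain u K n where "u n \<noteq> 0" "J u = (\<lambda>n. of_real x * u n)"
      "\<And>n. cmod (u n) \<le> K * (1 + (real_of_int n)\<^sup>2)" by auto
    then show ?case using no[of x u K n] by auto
  qed
  then have "B \<in> null_sets dominating_measure"
    using B by (subst (asm) AE_iff_null_sets[symmetric]) auto
  then show ?thesis
    using absolutely_continuous_dominating[OF \<phi>] by (auto simp: absolutely_continuous_def null_sets_def)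
qed

text \<open>By \<open>cdens_jacobi\<close> each factor \<open>x\<close> is traded for one step of
  the three-term recursion.\<close>

lemma integral_power_cdens:
  "(\<integral>x. of_real (x ^ k) * cdens (unit_seq n) (unit_seq m) x \<partial>dominating_measure) = jacobi_moment a b k n m"
proof (induction k arbitrary: n)
  case 0
  have "(\<integral>x. cdens (unit_seq n) (unit_seq m) x \<partial>dominating_measure)
      = (LINT x:UNIV|dominating_measure. cdens (unit_seq n) (unit_seq m) x)"
    by (simp add: set_lebesgue_integral_def)
  also have "\<dots> = form (unit_seq n) (unit_seq m) UNIV" by (intro set_integral_cdens) auto
  finally show ?case by (auto simp: form_def E_UNIV) (auto simp: unit_seq_def)
next
  case (Suc k)
  let ?c = "\<lambda>n x. cdens (unit_seq n) (unit_seq m) x"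
  have i: "integrable dominating_measure (\<lambda>x. of_real (x ^ k) * ?c n x)" for k n
    by (intro integrable_times_power integrable_cdens) auto
  have "(\<integral>x. of_real (x ^ Suc k) * ?c n x \<partial>dominating_measure)
     = (\<integral>x. of_real (b n) * (of_real (x ^ k) * ?c n x) + a n * (of_real (x ^ k) * ?c (n + 1) x)
         + cnj (a (n - 1)) * (of_real (x ^ k) * ?c (n - 1) x) \<partial>dominating_measure)"
  proof (rule integral_cong_AE)
    show "AE x in dominating_measure. of_real (x ^ Suc k) * ?c n x = of_real (b n) * (of_real (x ^ k) * ?c n x)
         + a n * (of_real (x ^ k) * ?c (n + 1) x) + cnj (a (n - 1)) * (of_real (x ^ k) * ?c (n - 1) x)"
      using cdens_jacobi[OF unit_seq_ell2, of m n]
    proof eventually_elim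
      case (elim x)
      have "of_real (x ^ Suc k) * ?c n x = of_real (x ^ k) * (of_real x * ?c n x)" by simp
      then show ?case unfolding elim[symmetric] jacobi_op_def by (simp add: algebra_simps)
    qed
  qed (intro borel_measurable_integrable Bochner_Integration.integrable_add integrable_mult_right i)+
  also have "\<dots> = jacobi_moment a b (Suc k) n m"
    using i by (simp only: Bochner_Integration.integral_add Bochner_Integration.integrable_add 
       integrable_mult_right integral_mult_right_zero Suc jacobi_moment.simps)
  finally show ?case .
qed

lemma integral_power_pvm_measure:
  shows "integrable (pvm_measure E (unit_seq n)) (\<lambda>x. x ^ k)"
    and "(\<integral>x. x ^ k \<partial>pvm_measure E (unit_seq n)) = Re (jacobi_moment a b k n n)"
proof -
  have i: "integrable dominating_measure (\<lambda>x. of_real (x ^ k) * complex_of_real (dens (unit_seq n) x))"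
    by (intro integrable_times_power integrable_of_real integrable_dens) simp
  have "integrable dominating_measure (\<lambda>x. Re (of_real (x ^ k) * complex_of_real (dens (unit_seq n) x)))"
    using i by (rule integrable_Re)
  then show "integrable (pvm_measure E (unit_seq n)) (\<lambda>x. x ^ k)"
    by (subst integrable_pvm_measure) (auto simp: mult.commute)
  have "complex_of_real (\<integral>x. x ^ k \<partial>pvm_measure E (unit_seq n))
      = (\<integral>x. of_real (x ^ k) * complex_of_real (dens (unit_seq n) x) \<partial>dominating_measure)"
    by (subst integral_pvm_measure) (simp_all only: integral_complex_of_real[symmetric] of_real_mult mult.commute unit_seq_ell2, auto)
  also have "\<dots> = (\<integral>x. of_real (x ^ k) * cdens (unit_seq n) (unit_seq n) x \<partial>dominating_measure)"
  proof (rule integral_cong_AE)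
    show "AE x in dominating_measure. of_real (x ^ k) * complex_of_real (dens (unit_seq n) x) =
        of_real (x ^ k) * cdens (unit_seq n) (unit_seq n) x"
      using cdens_self[OF unit_seq_ell2, of n] by eventually_elim simp
  qed (use i integrable_times_power[OF integrable_cdens[OF unit_seq_ell2 unit_seq_ell2]] in auto)
  also have "\<dots> = jacobi_moment a b k n n" by (rule integral_power_cdens)
  finally show "(\<integral>x. x ^ k \<partial>pvm_measure E (unit_seq n)) = Re (jacobi_moment a b k n n)"
    by (metis Re_complex_of_real)
qed

lemma prob_space_pvm_unit: "prob_space (pvm_measure E (unit_seq n))"
  by (rule prob_spaceI) (simp add: pvm_measure_unit_total)

text \<open>Markov's inequality for the moments of order \<open>2 * k\<close>: for c > 3C the mass
  of |x| >= c is at most (3C/c)^(2k), which tends to 0. The explicit radius is uniform in \<omega>,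
  unlike the one provided by the spectral resolution, and uniformity is what
  \<open>measurable_kernel_of_moments\<close> asks for.\<close>

lemma pvm_unit_support: "AE x in pvm_measure E (unit_seq n). \<bar>x\<bar> \<le> 3 * C"
proof -
  interpret P: prob_space "pvm_measure E (unit_seq n)" by (rule prob_space_pvm_unit)
  have C: "0 \<le> C" using b_le[of 0] by linarith
  have "AE x in pvm_measure E (unit_seq n). \<bar>x\<bar> < 3 * C + 1 / Suc j" for j
  proof -
    let ?c = "3 * C + 1 / Suc j"
    let ?A = "{x. ?c \<le> \<bar>x\<bar>}"
    have c: "0 < ?c" using C by (simp add: add_nonneg_pos)
    have A[measurable]: "?A \<in> sets borel" by measurable
    have "P.prob ?A \<le> ((3 * C / ?c)\<^sup>2) ^ k" for k
    proof -
      have "P.prob ?A = (\<integral>x. indicator ?A x \<partial>pvm_measure E (unit_seq n))" by simp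
      also have "\<dots> \<le> (\<integral>x. x ^ (2 * k) / ?c ^ (2 * k) \<partial>pvm_measure E (unit_seq n))"
      proof (intro integral_mono)
        show "integrable (pvm_measure E (unit_seq n)) (indicat_real ?A)"
          by (intro integrable_real_indicator) (auto simp: less_top[symmetric])
        show "integrable (pvm_measure E (unit_seq n)) (\<lambda>x. x ^ (2 * k) / ?c ^ (2 * k))"
          by (intro Bochner_Integration.integrable_divide integral_power_pvm_measure)
        fix x
        show "indicator ?A x \<le> x ^ (2 * k) / ?c ^ (2 * k)"
        proof (cases "x \<in> ?A")
          case True
          then have "?c ^ (2 * k) \<le> \<bar>x\<bar> ^ (2 * k)" using c by (intro power_mono) auto
          then show ?thesis using True c by (simp add: power_even_abs)
        qed (auto simp: zero_le_even_power)
      qed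
      also have "\<dots> = Re (jacobi_moment a b (2 * k) n n) / ?c ^ (2 * k)"
        by (simp add: integral_power_pvm_measure)
      also have "\<dots> \<le> (3 * C) ^ (2 * k) / ?c ^ (2 * k)"
        using order_trans[OF complex_Re_le_cmod norm_jacobi_moment_le[where a=a and b=b, OF a_le b_le]] c
        by (intro divide_right_mono) auto
      also have "\<dots> = ((3 * C / ?c)\<^sup>2) ^ k" by (simp add: power_divide power_mult)
      finally show ?thesis .
    qed
    moreover have "(\<lambda>k. ((3 * C / ?c)\<^sup>2) ^ k) \<longlonglongrightarrow> 0"
    proof (rule LIMSEQ_power_zero)
      have "3 * C / ?c < 1" "0 \<le> 3 * C / ?c" using c C by (simp_all add: divide_simps)
      then show "norm ((3 * C / ?c)\<^sup>2) < 1"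
        unfolding real_norm_def abs_power2 abs_square_less_1 by linarith
    qed
    ultimately have "P.prob ?A \<le> 0" by (intro LIMSEQ_le_const) auto
    then have "P.prob ?A = 0" by (simp add: antisym)
    then have "?A \<in> null_sets (pvm_measure E (unit_seq n))"
      by (simp add: null_sets_def P.emeasure_eq_measure)
    from AE_not_in[OF this] show ?thesis by eventually_elim simp
  qed
  then have "AE x in pvm_measure E (unit_seq n). \<forall>j. \<bar>x\<bar> < 3 * C + 1 / Suc j"
    unfolding AE_all_countable by blast
  then show ?thesis
  proof eventually_elim
    case (elim x)
    have "(\<lambda>j. 3 * C + 1 / Suc j) \<longlonglongrightarrow> 3 * C + 0"
      by (intro tendsto_add tendsto_const) (rule LIMSEQ_Suc[OF lim_1_over_n])
    then show ?case using elim by (intro LIMSEQ_le_const[of _ "3 * C"]) (auto intro: less_imp_le)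
  qed
qed

end

section \<open>Kernels determined by moments\<close>

text \<open>Weierstrass approximation, with error below \<open>1 / Suc j\<close>, of ramps equal to
  1 up to \<open>t\<close> and falling to 0 on the interval from t to t + 1/j. Placing the ramp to
  the right of \<open>t\<close> yields the closed half-line. The bound 2 is 1 for the ramp plus 1
  for the error.\<close>

lemma polynomials_tendsto_indicator_atMost:
  fixes t S :: real
  shows "\<exists>p. (\<forall>j::nat. real_polynomial_function (p j)) \<and>
     (\<forall>x. \<bar>x\<bar> \<le> S \<longrightarrow> (\<forall>j. \<bar>p j x\<bar> \<le> 2) \<and> (\<lambda>j. p j x) \<longlonglongrightarrow> indicator {..t} x)"
proof -
  define f where "f j x = max 0 (min 1 (1 - real j * (x - t)))" for j :: nat and x :: real
  have "\<exists>g. real_polynomial_function g \<and> (\<forall>x\<in>{-S..S}. \<bar>f j x - g x\<bar> < 1 / Suc j)" for j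
  proof -
    have "continuous_on {-S..S} (f j)" unfolding f_def by (intro continuous_intros)
    then show ?thesis
      using Stone_Weierstrass_real_polynomial_function[of "{-S..S}" "f j" "1 / Suc j"] by (metis compact_Icc of_nat_0_less_iff zero_less_Suc zero_less_divide_1_iff)
  qed
  then obtain p where p: "\<And>j. real_polynomial_function (p j)"
    "\<And>j x. x \<in> {-S..S} \<Longrightarrow> \<bar>f j x - p j x\<bar> < 1 / Suc j" by metis
  have f_lim: "(\<lambda>j. f j x) \<longlonglongrightarrow> indicator {..t} x" for x
  proof (cases "x \<le> t")
    case True
    then have "f j x = 1" for j by (simp add: f_def mult_nonneg_nonpos)
    then show ?thesis using True by simp
  next
    case False
    have "eventually (\<lambda>j. real j \<ge> 1 / (x - t)) sequentially"
      using filterlim_real_sequentially by (simp add: filterlim_at_top)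
    then have "eventually (\<lambda>j. f j x = 0) sequentially"
      by eventually_elim (use False in \<open>simp add: f_def divide_simps\<close>)
    then show ?thesis using False by (simp add: tendsto_eventually)
  qed
  have "\<bar>p j x\<bar> \<le> 2" if "\<bar>x\<bar> \<le> S" for j x
  proof -
    have "\<bar>f j x\<bar> \<le> 1" by (auto simp: f_def)
    moreover have "\<bar>f j x - p j x\<bar> < 1 / Suc j" using that by (intro p) auto
    moreover have "1 / real (Suc j) \<le> 1" by simp
    ultimately show ?thesis by linarith
  qed
  moreover have "(\<lambda>j. p j x) \<longlonglongrightarrow> indicator {..t} x" if "\<bar>x\<bar> \<le> S" for x
  proof -
    have "(\<lambda>j. f j x - p j x) \<longlonglongrightarrow> 0"
    proof (rule Lim_null_comparison)
      show "eventually (\<lambda>j. norm (f j x - p j x) \<le> 1 / Suc j) sequentially"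
      proof (intro always_eventually allI)
        fix j
        have "x \<in> {-S..S}" using that by auto
        from p(2)[OF this, of j] show "norm (f j x - p j x) \<le> 1 / Suc j" by simp
      qed
      show "(\<lambda>j. 1 / real (Suc j)) \<longlonglongrightarrow> 0" by (rule LIMSEQ_Suc[OF lim_1_over_n])
    qed
    from tendsto_diff[OF f_lim[of x] this] show ?thesis by simp
  qed
  ultimately show ?thesis using p(1) by blast
qed

text \<open>Half-lines generate the Borel sets, and the mass of a half-line is a limit of integrals
  of polynomials, that is, of linear combinations of moments. The common bound \<open>S\<close> on
  the supports lets one sequence of polynomials serve all \<omega>.\<close>

lemma measurable_kernel_of_moments:
  fixes K :: "'w \<Rightarrow> real measure"
  assumes prob: "\<And>\<omega>. \<omega> \<in> space M \<Longrightarrow> prob_space (K \<omega>)"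
    and sets: "\<And>\<omega>. \<omega> \<in> space M \<Longrightarrow> sets (K \<omega>) = sets borel"
    and supp: "\<And>\<omega>. \<omega> \<in> space M \<Longrightarrow> AE x in K \<omega>. \<bar>x\<bar> \<le> S"
    and moments: "\<And>k. (\<lambda>\<omega>. \<integral>x. x ^ k \<partial>K \<omega>) \<in> borel_measurable M"
  shows "K \<in> measurable M (subprob_algebra borel)"
proof (rule measurable_subprob_algebra_generated)
  show "sets (borel :: real measure) = sigma_sets UNIV (range atMost)"
    by (simp add: borel_eq_atMost)
  show "Int_stable (range (atMost :: real \<Rightarrow> real set))" by (auto simp: Int_stable_def)
  show "range (atMost :: real \<Rightarrow> real set) \<subseteq> Pow UNIV" by auto
  show "subprob_space (K \<omega>)" "sets (K \<omega>) = sets borel" if "\<omega> \<in> space M" for \<omega>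
    using prob[OF that] sets[OF that] by (auto intro: prob_space_imp_subprob_space)
  have "emeasure (K \<omega>) UNIV = 1" if "\<omega> \<in> space M" for \<omega>
    using prob_space.emeasure_space_1[OF prob[OF that]] sets_eq_imp_space_eq[OF sets[OF that]] by simp
  then show "(\<lambda>\<omega>. emeasure (K \<omega>) UNIV) \<in> borel_measurable M" by (simp cong: measurable_cong)
  fix A :: "real set" assume "A \<in> range atMost"
  then obtain t where A: "A = {..t}" by auto
  obtain p where p: "\<And>j. real_polynomial_function (p j)" "\<And>x j. \<bar>x\<bar> \<le> S \<Longrightarrow> \<bar>p j x\<bar> \<le> 2"
    "\<And>x. \<bar>x\<bar> \<le> S \<Longrightarrow> (\<lambda>j::nat. p j x) \<longlonglongrightarrow> indicator {..t} x"
    using polynomials_tendsto_indicator_atMost[of S t] by blast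
  have "(\<lambda>\<omega>. lim (\<lambda>j. \<integral>x. p j x \<partial>K \<omega>)) \<in> borel_measurable M"
  proof (rule borel_measurable_lim_metric)
    fix j
    obtain c n where cn: "p j = (\<lambda>x. \<Sum>i\<le>n. c i * x ^ i)"
      using p(1)[of j] real_polynomial_function_iff_sum by blast
    have "(\<integral>x. p j x \<partial>K \<omega>) = (\<Sum>i\<le>n. c i * (\<integral>x. x ^ i \<partial>K \<omega>))" if \<omega>: "\<omega> \<in> space M" for \<omega>
    proof -
      interpret prob_space "K \<omega>" by (rule prob[OF \<omega>])
      have [measurable_cong]: "sets (K \<omega>) = sets borel" by (rule sets[OF \<omega>])
      have "integrable (K \<omega>) (\<lambda>x. x ^ i)" for i
      proof (rule integrable_const_bound)
        show "AE x in K \<omega>. norm (x ^ i) \<le> S ^ i"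
          using supp[OF \<omega>] by eventually_elim (simp add: power_abs power_mono)
      qed measurable
      then show ?thesis unfolding cn by simp
    qed
    then show "(\<lambda>\<omega>. \<integral>x. p j x \<partial>K \<omega>) \<in> borel_measurable M"
      using moments by (simp cong: measurable_cong)
  qed
  then have "(\<lambda>\<omega>. ennreal (lim (\<lambda>j. \<integral>x. p j x \<partial>K \<omega>))) \<in> borel_measurable M" by measurable
  moreover have "emeasure (K \<omega>) A = ennreal (lim (\<lambda>j. \<integral>x. p j x \<partial>K \<omega>))" if \<omega>: "\<omega> \<in> space M" for \<omega>
  proof -
    interpret prob_space "K \<omega>" by (rule prob[OF \<omega>])
    have s [measurable_cong]: "sets (K \<omega>) = sets borel" by (rule sets[OF \<omega>])
    have p_meas: "p j \<in> borel_measurable (K \<omega>)" for j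
    proof -
      have "continuous_on UNIV (p j)"
        using p(1)[of j] by (intro continuous_on_polymonial_function) (simp add: real_polynomial_function_eq)
      then have "p j \<in> borel_measurable borel" by (rule borel_measurable_continuous_onI)
      then show ?thesis using s by (simp cong: measurable_cong_sets)
    qed
    have "(\<lambda>j. \<integral>x. p j x \<partial>K \<omega>) \<longlonglongrightarrow> (\<integral>x. indicator {..t} x \<partial>K \<omega>)"
    proof (rule integral_dominated_convergence)
      show "integrable (K \<omega>) (\<lambda>x. 2::real)" by simp
      show "AE x in K \<omega>. (\<lambda>j. p j x) \<longlonglongrightarrow> indicator {..t} x"
        using supp[OF \<omega>] by eventually_elim (rule p(3))
      show "AE x in K \<omega>. norm (p j x) \<le> 2" for j
        using supp[OF \<omega>] by eventually_elim (simp add: p(2))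
    qed (use p_meas s in auto)
    then have "lim (\<lambda>j. \<integral>x. p j x \<partial>K \<omega>) = prob A" by (simp add: limI A s)
    then show ?thesis by (simp add: emeasure_eq_measure)
  qed
  ultimately show "(\<lambda>\<omega>. emeasure (K \<omega>) A) \<in> borel_measurable M" by (simp cong: measurable_cong)
qed

section \<open>Solutions of the Jacobi equation\<close>

definition solution :: "(int \<Rightarrow> complex) \<Rightarrow> (int \<Rightarrow> real) \<Rightarrow> real \<Rightarrow> (int \<Rightarrow> complex) \<Rightarrow> bool" where
  "solution a b x u \<longleftrightarrow> jacobi_op a b u = (\<lambda>n. of_real x * u n)"

text \<open>The second component carries the weight \<open>cnj (a (n - 1))\<close>. With it the
  Wronskian has constant modulus, and one step costs at most a constant over
  \<open>cmod (a n)\<close> in either direction, with no division by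
  \<open>a (n - 1)\<close>.\<close>

definition state_norm :: "(int \<Rightarrow> complex) \<Rightarrow> (int \<Rightarrow> complex) \<Rightarrow> int \<Rightarrow> real" where
  "state_norm a u n = cmod (u n) + cmod (cnj (a (n - 1)) * u (n - 1))"

definition quadratically_bounded :: "(int \<Rightarrow> complex) \<Rightarrow> bool" where
  "quadratically_bounded u \<longleftrightarrow> (\<exists>K. \<forall>n. cmod (u n) \<le> K * (1 + (real_of_int n)\<^sup>2))"

definition wronskian :: "(int \<Rightarrow> complex) \<Rightarrow> (int \<Rightarrow> complex) \<Rightarrow> (int \<Rightarrow> complex) \<Rightarrow> int \<Rightarrow> complex" where
  "wronskian a u v n = u n * (cnj (a (n - 1)) * v (n - 1)) - v n * (cnj (a (n - 1)) * u (n - 1))"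

lemma solution_iff:
  "solution a b x u \<longleftrightarrow> (\<forall>n. a n * u (n + 1) = (of_real x - of_real (b n)) * u n - cnj (a (n - 1)) * u (n - 1))"
  by (auto simp: solution_def jacobi_op_def fun_eq_iff algebra_simps)

lemma solution_lincomb:
  "solution a b x u \<Longrightarrow> solution a b x v \<Longrightarrow> solution a b x (\<lambda>n. c * u n + d * v n)"
  unfolding solution_def jacobi_op_linear by (simp add: algebra_simps)

lemma state_norm_nonneg: "0 \<le> state_norm a u n"
  by (simp add: state_norm_def)

lemma state_norm_lincomb:
  "state_norm a (\<lambda>n. c * u n + d * v n) n \<le> cmod c * state_norm a u n + cmod d * state_norm a v n"
proof -
  have "cmod (c * u n + d * v n) \<le> cmod c * cmod (u n) + cmod d * cmod (v n)"
    using norm_triangle_ineq[of "c * u n" "d * v n"] by (simp add: norm_mult)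
  moreover have "cmod (cnj (a (n - 1)) * (c * u (n - 1) + d * v (n - 1)))
      \<le> cmod c * cmod (cnj (a (n - 1)) * u (n - 1)) + cmod d * cmod (cnj (a (n - 1)) * v (n - 1))"
    using norm_triangle_ineq[of "c * (cnj (a (n - 1)) * u (n - 1))" "d * (cnj (a (n - 1)) * v (n - 1))"]
    by (simp add: norm_mult algebra_simps)
  ultimately show ?thesis unfolding state_norm_def by (simp add: algebra_simps)
qed

lemma state_norm_scale: "state_norm a (\<lambda>n. c * u n) n = cmod c * state_norm a u n"
  by (simp add: state_norm_def norm_mult algebra_simps)

lemma state_norm_step:
  assumes sol: "solution a b x u" and a: "a n \<noteq> 0"
    and C: "\<bar>x\<bar> + \<bar>b n\<bar> + 1 + (cmod (a n))\<^sup>2 \<le> C"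
  shows "state_norm a u (n + 1) \<le> C / cmod (a n) * state_norm a u n"
    and "state_norm a u n \<le> C / cmod (a n) * state_norm a u (n + 1)"
proof -
  define p where "p = cmod (u n)"
  define q where "q = cmod (cnj (a (n - 1)) * u (n - 1))"
  define r where "r = cmod (u (n + 1))"
  define \<alpha> where "\<alpha> = cmod (a n)"
  have nn: "0 \<le> p" "0 \<le> q" "0 \<le> r" "0 < \<alpha>" using a by (auto simp: p_def q_def r_def \<alpha>_def)
  have eq: "a n * u (n + 1) = (of_real x - of_real (b n)) * u n - cnj (a (n - 1)) * u (n - 1)"
    using sol by (simp add: solution_iff)
  have xb: "cmod (of_real x - of_real (b n)) \<le> \<bar>x\<bar> + \<bar>b n\<bar>"
    by (metis norm_of_real norm_triangle_ineq4 real_norm_def of_real_diff)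
  have xp: "cmod ((of_real x - of_real (b n)) * u n) \<le> (\<bar>x\<bar> + \<bar>b n\<bar>) * p"
    unfolding norm_mult p_def by (intro mult_right_mono xb) simp
  have 1: "\<alpha> * r \<le> (\<bar>x\<bar> + \<bar>b n\<bar>) * p + q"
  proof -
    have "\<alpha> * r = cmod (a n * u (n + 1))" by (simp add: \<alpha>_def r_def norm_mult)
    also have "\<dots> \<le> cmod ((of_real x - of_real (b n)) * u n) + q"
      unfolding eq q_def by (rule norm_triangle_ineq4)
    finally show ?thesis using xp by simp
  qed
  have 2: "q \<le> (\<bar>x\<bar> + \<bar>b n\<bar>) * p + \<alpha> * r"
  proof -
    have "cnj (a (n - 1)) * u (n - 1) = (of_real x - of_real (b n)) * u n - a n * u (n + 1)"
      using eq by simp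
    then have "q \<le> cmod ((of_real x - of_real (b n)) * u n) + cmod (a n * u (n + 1))"
      unfolding q_def by (metis norm_triangle_ineq4)
    then show ?thesis using xp by (simp add: \<alpha>_def r_def norm_mult)
  qed
  have sn: "state_norm a u n = p + q" "state_norm a u (n + 1) = r + \<alpha> * p"
    by (simp_all add: state_norm_def p_def q_def r_def \<alpha>_def norm_mult)
  have "\<alpha> * (r + \<alpha> * p) \<le> (\<bar>x\<bar> + \<bar>b n\<bar> + \<alpha>\<^sup>2) * p + q"
    using 1 by (simp add: algebra_simps power2_eq_square)
  also have "\<dots> \<le> C * p + C * q"
  proof (intro add_mono mult_right_mono nn)
    show "\<bar>x\<bar> + \<bar>b n\<bar> + \<alpha>\<^sup>2 \<le> C" using C by (simp add: \<alpha>_def)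
    have "1 \<le> C" using C zero_le_power2[of "cmod (a n)"] by linarith
    then show "q \<le> C * q" using nn by (simp add: mult_le_cancel_right1)
  qed
  finally show "state_norm a u (n + 1) \<le> C / cmod (a n) * state_norm a u n"
    unfolding sn \<alpha>_def[symmetric] using nn by (simp add: field_simps)
  have "\<alpha> * (p + q) \<le> (\<bar>x\<bar> + \<bar>b n\<bar> + 1) * (\<alpha> * p) + \<alpha>\<^sup>2 * r"
    using mult_left_mono[OF 2, of \<alpha>] nn by (simp add: algebra_simps power2_eq_square)
  also have "\<dots> \<le> C * (\<alpha> * p) + C * r"
  proof (intro add_mono mult_right_mono)
    show "\<bar>x\<bar> + \<bar>b n\<bar> + 1 \<le> C" "\<alpha>\<^sup>2 \<le> C"
      using C zero_le_power2[of "\<alpha>"] unfolding \<alpha>_def[symmetric] by linarith+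
  qed (use nn in auto)
  finally show "state_norm a u n \<le> C / cmod (a n) * state_norm a u (n + 1)"
    unfolding sn \<alpha>_def[symmetric] using nn by (simp add: field_simps)
qed

lemma int_induct_both:
  fixes P :: "int \<Rightarrow> bool"
  assumes "P 0" "\<And>n. P n \<Longrightarrow> P (n + 1)" "\<And>n. P (n + 1) \<Longrightarrow> P n"
  shows "P n"
proof (induction n rule: int_induct[where k=0])
  case (step2 i) then show ?case using assms(3)[of "i - 1"] by simp
qed (use assms in auto)

lemma solution_eq_0:
  assumes sol: "solution a b x u" and a: "\<And>n. a n \<noteq> 0" and 0: "state_norm a u 0 = 0"
  shows "u n = 0"
proof -
  let ?C = "\<lambda>n. \<bar>x\<bar> + \<bar>b n\<bar> + 1 + (cmod (a n))\<^sup>2"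
  have "state_norm a u n = 0"
  proof (induction n rule: int_induct_both)
    case (2 n)
    then show ?case using state_norm_step(1)[OF sol a, of n "?C n"] state_norm_nonneg[of a u "n + 1"] by simp
  next
    case (3 n)
    then show ?case using state_norm_step(2)[OF sol a, of n "?C n"] state_norm_nonneg[of a u n] by simp
  qed (rule 0)
  then show ?thesis unfolding state_norm_def by (metis add_nonneg_eq_0_iff norm_eq_zero norm_ge_zero)
qed

lemma solution_eqI:
  assumes "solution a b x u" "solution a b x v" "\<And>n. a n \<noteq> 0" "u 0 = v 0" "u (- 1) = v (- 1)"
  shows "u = v"
proof
  fix n
  have "(\<lambda>n. 1 * u n + (- 1) * v n) n = 0"
    by (rule solution_eq_0[OF solution_lincomb[OF assms(1,2)] assms(3)]) (simp add: state_norm_def assms)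
  then show "u n = v n" by simp
qed

text \<open>One step multiplies the Wronskian by the phase \<open>cnj (a n) / a n\<close>, so for
  complex \<open>a\<close> it is the modulus that is conserved.\<close>

lemma norm_wronskian:
  assumes u: "solution a b x u" and v: "solution a b x v" and a: "\<And>n. a n \<noteq> 0"
  shows "cmod (wronskian a u v n) = cmod (wronskian a u v 0)"
proof -
  have step: "cmod (wronskian a u v (n + 1)) = cmod (wronskian a u v n)" for n
  proof -
    have eu: "a n * u (n + 1) = (of_real x - of_real (b n)) * u n - cnj (a (n - 1)) * u (n - 1)"
      and ev: "a n * v (n + 1) = (of_real x - of_real (b n)) * v n - cnj (a (n - 1)) * v (n - 1)"
      using u v by (auto simp: solution_iff)
    have "a n * wronskian a u v (n + 1) = cnj (a n) * ((a n * u (n + 1)) * v n - (a n * v (n + 1)) * u n)"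
      by (simp add: wronskian_def algebra_simps)
    also have "\<dots> = cnj (a n) * wronskian a u v n"
      unfolding eu ev by (simp add: wronskian_def algebra_simps)
    finally have "cmod (a n) * cmod (wronskian a u v (n + 1)) = cmod (a n) * cmod (wronskian a u v n)"
      by (metis complex_mod_cnj norm_mult)
    then show ?thesis using a[of n] by simp
  qed
  show ?thesis by (induction n rule: int_induct_both) (simp_all add: step)
qed

subsection \<open>Fundamental solutions\<close>

primrec forward_state :: "(int \<Rightarrow> complex) \<Rightarrow> (int \<Rightarrow> real) \<Rightarrow> real \<Rightarrow> complex \<times> complex \<Rightarrow> nat \<Rightarrow> complex \<times> complex" where
  "forward_state a b x s 0 = s"
| "forward_state a b x s (Suc n) =
    (((of_real x - of_real (b (int n))) * fst (forward_state a b x s n) - snd (forward_state a b x s n)) / a (int n),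
     cnj (a (int n)) * fst (forward_state a b x s n))"

text \<open>Entry \<open>n\<close> is \<open>(u (- n), cnj (a (- n - 1)) * u (- n - 1))\<close>; the
  recursion solves the equation at site \<open>- n - 1\<close> for its left neighbour.\<close>

primrec backward_state :: "(int \<Rightarrow> complex) \<Rightarrow> (int \<Rightarrow> real) \<Rightarrow> real \<Rightarrow> complex \<times> complex \<Rightarrow> nat \<Rightarrow> complex \<times> complex" where
  "backward_state a b x s 0 = s"
| "backward_state a b x s (Suc n) =
    (snd (backward_state a b x s n) / cnj (a (- int n - 1)),
     (of_real x - of_real (b (- int n - 1))) * (snd (backward_state a b x s n) / cnj (a (- int n - 1)))
       - a (- int n - 1) * fst (backward_state a b x s n))"

text \<open>The solution with state \<open>(u 0, cnj (a (- 1)) * u (- 1)) = s\<close> at the origin.\<close>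

definition jacobi_sol :: "(int \<Rightarrow> complex) \<Rightarrow> (int \<Rightarrow> real) \<Rightarrow> real \<Rightarrow> complex \<times> complex \<Rightarrow> int \<Rightarrow> complex" where
  "jacobi_sol a b x s n =
     (if 0 \<le> n then fst (forward_state a b x s (nat n)) else fst (backward_state a b x s (nat (- n))))"

lemma jacobi_sol_0: "jacobi_sol a b x s 0 = fst s"
  by (simp add: jacobi_sol_def)

lemma jacobi_sol_minus1: "jacobi_sol a b x s (- 1) = snd s / cnj (a (- 1))"
  by (simp add: jacobi_sol_def)

lemma state_norm_jacobi_sol_0: "a (- 1) \<noteq> 0 \<Longrightarrow> state_norm a (jacobi_sol a b x s) 0 = cmod (fst s) + cmod (snd s)"
  by (simp add: state_norm_def jacobi_sol_0 jacobi_sol_minus1)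

lemma solution_jacobi_sol:
  assumes a: "\<And>n. a n \<noteq> 0"
  shows "solution a b x (jacobi_sol a b x s)"
  unfolding solution_iff
proof
  fix n :: int
  let ?u = "jacobi_sol a b x s"
  show "a n * ?u (n + 1) = (of_real x - of_real (b n)) * ?u n - cnj (a (n - 1)) * ?u (n - 1)"
  proof (cases "n \<ge> 0")
    case True
    then obtain k where k: "n = int k" using nonneg_int_cases by blast
    have "cnj (a (int k - 1)) * ?u (int k - 1) = snd (forward_state a b x s k)"
    proof (cases k)
      case 0
      then show ?thesis using a[of "-1"] by (simp add: jacobi_sol_def)
    next
      case (Suc j)
      then show ?thesis by (simp add: jacobi_sol_def)
    qed
    moreover have "?u (int k + 1) = fst (forward_state a b x s (Suc k))"
      by (simp add: jacobi_sol_def nat_add_distrib)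
    moreover have "?u (int k) = fst (forward_state a b x s k)" by (simp add: jacobi_sol_def)
    ultimately show ?thesis using a[of "int k"] by (simp add: k)
  next
    case False
    define k where "k = nat (- n - 1)"
    have k: "n = - int k - 1" using False by (simp add: k_def)
    have n: "n < 0" "nat (- n) = Suc k" "n - 1 < 0" "nat (- (n - 1)) = Suc (Suc k)" using k by auto
    have 1: "?u n = fst (backward_state a b x s (Suc k))" using n by (simp add: jacobi_sol_def del: backward_state.simps)
    have 2: "?u (n - 1) = fst (backward_state a b x s (Suc (Suc k)))" using n by (simp add: jacobi_sol_def del: backward_state.simps)
    have 3: "?u (n + 1) = fst (backward_state a b x s k)"
      using k by (cases k) (auto simp: jacobi_sol_def nat_add_distrib)
    have e: "- int (Suc k) - 1 = n - 1" using k by simp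
    have "cnj (a (n - 1)) * ?u (n - 1) = snd (backward_state a b x s (Suc k))"
      unfolding 2 backward_state.simps(2)[of a b x s "Suc k"] e using a[of "n - 1"] by simp
    then show ?thesis unfolding 1 3 by (simp add: k)
  qed
qed

lemma jacobi_sol_of_state:
  assumes "solution a b x u" "\<And>n. a n \<noteq> 0"
  shows "u = jacobi_sol a b x (u 0, cnj (a (- 1)) * u (- 1))"
  using assms by (intro solution_eqI[OF assms(1) solution_jacobi_sol]) (auto simp: jacobi_sol_0 jacobi_sol_minus1)

lemma jacobi_sol_lincomb:
  assumes "\<And>n. a n \<noteq> 0"
  shows "jacobi_sol a b x s n = fst s * jacobi_sol a b x (1, 0) n + snd s * jacobi_sol a b x (0, 1) n"
proof -
  have "jacobi_sol a b x s = (\<lambda>n. fst s * jacobi_sol a b x (1, 0) n + snd s * jacobi_sol a b x (0, 1) n)"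
    using assms by (intro solution_eqI[where a=a and b=b and x=x] solution_lincomb solution_jacobi_sol)
      (auto simp: jacobi_sol_0 jacobi_sol_minus1)
  then show ?thesis by (rule fun_cong)
qed

text \<open>Dividing by a coefficient is multiplying by a constant, namely 0 if the coefficient is
  0. Continuity therefore holds at all parameters, as \<open>sets_Collect_ex_compact\<close>
  requires.\<close>

lemma continuous_on_state_norm_jacobi_sol:
  "continuous_on S (\<lambda>s. state_norm a (jacobi_sol a b x s) n)"
proof -
  have "continuous_on S (\<lambda>s. forward_state a b x s k)" for k
    by (induction k) (auto intro!: continuous_intros simp: divide_inverse)
  moreover have "continuous_on S (\<lambda>s. backward_state a b x s k)" for k
    by (induction k) (auto intro!: continuous_intros simp: divide_inverse)
  ultimately have "continuous_on S (\<lambda>s. jacobi_sol a b x s n)" for n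
    unfolding jacobi_sol_def by (cases "0 \<le> n") (auto intro!: continuous_intros)
  then show ?thesis unfolding state_norm_def by (intro continuous_intros)
qed

lemma measurable_state_norm_jacobi_sol:
  assumes [measurable]: "\<And>n. (\<lambda>p. a p n) \<in> borel_measurable N" "\<And>n. (\<lambda>p. b p n) \<in> borel_measurable N"
    "x \<in> borel_measurable N"
  shows "(\<lambda>p. state_norm (a p) (jacobi_sol (a p) (b p) (x p) s) n) \<in> borel_measurable N"
proof -
  have cnj_meas [measurable]: "cnj \<in> borel_measurable borel"
    by (intro borel_measurable_continuous_onI continuous_intros)
  have "(\<lambda>p. fst (forward_state (a p) (b p) (x p) s k)) \<in> borel_measurable N \<and>
     (\<lambda>p. snd (forward_state (a p) (b p) (x p) s k)) \<in> borel_measurable N" for k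
    by (induction k) auto
  moreover have "(\<lambda>p. fst (backward_state (a p) (b p) (x p) s k)) \<in> borel_measurable N \<and>
     (\<lambda>p. snd (backward_state (a p) (b p) (x p) s k)) \<in> borel_measurable N" for k
    by (induction k) auto
  ultimately have [measurable]: "(\<lambda>p. jacobi_sol (a p) (b p) (x p) s n) \<in> borel_measurable N" for n
    unfolding jacobi_sol_def by (cases "0 \<le> n") auto
  show ?thesis unfolding state_norm_def by measurable
qed

subsection \<open>Measurability of the existence of quadratically bounded solutions\<close>

text \<open>Replaces an uncountable existential by countable operations. By continuity a solution
  yields, for each \<open>k\<close>, a point of a countable dense set that satisfies the first
  constraints up to the error \<open>1 / Suc k\<close>; by compactness such approximate solutions
  accumulate at an exact one.\<close>

lemma sets_Collect_ex_compact:
  fixes f :: "'i::countable \<Rightarrow> 'p \<Rightarrow> 's::{metric_space, second_countable_topology} \<Rightarrow> real"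
  assumes S: "compact S"
    and cont: "\<And>i p. continuous_on S (f i p)"
    and meas: "\<And>i s. (\<lambda>p. f i p s) \<in> borel_measurable N"
  shows "{p \<in> space N. \<exists>s\<in>S. \<forall>i. f i p s \<le> 0} \<in> sets N"
proof -
  obtain D where D: "countable D" "D \<subseteq> S" "S \<subseteq> closure D" by (rule separable)
  have "(\<exists>s\<in>S. \<forall>i. f i p s \<le> 0) \<longleftrightarrow> (\<forall>k. \<exists>s\<in>D. \<forall>i. to_nat i \<le> k \<longrightarrow> f i p s < 1 / real (Suc k))" for p
  proof
    assume "\<exists>s\<in>S. \<forall>i. f i p s \<le> 0"
    then obtain s where s: "s \<in> S" "\<And>i. f i p s \<le> 0" by blast
    obtain d where d: "\<And>j. d j \<in> D" "d \<longlonglongrightarrow> s" using s D closure_sequential by blast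
    show "\<forall>k. \<exists>s\<in>D. \<forall>i. to_nat i \<le> k \<longrightarrow> f i p s < 1 / real (Suc k)"
    proof
      fix k
      have fin: "finite {i :: 'i. to_nat i \<le> k}"
        by (rule finite_imageD[of to_nat]) (auto intro: finite_subset[of _ "{..k}"] inj_on_subset[OF inj_to_nat])
      have "eventually (\<lambda>j. f i p (d j) < 1 / real (Suc k)) sequentially" for i
      proof -
        have "(\<lambda>j. f i p (d j)) \<longlonglongrightarrow> f i p s"
          using s d D by (intro continuous_on_tendsto_compose[OF cont] always_eventually) auto
        then show ?thesis using s(2)[of i] by (intro order_tendstoD(2)) (auto intro: le_less_trans)
      qed
      then have "eventually (\<lambda>j. \<forall>i\<in>{i. to_nat i \<le> k}. f i p (d j) < 1 / real (Suc k)) sequentially"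
        using fin by (intro eventually_ball_finite) auto
      then obtain j where "\<forall>i\<in>{i. to_nat i \<le> k}. f i p (d j) < 1 / real (Suc k)"
        using eventually_happens'[OF sequentially_bot] by blast
      then show "\<exists>s\<in>D. \<forall>i. to_nat i \<le> k \<longrightarrow> f i p s < 1 / real (Suc k)" using d(1) by blast
    qed
  next
    assume "\<forall>k. \<exists>s\<in>D. \<forall>i. to_nat i \<le> k \<longrightarrow> f i p s < 1 / real (Suc k)"
    then obtain d where d: "\<And>k. d k \<in> D" "\<And>k i. to_nat i \<le> k \<Longrightarrow> f i p (d k) < 1 / real (Suc k)" by metis
    obtain s r where s: "s \<in> S" and r: "strict_mono r" "(\<lambda>k. d (r k)) \<longlonglongrightarrow> s"
      using S d(1) D(2) unfolding compact_def o_def by blast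
    have "f i p s \<le> 0" for i
    proof (rule LIMSEQ_le)
      show "(\<lambda>k. f i p (d (r k))) \<longlonglongrightarrow> f i p s"
        using s d D r by (intro continuous_on_tendsto_compose[OF cont] always_eventually) auto
      show "(\<lambda>k. 1 / real (Suc k)) \<longlonglongrightarrow> 0" by (rule LIMSEQ_Suc[OF lim_1_over_n])
      have "f i p (d (r k)) \<le> 1 / real (Suc k)" if "k \<ge> to_nat i" for k
      proof -
        have rk: "k \<le> r k" using r(1) by (rule seq_suble)
        then have "f i p (d (r k)) < 1 / real (Suc (r k))" using that by (intro d(2)) simp
        also have "\<dots> \<le> 1 / real (Suc k)" using rk by (intro divide_left_mono) auto
        finally show ?thesis by simp
      qed
      then show "\<exists>M. \<forall>k\<ge>M. f i p (d (r k)) \<le> 1 / real (Suc k)" by blast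
    qed
    then show "\<exists>s\<in>S. \<forall>i. f i p s \<le> 0" using s by blast
  qed
  moreover have "{p \<in> space N. \<forall>k. \<exists>s\<in>D. \<forall>i. to_nat i \<le> k \<longrightarrow> f i p s < 1 / real (Suc k)} \<in> sets N"
    using D(1) meas by (intro sets.sets_Collect_countable_All sets.sets_Collect_countable_Ex'
       sets.sets_Collect_imp sets.sets_Collect_const borel_measurable_less) auto
  ultimately show ?thesis by simp
qed

text \<open>If both fundamental solutions are quadratically bounded, then so are all solutions. Otherwise the
  quadratically bounded solutions are unique up to scaling, so that the constant \<open>K\<close> of one of them
  serves for all; see \<open>tempered_bound\<close>.\<close>

definition tempered_both :: "(int \<Rightarrow> complex) \<Rightarrow> (int \<Rightarrow> real) \<Rightarrow> real \<Rightarrow> nat \<Rightarrow> bool" where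
  "tempered_both a b x K \<longleftrightarrow> (\<forall>n. state_norm a (jacobi_sol a b x (1, 0)) n \<le> real K * (1 + (real_of_int n)\<^sup>2)
     \<and> state_norm a (jacobi_sol a b x (0, 1)) n \<le> real K * (1 + (real_of_int n)\<^sup>2))"

definition tempered_some :: "(int \<Rightarrow> complex) \<Rightarrow> (int \<Rightarrow> real) \<Rightarrow> real \<Rightarrow> nat \<Rightarrow> bool" where
  "tempered_some a b x K \<longleftrightarrow> (\<exists>s\<in>sphere 0 1. \<forall>n. state_norm a (jacobi_sol a b x s) n \<le> real K * (1 + (real_of_int n)\<^sup>2))"

definition tempered :: "(int \<Rightarrow> complex) \<Rightarrow> (int \<Rightarrow> real) \<Rightarrow> real \<Rightarrow> nat \<Rightarrow> bool" where
  "tempered a b x K \<longleftrightarrow> tempered_both a b x K \<or> (\<nexists>K'. tempered_both a b x K') \<and> tempered_some a b x K"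

lemma tempered_mono:
  assumes "K \<le> K'" "tempered a b x K"
  shows "tempered a b x K'"
proof -
  have *: "t \<le> real K' * (1 + (real_of_int n)\<^sup>2)" if "t \<le> real K * (1 + (real_of_int n)\<^sup>2)" for t n
    using assms(1) that by (meson mult_right_mono of_nat_mono order_trans add_nonneg_nonneg zero_le_one zero_le_power2)
  show ?thesis using assms(2) unfolding tempered_def tempered_both_def tempered_some_def
    by (elim disjE) (blast intro: *)+
qed

lemma measurable_tempered:
  assumes a: "\<And>n. (\<lambda>p. a p n) \<in> borel_measurable N" and b: "\<And>n. (\<lambda>p. b p n) \<in> borel_measurable N"
    and x: "x \<in> borel_measurable N"
  shows "{p \<in> space N. tempered (a p) (b p) (x p) K} \<in> sets N"
proof -
  note m [measurable] = measurable_state_norm_jacobi_sol[where a=a and b=b and x=x, OF a b x]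
  have [measurable]: "{p \<in> space N. tempered_both (a p) (b p) (x p) K} \<in> sets N" for K
    unfolding tempered_both_def by measurable
  have [measurable]: "{p \<in> space N. tempered_some (a p) (b p) (x p) K} \<in> sets N"
  proof -
    have "{p \<in> space N. \<exists>s\<in>sphere 0 1. \<forall>n. state_norm (a p) (jacobi_sol (a p) (b p) (x p) s) n - real K * (1 + (real_of_int n)\<^sup>2) \<le> 0} \<in> sets N"
      by (rule sets_Collect_ex_compact) (auto intro!: continuous_intros continuous_on_state_norm_jacobi_sol)
    then show ?thesis unfolding tempered_some_def by simp
  qed
  show ?thesis unfolding tempered_def by measurable
qed

lemma quadratically_bounded_state_norm:
  assumes "quadratically_bounded u" "\<And>n. cmod (a n) \<le> A"
  shows "\<exists>K. \<forall>n. state_norm a u n \<le> real K * (1 + (real_of_int n)\<^sup>2)"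
proof -
  obtain K where K: "\<And>n. cmod (u n) \<le> K * (1 + (real_of_int n)\<^sup>2)"
    using assms(1) unfolding quadratically_bounded_def by blast
  have A0: "0 \<le> A" using assms(2)[of 0] norm_ge_zero[of "a 0"] by linarith
  have K0: "0 \<le> K" using order_trans[OF norm_ge_zero K[of 0]] by simp
  \<comment> \<open>The 3 comes from comparing the weight at \<open>n - 1\<close> with that at
    \<open>n\<close>: 1 + (n - 1)^2 <= 3 (1 + n^2).\<close>
  obtain L :: nat where L: "K + 3 * A * K \<le> real L" using real_arch_simple by blast
  have "state_norm a u n \<le> real L * (1 + (real_of_int n)\<^sup>2)" for n
  proof -
    have "0 \<le> (real_of_int n + 1)\<^sup>2" by simp
    then have "(real_of_int (n - 1))\<^sup>2 \<le> 2 * (real_of_int n)\<^sup>2 + 2"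
      by (simp add: power2_eq_square algebra_simps)
    then have n: "1 + (real_of_int (n - 1))\<^sup>2 \<le> 3 * (1 + (real_of_int n)\<^sup>2)"
      using zero_le_power2[of "real_of_int n"] unfolding distrib_left by linarith
    have "cmod (cnj (a (n - 1)) * u (n - 1)) \<le> A * (K * (1 + (real_of_int (n - 1))\<^sup>2))"
      unfolding norm_mult using assms(2)[of "n - 1"] K[of "n - 1"] A0 by (intro mult_mono) auto
    also have "\<dots> \<le> A * (K * (3 * (1 + (real_of_int n)\<^sup>2)))"
      using n A0 K0 by (intro mult_left_mono) auto
    finally have "state_norm a u n \<le> (K + 3 * A * K) * (1 + (real_of_int n)\<^sup>2)"
      unfolding state_norm_def using K[of n] by (simp add: algebra_simps)
    also have "\<dots> \<le> real L * (1 + (real_of_int n)\<^sup>2)" using L by (intro mult_right_mono) auto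
    finally show ?thesis .
  qed
  then show ?thesis by blast
qed

lemma norm_pair_le: "norm s \<le> cmod (fst s) + cmod (snd s)"
  by (metis norm_Pair_le prod.collapse)

text \<open>The bridge between two forms of resonance: \<open>tempered\<close> is measurable in the
  coefficients, while the existence of a solution is visibly invariant under shifts. To pass from
  right to left, a solution is rescaled so that its state at the origin lies on the unit
  sphere.\<close>

lemma tempered_exists_iff:
  assumes a: "\<And>n. a n \<noteq> 0" and A: "\<And>n. cmod (a n) \<le> A"
  shows "(\<exists>K. tempered a b x K) \<longleftrightarrow> (\<exists>u. solution a b x u \<and> quadratically_bounded u \<and> (\<exists>n. u n \<noteq> 0))"
proof
  assume "\<exists>K. tempered a b x K"
  then obtain K where K: "tempered a b x K" by blast
  have "\<exists>s K. s \<noteq> 0 \<and> (\<forall>n. state_norm a (jacobi_sol a b x s) n \<le> real K * (1 + (real_of_int n)\<^sup>2))"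
  proof (cases "tempered_both a b x K")
    case True
    then show ?thesis unfolding tempered_both_def
      by (intro exI[of _ "(1, 0)"] exI[of _ K]) (auto simp: zero_prod_def)
  next
    case False
    then show ?thesis using K unfolding tempered_def tempered_some_def
      by (metis dist_0_norm mem_sphere norm_zero zero_neq_one)
  qed
  then obtain s K where s: "s \<noteq> 0" and K: "\<And>n. state_norm a (jacobi_sol a b x s) n \<le> real K * (1 + (real_of_int n)\<^sup>2)"
    by blast
  let ?u = "jacobi_sol a b x s"
  have "cmod (?u n) \<le> real K * (1 + (real_of_int n)\<^sup>2)" for n
    using K[of n] norm_ge_zero[of "cnj (a (n - 1)) * ?u (n - 1)"] unfolding state_norm_def by linarith
  then have "quadratically_bounded ?u" unfolding quadratically_bounded_def by blast
  moreover have "\<exists>n. ?u n \<noteq> 0"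
  proof (rule ccontr)
    assume "\<nexists>n. ?u n \<noteq> 0"
    then have "state_norm a ?u 0 = 0" by (simp add: state_norm_def)
    then have "norm s \<le> 0" using norm_pair_le[of s] state_norm_jacobi_sol_0[of a b x s] a by simp
    then show False using s by simp
  qed
  ultimately show "\<exists>u. solution a b x u \<and> quadratically_bounded u \<and> (\<exists>n. u n \<noteq> 0)"
    using solution_jacobi_sol[where a=a, OF a] by blast
next
  assume "\<exists>u. solution a b x u \<and> quadratically_bounded u \<and> (\<exists>n. u n \<noteq> 0)"
  then obtain u where u: "solution a b x u" "quadratically_bounded u" "\<exists>n. u n \<noteq> 0" by blast
  show "\<exists>K. tempered a b x K"
  proof (cases "\<exists>K. tempered_both a b x K")
    case True
    then show ?thesis unfolding tempered_def by blast
  next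
    case False
    define s where "s = (u 0, cnj (a (- 1)) * u (- 1))"
    have us: "u = jacobi_sol a b x s" unfolding s_def by (rule jacobi_sol_of_state[OF u(1) a])
    have s0: "s \<noteq> 0"
    proof
      assume "s = 0"
      then have "state_norm a u 0 = 0" by (simp add: state_norm_def s_def zero_prod_def)
      then show False using solution_eq_0[OF u(1) a] u(3) by blast
    qed
    define c where "c = complex_of_real (1 / norm s)"
    define t where "t = (c * fst s, c * snd s)"
    have t: "t = (1 / norm s) *\<^sub>R s" by (simp add: t_def c_def prod_eq_iff scaleR_conv_of_real)
    have t1: "norm t = 1" unfolding t using s0 by simp
    have ut: "jacobi_sol a b x t = (\<lambda>n. c * u n)"
    proof
      fix n
      have "jacobi_sol a b x t n = fst t * jacobi_sol a b x (1, 0) n + snd t * jacobi_sol a b x (0, 1) n"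
        by (rule jacobi_sol_lincomb[OF a])
      also have "\<dots> = c * (fst s * jacobi_sol a b x (1, 0) n + snd s * jacobi_sol a b x (0, 1) n)"
        by (simp add: t_def algebra_simps)
      also have "fst s * jacobi_sol a b x (1, 0) n + snd s * jacobi_sol a b x (0, 1) n = u n"
        unfolding us by (rule jacobi_sol_lincomb[OF a, symmetric])
      finally show "jacobi_sol a b x t n = c * u n" .
    qed
    have "quadratically_bounded (\<lambda>n. c * u n)"
    proof -
      obtain K where "\<And>n. cmod (u n) \<le> K * (1 + (real_of_int n)\<^sup>2)"
        using u(2) unfolding quadratically_bounded_def by blast
      then have "cmod (c * u n) \<le> (cmod c * K) * (1 + (real_of_int n)\<^sup>2)" for n
        unfolding norm_mult mult.assoc by (intro mult_left_mono) auto
      then show ?thesis unfolding quadratically_bounded_def by blast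
    qed
    from quadratically_bounded_state_norm[where a=a, OF this A] obtain K where
      "\<And>n. state_norm a (\<lambda>n. c * u n) n \<le> real K * (1 + (real_of_int n)\<^sup>2)" by blast
    then have "\<forall>n. state_norm a (jacobi_sol a b x t) n \<le> real K * (1 + (real_of_int n)\<^sup>2)"
      unfolding ut by blast
    moreover have "t \<in> sphere 0 1" using t1 by simp
    ultimately have "tempered_some a b x K" unfolding tempered_some_def by blast
    then show ?thesis using False unfolding tempered_def by blast
  qed
qed

lemma tempered_both_if_wronskian_nonzero:
  assumes a: "\<And>n. a n \<noteq> 0" and A: "\<And>n. cmod (a n) \<le> A"
    and u: "solution a b x u" "quadratically_bounded u" and v: "solution a b x v" "quadratically_bounded v"
    and W: "wronskian a u v 0 \<noteq> 0"
  shows "\<exists>K. tempered_both a b x K"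
proof -
  obtain Ku where Ku: "\<And>n. state_norm a u n \<le> real Ku * (1 + (real_of_int n)\<^sup>2)"
    using quadratically_bounded_state_norm[where a=a, OF u(2) A] by blast
  obtain Kv where Kv: "\<And>n. state_norm a v n \<le> real Kv * (1 + (real_of_int n)\<^sup>2)"
    using quadratically_bounded_state_norm[where a=a, OF v(2) A] by blast
  define W where "W = wronskian a u v 0"
  define yu yv where "yu = cnj (a (- 1)) * u (- 1)" and "yv = cnj (a (- 1)) * v (- 1)"
  have Wdef: "W = u 0 * yv - v 0 * yu" by (simp add: W_def wronskian_def yu_def yv_def)
  have W0: "W \<noteq> 0" using W by (simp add: W_def)
  have bound: "\<exists>K. \<forall>n. state_norm a (\<lambda>n. c * u n + d * v n) n \<le> real K * (1 + (real_of_int n)\<^sup>2)" for c d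
  proof -
    obtain L :: nat where L: "cmod c * real Ku + cmod d * real Kv \<le> real L" using real_arch_simple by blast
    have "state_norm a (\<lambda>n. c * u n + d * v n) n \<le> real L * (1 + (real_of_int n)\<^sup>2)" for n
    proof -
      have "state_norm a (\<lambda>n. c * u n + d * v n) n \<le> cmod c * state_norm a u n + cmod d * state_norm a v n"
        by (rule state_norm_lincomb)
      also have "\<dots> \<le> cmod c * (real Ku * (1 + (real_of_int n)\<^sup>2)) + cmod d * (real Kv * (1 + (real_of_int n)\<^sup>2))"
        by (intro add_mono mult_left_mono Ku Kv) auto
      also have "\<dots> = (cmod c * real Ku + cmod d * real Kv) * (1 + (real_of_int n)\<^sup>2)" by (simp add: algebra_simps)
      also have "\<dots> \<le> real L * (1 + (real_of_int n)\<^sup>2)" using L by (intro mult_right_mono) auto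
      finally show ?thesis .
    qed
    then show ?thesis by blast
  qed
  \<comment> \<open>Cramer's rule for the coefficients of the state \<open>s\<close> in the basis
    formed by the states of \<open>u\<close> and \<open>v\<close> at the origin.\<close>
  have sol_eq: "jacobi_sol a b x s = (\<lambda>n. ((fst s * yv - v 0 * snd s) / W) * u n + ((u 0 * snd s - fst s * yu) / W) * v n)" for s
  proof (rule solution_eqI[OF solution_jacobi_sol[OF a] solution_lincomb[OF u(1) v(1)] a])
    show "jacobi_sol a b x s 0 = (fst s * yv - v 0 * snd s) / W * u 0 + (u 0 * snd s - fst s * yu) / W * v 0"
      using W0 by (simp add: jacobi_sol_0 field_simps) (simp add: Wdef algebra_simps)
    have "snd s * W = (fst s * yv - v 0 * snd s) * yu + (u 0 * snd s - fst s * yu) * yv"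
      by (simp add: Wdef algebra_simps)
    then have "snd s = (fst s * yv - v 0 * snd s) / W * yu + (u 0 * snd s - fst s * yu) / W * yv"
      using W0 by (simp only: times_divide_eq_left add_divide_distrib[symmetric] eq_divide_eq if_True if_False not_False_eq_True)
    then show "jacobi_sol a b x s (- 1) = (fst s * yv - v 0 * snd s) / W * u (- 1) + (u 0 * snd s - fst s * yu) / W * v (- 1)"
      using a[of "-1"] by (simp add: jacobi_sol_minus1 yu_def yv_def divide_eq_eq) (simp add: algebra_simps)
  qed
  have "\<exists>K. \<forall>n. state_norm a (jacobi_sol a b x s) n \<le> real K * (1 + (real_of_int n)\<^sup>2)" for s
    unfolding sol_eq[of s] by (rule bound)
  from this[of "(1, 0)"] this[of "(0, 1)"]
  obtain K1 K2 where "\<And>n. state_norm a (jacobi_sol a b x (1, 0)) n \<le> real K1 * (1 + (real_of_int n)\<^sup>2)"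
    and "\<And>n. state_norm a (jacobi_sol a b x (0, 1)) n \<le> real K2 * (1 + (real_of_int n)\<^sup>2)" by blast
  moreover have "real K1 * (1 + (real_of_int n)\<^sup>2) \<le> real (K1 + K2) * (1 + (real_of_int n)\<^sup>2)"
    "real K2 * (1 + (real_of_int n)\<^sup>2) \<le> real (K1 + K2) * (1 + (real_of_int n)\<^sup>2)" for n
    by (intro mult_right_mono; simp)+
  ultimately have "tempered_both a b x (K1 + K2)"
    unfolding tempered_both_def by (meson order_trans)
  then show ?thesis by blast
qed

lemma solution_proportional:
  assumes a: "\<And>n. a n \<noteq> 0" and u: "solution a b x u" and v: "solution a b x v" "state_norm a v 0 \<noteq> 0"
    and W: "wronskian a u v 0 = 0"
  shows "\<exists>c. u = (\<lambda>n. c * v n)"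
proof -
  define yu yv where "yu = cnj (a (- 1)) * u (- 1)" and "yv = cnj (a (- 1)) * v (- 1)"
  have W0: "u 0 * yv = v 0 * yu" using W by (simp add: wronskian_def yu_def yv_def)
  have "v 0 \<noteq> 0 \<or> yv \<noteq> 0" using v(2) by (auto simp: state_norm_def yv_def)
  then obtain c where c: "u 0 = c * v 0" "yu = c * yv"
  proof (cases "v 0 = 0")
    case True
    then have "yv \<noteq> 0" using \<open>v 0 \<noteq> 0 \<or> yv \<noteq> 0\<close> by simp
    then show ?thesis using W0 True that[of "yu / yv"] by simp
  next
    case False
    then show ?thesis using W0 that[of "u 0 / v 0"] by (simp add: field_simps)
  qed
  have "u = (\<lambda>n. c * v n + 0 * v n)"
    using c(2) a[of "-1"] by (intro solution_eqI[OF u solution_lincomb[OF v(1) v(1)] a]) (auto simp: c(1) yu_def yv_def)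
  then show ?thesis by auto
qed

text \<open>The constant does not depend on \<open>u\<close>, so the constants at different sites of
  an orbit all apply to one solution. If both fundamental solutions are bounded, \<open>u\<close> is
  expanded in them, with its state at 0 as coefficients. Otherwise its Wronskian with the witness of
  \<open>tempered_some\<close> vanishes, and \<open>u\<close> is a multiple of that witness.\<close>

lemma tempered_bound:
  assumes a: "\<And>n. a n \<noteq> 0" and A: "\<And>n. cmod (a n) \<le> A" and K: "tempered a b x K"
    and u: "solution a b x u" "quadratically_bounded u"
  shows "state_norm a u n \<le> real K * (1 + (real_of_int n)\<^sup>2) * state_norm a u 0"
proof (cases "tempered_both a b x K")
  case True
  define s where "s = (u 0, cnj (a (- 1)) * u (- 1))"
  have us: "u = jacobi_sol a b x s" unfolding s_def by (rule jacobi_sol_of_state[OF u(1) a])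
  have "u = (\<lambda>n. fst s * jacobi_sol a b x (1, 0) n + snd s * jacobi_sol a b x (0, 1) n)"
    unfolding us fun_eq_iff by (intro allI jacobi_sol_lincomb[OF a])
  then have "state_norm a u n \<le> cmod (fst s) * state_norm a (jacobi_sol a b x (1, 0)) n
      + cmod (snd s) * state_norm a (jacobi_sol a b x (0, 1)) n"
    by (metis state_norm_lincomb)
  also have "\<dots> \<le> cmod (fst s) * (real K * (1 + (real_of_int n)\<^sup>2)) + cmod (snd s) * (real K * (1 + (real_of_int n)\<^sup>2))"
    using True unfolding tempered_both_def by (intro add_mono mult_left_mono) auto
  also have "\<dots> = real K * (1 + (real_of_int n)\<^sup>2) * state_norm a u 0"
    by (simp add: state_norm_def s_def algebra_simps)
  finally show ?thesis .
next
  case False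
  then have no: "\<nexists>K. tempered_both a b x K" and "tempered_some a b x K"
    using K by (auto simp: tempered_def)
  then obtain s where s: "norm s = 1" and sK: "\<And>n. state_norm a (jacobi_sol a b x s) n \<le> real K * (1 + (real_of_int n)\<^sup>2)"
    by (auto simp: tempered_some_def)
  let ?v = "jacobi_sol a b x s"
  \<comment> \<open>The witness has Euclidean norm 1, whereas \<open>state_norm\<close> is a sum of
    moduli, which is at least as large.\<close>
  have v1: "1 \<le> state_norm a ?v 0" using norm_pair_le[of s] s a by (simp add: state_norm_jacobi_sol_0)
  have v: "solution a b x ?v" by (rule solution_jacobi_sol[OF a])
  have "cmod (?v n) \<le> real K * (1 + (real_of_int n)\<^sup>2)" for n
    using sK[of n] norm_ge_zero[of "cnj (a (n - 1)) * ?v (n - 1)"] unfolding state_norm_def by linarith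
  then have "quadratically_bounded ?v" unfolding quadratically_bounded_def by blast
  then have "wronskian a u ?v 0 = 0"
    using tempered_both_if_wronskian_nonzero[OF a A u v] no by blast
  then obtain c where c: "u = (\<lambda>n. c * ?v n)" using solution_proportional[OF a u(1) v] v1 by fastforce
  have "state_norm a u n = cmod c * state_norm a ?v n" unfolding c by (rule state_norm_scale)
  also have "\<dots> \<le> cmod c * (real K * (1 + (real_of_int n)\<^sup>2) * state_norm a ?v 0)"
  proof (rule mult_left_mono)
    have "real K * (1 + (real_of_int n)\<^sup>2) * 1 \<le> real K * (1 + (real_of_int n)\<^sup>2) * state_norm a ?v 0"
      using v1 by (intro mult_left_mono) auto
    then show "state_norm a ?v n \<le> real K * (1 + (real_of_int n)\<^sup>2) * state_norm a ?v 0" using sK[of n] by linarith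
  qed simp
  also have "\<dots> = real K * (1 + (real_of_int n)\<^sup>2) * state_norm a u 0"
    unfolding c state_norm_scale by simp
  finally show ?thesis .
qed

section \<open>Subexponential growth in the presence of a quadratically bounded solution\<close>

text \<open>At the good sites the solution \<open>v\<close> is under control; at the bad sites it changes by at most the
  factor \<open>exp (h i)\<close>. Hence \<open>v\<close> is controlled everywhere up to the total of \<open>h\<close> over bad sites.\<close>

definition bad_total :: "(nat \<Rightarrow> bool) \<Rightarrow> (nat \<Rightarrow> real) \<Rightarrow> nat \<Rightarrow> real" where
  "bad_total good h n = (\<Sum>i<n. (of_bool (\<not> good i) + of_bool (\<not> good (Suc i))) * h i)"

lemma bad_total_ge:
  assumes "\<And>i. 0 \<le> h i"
  shows "0 \<le> bad_total good h n"
  unfolding bad_total_def using assms by (intro sum_nonneg mult_nonneg_nonneg) auto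

text \<open>A good site is compared with the origin directly. A bad site \<open>Suc i\<close> is
  reached from its left neighbour at the cost \<open>h i\<close>, whence the shifted index in the
  sum.\<close>

lemma good_sites_lower_bound:
  fixes N :: "nat \<Rightarrow> real"
  assumes h: "\<And>i. 0 \<le> h i" and pos: "N 0 = 1"
    and step: "\<And>i. N i \<le> exp (h i) * N (Suc i)"
    and good: "\<And>i. good i \<Longrightarrow> N 0 \<le> K * (1 + (real i)\<^sup>2) * N i" and K: "1 \<le> K"
  shows "1 \<le> K * (1 + (real k)\<^sup>2) * exp (\<Sum>i<k. of_bool (\<not> good (Suc i)) * h i) * N k"
proof (induction k)
  case 0
  then show ?case using K pos by simp
next
  case (Suc k)
  let ?S = "\<lambda>k. \<Sum>i<k. of_bool (\<not> good (Suc i)) * h i"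
  have S: "0 \<le> ?S k" for k using h by (intro sum_nonneg) auto
  show ?case
  proof (cases "good (Suc k)")
    case True
    have "0 < K * (1 + (real (Suc k))\<^sup>2)" using K by (intro mult_pos_pos) (auto simp: add_pos_nonneg)
    have "1 \<le> K * (1 + (real (Suc k))\<^sup>2) * N (Suc k)" using good[OF True] pos by simp
    also have "\<dots> \<le> exp (?S (Suc k)) * (K * (1 + (real (Suc k))\<^sup>2) * N (Suc k))"
      using calculation S[of "Suc k"] by (simp only: mult_le_cancel_right1) auto
    finally show ?thesis by (simp only: mult_ac)
  next
    case False
    have N: "0 \<le> N k"
    proof -
      have "0 < K * (1 + (real k)\<^sup>2) * exp (?S k)" using K by (intro mult_pos_pos) (auto simp: add_pos_nonneg)
      from mult_pos_neg[OF this, of "N k"] show ?thesis using Suc by linarith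
    qed
    have "1 \<le> K * (1 + (real k)\<^sup>2) * exp (?S k) * N k" by (rule Suc)
    also have "\<dots> \<le> K * (1 + (real (Suc k))\<^sup>2) * exp (?S k) * (exp (h k) * N (Suc k))"
      using K N step[of k] by (intro mult_mono add_mono power_mono) auto
    also have "\<dots> = K * (1 + (real (Suc k))\<^sup>2) * exp (?S (Suc k)) * N (Suc k)"
      using False by (simp add: exp_add)
    finally show ?thesis .
  qed
qed

text \<open>Induction downwards from \<open>n\<close>: a good site controls everything to its right
  at once, and a bad site \<open>i\<close> is left at the cost \<open>h i\<close>. The two bounds
  account for the two indicators in \<open>bad_total\<close>.\<close>

lemma good_sites_upper_bound:
  fixes N :: "nat \<Rightarrow> real"
  assumes h: "\<And>i. 0 \<le> h i" and nn: "\<And>i. 0 \<le> N i"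
    and step: "\<And>i. N (Suc i) \<le> exp (h i) * N i"
    and good: "\<And>i j. good i \<Longrightarrow> i \<le> j \<Longrightarrow> N j \<le> K * (1 + (real (j - i))\<^sup>2) * N i" and K: "1 \<le> K"
  shows "k \<le> n \<Longrightarrow> N n \<le> K * (1 + (real (n - k))\<^sup>2) * exp (\<Sum>i=k..<n. of_bool (\<not> good i) * h i) * N k"
proof (induction k rule: inc_induct)
  case base
  then show ?case using K nn[of n] by (simp add: mult_le_cancel_right1)
next
  case (step k)
  let ?S = "\<lambda>k. \<Sum>i=k..<n. of_bool (\<not> good i) * h i"
  show ?case
  proof (cases "good k")
    case True
    have S: "0 \<le> ?S k" using h by (intro sum_nonneg) auto
    have "N n \<le> K * (1 + (real (n - k))\<^sup>2) * N k * 1" using good[OF True, of n] step by simp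
    also have "\<dots> \<le> K * (1 + (real (n - k))\<^sup>2) * N k * exp (?S k)"
      using K nn[of k] S by (intro mult_left_mono) auto
    finally show ?thesis by (simp only: mult_ac)
  next
    case False
    have "N n \<le> K * (1 + (real (n - Suc k))\<^sup>2) * exp (?S (Suc k)) * N (Suc k)" by (rule step)
    also have "\<dots> \<le> K * (1 + (real (n - k))\<^sup>2) * exp (?S (Suc k)) * (exp (h k) * N k)"
      using K nn assms(3)[of k] by (intro mult_mono add_mono power_mono) auto
    also have "\<dots> = K * (1 + (real (n - k))\<^sup>2) * exp (?S k) * N k"
    proof -
      have "?S k = of_bool (\<not> good k) * h k + ?S (Suc k)" using step by (intro sum.atLeast_Suc_lessThan)
      also have "\<dots> = h k + ?S (Suc k)" using False by simp
      finally show ?thesis by (simp only: exp_add mult_ac)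
    qed
    finally show ?thesis .
  qed
qed

text \<open>The coefficient of the orthogonal projection, in the plane of states at site
  \<open>n\<close>, of the state of \<open>w\<close> onto that of \<open>v\<close>.\<close>

definition projection_coeff :: "(int \<Rightarrow> complex) \<Rightarrow> (int \<Rightarrow> complex) \<Rightarrow> (int \<Rightarrow> complex) \<Rightarrow> int \<Rightarrow> complex" where
  "projection_coeff a v w n =
     (cnj (v n) * w n + cnj (cnj (a (n - 1)) * v (n - 1)) * (cnj (a (n - 1)) * w (n - 1)))
     / of_real ((cmod (v n))\<^sup>2 + (cmod (cnj (a (n - 1)) * v (n - 1)))\<^sup>2)"

lemma projection_coeff_lincomb:
  assumes "state_norm a v n \<noteq> 0"
  shows "projection_coeff a v (\<lambda>n. 1 * w n + c * v n) n = projection_coeff a v w n + c"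
proof -
  define p q where "p = v n" and "q = cnj (a (n - 1)) * v (n - 1)"
  define D where "D = (cmod p)\<^sup>2 + (cmod q)\<^sup>2"
  have "D \<noteq> 0"
    using assms by (auto simp: D_def state_norm_def p_def q_def add_nonneg_eq_0_iff)
  then have D0: "complex_of_real D \<noteq> 0" by simp
  have D: "complex_of_real D = cnj p * p + cnj q * q"
    unfolding D_def of_real_add complex_norm_square by (simp add: mult.commute)
  have "cnj p * (1 * w n + c * p) + cnj q * (cnj (a (n - 1)) * (1 * w (n - 1) + c * v (n - 1)))
     = (cnj p * w n + cnj q * (cnj (a (n - 1)) * w (n - 1))) + c * complex_of_real D"
    unfolding D by (simp add: q_def algebra_simps)
  then show ?thesis
    using D0 unfolding projection_coeff_def p_def[symmetric] q_def[symmetric] D_def[symmetric]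
    by (simp only: add_divide_distrib) simp
qed

lemma norm_projection_coeff_le:
  assumes "state_norm a v n \<noteq> 0"
  shows "cmod (projection_coeff a v w n) \<le> 2 * state_norm a w n / state_norm a v n"
proof -
  define p q where "p = v n" and "q = cnj (a (n - 1)) * v (n - 1)"
  define P Q where "P = w n" and "Q = cnj (a (n - 1)) * w (n - 1)"
  have pos: "0 < cmod p + cmod q"
    using assms state_norm_nonneg[of a v n] unfolding state_norm_def p_def q_def by linarith
  have D: "(cmod p + cmod q)\<^sup>2 \<le> 2 * ((cmod p)\<^sup>2 + (cmod q)\<^sup>2)"
    using sum_squares_bound[of "cmod p" "cmod q"] by (simp add: power2_sum)
  have "cmod (cnj p * P + cnj q * Q) \<le> cmod p * cmod P + cmod q * cmod Q"
    using norm_triangle_ineq[of "cnj p * P" "cnj q * Q"] by (simp add: norm_mult)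
  also have "\<dots> \<le> (cmod p + cmod q) * (cmod P + cmod Q)" by (simp add: algebra_simps)
  finally have num: "cmod (cnj p * P + cnj q * Q) \<le> (cmod p + cmod q) * (cmod P + cmod Q)" .
  have "(cmod p + cmod q)\<^sup>2 > 0" using pos by simp
  from less_le_trans[OF this D] have D0: "0 < (cmod p)\<^sup>2 + (cmod q)\<^sup>2" by simp
  have nD: "cmod (complex_of_real ((cmod p)\<^sup>2 + (cmod q)\<^sup>2)) = (cmod p)\<^sup>2 + (cmod q)\<^sup>2"
    unfolding norm_of_real by simp
  have "cmod (projection_coeff a v w n) = cmod (cnj p * P + cnj q * Q) / ((cmod p)\<^sup>2 + (cmod q)\<^sup>2)"
    unfolding projection_coeff_def p_def[symmetric] q_def[symmetric] P_def[symmetric] Q_def[symmetric] norm_divide nD ..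
  also have "\<dots> \<le> ((cmod p + cmod q) * (cmod P + cmod Q)) / ((cmod p + cmod q)\<^sup>2 / 2)"
    using num D pos D0 by (intro frac_le) auto
  also have "\<dots> = 2 * (cmod P + cmod Q) / (cmod p + cmod q)"
    using pos by (simp add: power2_eq_square)
  finally show ?thesis unfolding state_norm_def p_def q_def P_def Q_def .
qed

text \<open>If (p, q) is the state of \<open>v\<close>, the residual is a multiple of the orthogonal
  vector (- cnj q, cnj p), with coefficient the Wronskian divided by |p|^2 + |q|^2. The factor 2
  comes from (|p| + |q|)^2 <= 2 (|p|^2 + |q|^2).\<close>

lemma state_norm_projection_residual:
  assumes "state_norm a v n \<noteq> 0"
  shows "state_norm a (\<lambda>k. 1 * w k + (- projection_coeff a v w n) * v k) n
     \<le> 2 * cmod (wronskian a v w n) / state_norm a v n"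
proof -
  define p q where "p = v n" and "q = cnj (a (n - 1)) * v (n - 1)"
  define P Q where "P = w n" and "Q = cnj (a (n - 1)) * w (n - 1)"
  define D where "D = (cmod p)\<^sup>2 + (cmod q)\<^sup>2"
  define W where "W = p * Q - P * q"
  define c where "c = projection_coeff a v w n"
  have W: "wronskian a v w n = W" by (simp add: W_def wronskian_def p_def q_def P_def Q_def)
  have pos: "0 < cmod p + cmod q"
    using assms state_norm_nonneg[of a v n] unfolding state_norm_def p_def q_def by linarith
  have D2: "(cmod p + cmod q)\<^sup>2 \<le> 2 * D"
    using sum_squares_bound[of "cmod p" "cmod q"] by (simp add: D_def power2_sum)
  have D0: "0 < D" using D2 pos zero_less_power[OF pos, of 2] by linarith
  have D: "complex_of_real D = cnj p * p + cnj q * q"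
    unfolding D_def of_real_add complex_norm_square by (simp add: mult.commute)
  have c: "c * of_real D = cnj p * P + cnj q * Q"
    using D0 unfolding c_def projection_coeff_def p_def[symmetric] q_def[symmetric] P_def[symmetric] Q_def[symmetric] D_def[symmetric]
    by simp
  have 1: "(P - c * p) * of_real D = - W * cnj q"
  proof -
    have "(P - c * p) * of_real D = P * of_real D - (c * of_real D) * p" by (simp add: algebra_simps)
    also have "\<dots> = - W * cnj q" unfolding c unfolding D W_def by (simp add: algebra_simps)
    finally show ?thesis .
  qed
  have 2: "(Q - c * q) * of_real D = W * cnj p"
  proof -
    have "(Q - c * q) * of_real D = Q * of_real D - (c * of_real D) * q" by (simp add: algebra_simps)
    also have "\<dots> = W * cnj p" unfolding c unfolding D W_def by (simp add: algebra_simps)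
    finally show ?thesis .
  qed
  have "cmod (P - c * p) * D = cmod W * cmod q" "cmod (Q - c * q) * D = cmod W * cmod p"
    using arg_cong[OF 1, of cmod] arg_cong[OF 2, of cmod] D0 by (simp_all add: norm_mult)
  then have "(cmod (P - c * p) + cmod (Q - c * q)) * D = cmod W * (cmod p + cmod q)"
    by (simp add: algebra_simps)
  then have "cmod (P - c * p) + cmod (Q - c * q) = cmod W * (cmod p + cmod q) / D"
    using D0 by (simp add: field_simps)
  also have "\<dots> \<le> cmod W * (cmod p + cmod q) / ((cmod p + cmod q)\<^sup>2 / 2)"
    using D2 pos D0 by (intro divide_left_mono) auto
  also have "\<dots> = 2 * cmod W / (cmod p + cmod q)"
    using pos by (simp add: power2_eq_square)
  finally show ?thesis
    unfolding W state_norm_def c_def[symmetric] by (simp add: p_def q_def P_def Q_def algebra_simps)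
qed

lemma norm_wronskian_le:
  "cmod (wronskian a v w n) \<le> state_norm a v n * state_norm a w n"
proof -
  let ?p = "cmod (v n)" and ?q = "cmod (cnj (a (n - 1)) * v (n - 1))"
  let ?P = "cmod (w n)" and ?Q = "cmod (cnj (a (n - 1)) * w (n - 1))"
  have "cmod (wronskian a v w n) \<le> ?p * ?Q + ?P * ?q"
    unfolding wronskian_def
    using norm_triangle_ineq4[of "v n * (cnj (a (n - 1)) * w (n - 1))" "w n * (cnj (a (n - 1)) * v (n - 1))"]
    by (simp add: norm_mult)
  also have "\<dots> \<le> (?p + ?q) * (?P + ?Q)" by (simp add: algebra_simps)
  finally show ?thesis by (simp add: state_norm_def)
qed

text \<open>Reduction of order: a second solution is controlled by its component along \<open>v\<close>, whose increments
  are bounded because the component across \<open>v\<close> is determined by the Wronskian.\<close>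

lemma reduction_of_order:
  fixes v w :: "int \<Rightarrow> complex"
  assumes a: "\<And>n. a n \<noteq> 0" and v: "solution a b x v" and w: "solution a b x w"
    and step: "\<And>i::nat. C i \<ge> 1" "\<And>i u. solution a b x u \<Longrightarrow> state_norm a u (int i + 1) \<le> C i * state_norm a u (int i)"
    and lower: "\<And>k. k \<le> n \<Longrightarrow> 1 \<le> P * state_norm a v (int k)"
    and upper: "state_norm a v (int n) \<le> P" and v0: "state_norm a v 0 = 1"
    and CP: "\<And>i. i < n \<Longrightarrow> C i \<le> H" "1 \<le> H"
  shows "state_norm a w (int n) \<le> 4 * (real n + 1) * H * P ^ 3 * state_norm a w 0"
proof -
  let ?N = "\<lambda>k. state_norm a v (int k)"
  define s where "s = state_norm a w 0"
  have s0: "0 \<le> s" by (simp add: s_def state_norm_nonneg)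
  have P1: "1 \<le> P" using lower[of 0] v0 by simp
  have Npos: "0 < ?N k" if "k \<le> n" for k
    using lower[OF that] P1 state_norm_nonneg[of a v "int k"] by (cases "?N k = 0") auto
  have inv: "1 / ?N k \<le> P" if "k \<le> n" for k
    using lower[OF that] Npos[OF that] by (simp add: divide_le_eq mult.commute)
  have W: "cmod (wronskian a v w k) \<le> s" for k
    using norm_wronskian[OF v w a, of k] norm_wronskian_le[of a v w 0] by (simp add: v0 s_def)
  define c where "c k = projection_coeff a v w (int k)" for k
  define r where "r k = (\<lambda>j. 1 * w j + (- c k) * v j)" for k
  have r_sol: "solution a b x (r k)" for k unfolding r_def by (rule solution_lincomb[OF w v])
  have r_le: "state_norm a (r k) (int k) \<le> 2 * s * P" if "k \<le> n" for k
  proof -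
    have "state_norm a (r k) (int k) \<le> 2 * cmod (wronskian a v w (int k)) / ?N k"
      unfolding r_def c_def using Npos[OF that] by (intro state_norm_projection_residual) auto
    also have "\<dots> \<le> 2 * s * (1 / ?N k)" using W[of "int k"] Npos[OF that] by (simp add: divide_right_mono)
    also have "\<dots> \<le> 2 * s * P" using inv[OF that] s0 by (intro mult_left_mono) auto
    finally show ?thesis .
  qed
  have c_step: "cmod (c (Suc k) - c k) \<le> 4 * s * H * P\<^sup>2" if k: "k < n" for k
  proof -
    have ne: "state_norm a v (int (Suc k)) \<noteq> 0" using Npos[of "Suc k"] k by simp
    \<comment> \<open>As \<open>w\<close> is \<open>r k\<close> plus \<open>c k\<close> times
      \<open>v\<close>, projecting at the next site adds to \<open>c k\<close> only the component of
      \<open>r k\<close> along \<open>v\<close>. The residual is at most \<open>2 * s * P\<close> at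
      site \<open>k\<close> and grows at most by the factor \<open>H\<close> in one step.\<close>
    have "c (Suc k) - c k = projection_coeff a v (r k) (int (Suc k))"
      unfolding r_def projection_coeff_lincomb[OF ne] by (simp add: c_def)
    then have "cmod (c (Suc k) - c k) \<le> 2 * state_norm a (r k) (int (Suc k)) * (1 / ?N (Suc k))"
      using norm_projection_coeff_le[OF ne, of "r k"] by simp
    also have "\<dots> \<le> 2 * (H * (2 * s * P)) * P"
    proof (intro mult_mono mult_left_mono inv)
      have "state_norm a (r k) (int (Suc k)) \<le> C k * state_norm a (r k) (int k)"
        using step(2)[OF r_sol, of k k] by (simp add: add.commute)
      also have "\<dots> \<le> H * (2 * s * P)"
        using CP k r_le[of k] state_norm_nonneg by (intro mult_mono) auto
      finally show "state_norm a (r k) (int (Suc k)) \<le> H * (2 * s * P)" .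
    qed (use s0 P1 CP k Npos[of "Suc k"] state_norm_nonneg in auto)
    finally show ?thesis by (simp add: power2_eq_square algebra_simps)
  qed
  have c_le: "cmod (c k) \<le> 2 * s + real k * (4 * s * H * P\<^sup>2)" if "k \<le> n" for k
    using that
  proof (induction k)
    case 0
    then show ?case using norm_projection_coeff_le[of a v 0 w] v0 by (simp add: c_def s_def)
  next
    case (Suc k)
    have "cmod (c (Suc k)) \<le> cmod (c k) + cmod (c (Suc k) - c k)"
      by (metis add.commute diff_add_cancel norm_triangle_ineq)
    also have "\<dots> \<le> 2 * s + real k * (4 * s * H * P\<^sup>2) + 4 * s * H * P\<^sup>2"
      using Suc c_step[of k] by (intro add_mono) auto
    finally show ?case by (simp add: algebra_simps)
  qed
  have "(\<lambda>j. 1 * r n j + c n * v j) = w" by (simp add: r_def)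
  with state_norm_lincomb[of a 1 "r n" "c n" v "int n"]
  have "state_norm a w (int n) \<le> cmod 1 * state_norm a (r n) (int n) + cmod (c n) * state_norm a v (int n)"
    by simp
  also have "\<dots> \<le> 2 * s * P + (2 * s + real n * (4 * s * H * P\<^sup>2)) * P"
  proof (rule add_mono)
    show "cmod 1 * state_norm a (r n) (int n) \<le> 2 * s * P" using r_le[OF order.refl] by simp
    show "cmod (c n) * state_norm a v (int n) \<le> (2 * s + real n * (4 * s * H * P\<^sup>2)) * P"
      using c_le[of n] upper s0 P1 CP(2) state_norm_nonneg by (intro mult_mono) auto
  qed
  also have "\<dots> = 4 * s * P + 4 * real n * s * H * P ^ 3"
    by (simp add: algebra_simps power2_eq_square power3_eq_cube)
  also have "\<dots> \<le> 4 * (H * P ^ 3) * s + 4 * real n * s * H * P ^ 3"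
  proof -
    have "P ^ 1 \<le> P ^ 3" using P1 by (intro power_increasing) auto
    then have "1 * P \<le> H * P ^ 3" using P1 CP(2) by (intro mult_mono) auto
    then have "P * s \<le> H * P ^ 3 * s" using s0 by (intro mult_right_mono) auto
    then show ?thesis by (simp add: mult_ac)
  qed
  also have "\<dots> = 4 * (real n + 1) * H * P ^ 3 * s" by (simp add: algebra_simps)
  finally show ?thesis by (simp add: s_def)
qed

subsection \<open>Transfer matrices\<close>

lemma transfer_matrix_solution:
  assumes a: "\<And>n. a n \<noteq> 0" and u: "solution a b x u"
  shows "transfer_matrix a b (of_real x) n *v vector [u 0, u (- 1)] = vector [u (int n), u (int n - 1)]"
proof (induction n)
  case 0
  then show ?case by simp
next
  case (Suc n)
  have eq: "a (int n) * u (int n + 1) = (of_real x - of_real (b (int n))) * u (int n) - cnj (a (int n - 1)) * u (int n - 1)"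
    using u by (simp add: solution_iff)
  have "transfer_matrix a b (of_real x) (Suc n) *v vector [u 0, u (- 1)]
     = one_step_matrix a b (of_real x) (int n) *v vector [u (int n), u (int n - 1)]"
    by (simp add: matrix_vector_mul_assoc[symmetric] Suc)
  also have "\<dots> = vector [u (int n + 1), u (int n)]"
    using a[of "int n"] eq
    by (simp add: vec_eq_iff forall_2 matrix_vector_mult_def sum_2 one_step_matrix_def field_simps)
  finally show ?case by (simp add: add.commute)
qed

lemma norm_det_one_step_matrix:
  assumes "a n \<noteq> 0"
  shows "cmod (det (one_step_matrix a b z n)) = cmod (a (n - 1)) / cmod (a n)"
  using assms by (simp add: det_2 one_step_matrix_def norm_mult norm_divide)

lemma norm_det_transfer_matrix:
  assumes "\<And>n. a n \<noteq> 0"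
  shows "cmod (det (transfer_matrix a b z n)) = cmod (a (- 1)) / cmod (a (int n - 1))"
proof (induction n)
  case (Suc n)
  then show ?case using assms[of "int n"] assms[of "int n - 1"]
    by (simp add: det_mul norm_mult norm_det_one_step_matrix[where a=a, OF assms])
qed (use assms[of "-1"] in simp)

lemma norm_entry_le_onorm:
  fixes A :: "complex^2^2"
  shows "cmod (A $ i $ j) \<le> onorm ((*v) A)"
proof -
  have "(A *v axis j 1) $ i = A $ i $ j"
    by (simp add: matrix_vector_mult_def axis_def if_distrib[of "(*) _"] cong: if_cong)
  then have "cmod (A $ i $ j) \<le> norm (A *v axis j 1)"
    using Finite_Cartesian_Product.norm_nth_le[of "A *v axis j 1" i] by simp
  also have "\<dots> \<le> onorm ((*v) A) * norm (axis j (1 :: complex))"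
    by (rule onorm[OF matrix_vector_mul_bounded_linear])
  also have "norm (axis j (1 :: complex)) = 1"
    using exhaust_2[of j] by (auto simp: norm_vec_def L2_set_def sum_2 axis_def)
  finally show ?thesis by simp
qed

lemma norm_det_le_onorm:
  fixes A :: "complex^2^2"
  shows "cmod (det A) \<le> 2 * (onorm ((*v) A))\<^sup>2"
proof -
  have "cmod (det A) \<le> cmod (A$1$1) * cmod (A$2$2) + cmod (A$1$2) * cmod (A$2$1)"
    unfolding det_2 using norm_triangle_ineq4[of "A$1$1 * A$2$2" "A$1$2 * A$2$1"] by (simp add: norm_mult)
  also have "\<dots> \<le> onorm ((*v) A) * onorm ((*v) A) + onorm ((*v) A) * onorm ((*v) A)"
    by (intro add_mono mult_mono norm_entry_le_onorm onorm_pos_le matrix_vector_mul_bounded_linear) auto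
  finally show ?thesis by (simp add: power2_eq_square)
qed

text \<open>The determinants telescope, and the modulus of a determinant is at most twice the square
  of the norm. In the mean the two logarithms of \<open>a\<close> cancel, which leaves a bounded
  lower bound.\<close>

lemma onorm_transfer_matrix_lower:
  assumes a: "\<And>n. a n \<noteq> 0"
  shows "0 < onorm ((*v) (transfer_matrix a b z n))"
    and "(ln (cmod (a (- 1))) - ln (cmod (a (int n - 1))) - ln 2) / 2 \<le> ln (onorm ((*v) (transfer_matrix a b z n)))"
proof -
  let ?o = "onorm ((*v) (transfer_matrix a b z n))"
  have le: "cmod (a (- 1)) / cmod (a (int n - 1)) \<le> 2 * ?o\<^sup>2"
    using norm_det_le_onorm[of "transfer_matrix a b z n"] norm_det_transfer_matrix[where a=a, OF a] by simp
  have pos: "0 < cmod (a (- 1)) / cmod (a (int n - 1))" using a by simp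
  have "?o \<noteq> 0"
  proof
    assume "?o = 0"
    then have "2 * ?o\<^sup>2 = 0" by simp
    then show False using less_le_trans[OF pos le] by linarith
  qed
  then show o: "0 < ?o" using onorm_pos_le[OF matrix_vector_mul_bounded_linear, of "transfer_matrix a b z n"] by simp
  have "ln (cmod (a (- 1)) / cmod (a (int n - 1))) \<le> ln (2 * ?o\<^sup>2)"
    using le pos by (subst ln_le_cancel_iff) auto
  then show "(ln (cmod (a (- 1))) - ln (cmod (a (int n - 1))) - ln 2) / 2 \<le> ln ?o"
    using o a by (simp add: ln_div ln_mult ln_realpow)
qed

lemma solution_shift: "solution a b x u \<Longrightarrow> solution (\<lambda>n. a (n + k)) (\<lambda>n. b (n + k)) x (\<lambda>n. u (n + k))"
  unfolding solution_iff
proof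
  fix n
  assume "\<forall>n. a n * u (n + 1) = (of_real x - of_real (b n)) * u n - cnj (a (n - 1)) * u (n - 1)"
  moreover have "n + 1 + k = n + k + 1" "n - 1 + k = n + k - 1" by simp_all
  ultimately show "a (n + k) * u (n + 1 + k) = (of_real x - of_real (b (n + k))) * u (n + k)
      - cnj (a (n - 1 + k)) * u (n - 1 + k)" by metis
qed

lemma state_norm_shift: "state_norm (\<lambda>n. a (n + k)) (\<lambda>n. u (n + k)) n = state_norm a u (n + k)"
  by (simp add: state_norm_def algebra_simps)

lemma quadratically_bounded_shift:
  assumes "quadratically_bounded u"
  shows "quadratically_bounded (\<lambda>n. u (n + k))"
proof -
  obtain K where K: "\<And>n. cmod (u n) \<le> K * (1 + (real_of_int n)\<^sup>2)"
    using assms unfolding quadratically_bounded_def by blast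
  have K0: "0 \<le> K" using order_trans[OF norm_ge_zero K[of 0]] by simp
  have "cmod (u (n + k)) \<le> (K * (2 + 2 * (real_of_int k)\<^sup>2)) * (1 + (real_of_int n)\<^sup>2)" for n
  proof -
    have "(real_of_int (n + k))\<^sup>2 \<le> 2 * (real_of_int n)\<^sup>2 + 2 * (real_of_int k)\<^sup>2"
      using sum_squares_bound[of "real_of_int n" "real_of_int k"] by (simp add: power2_sum)
    moreover have "0 \<le> (real_of_int k)\<^sup>2 * (real_of_int n)\<^sup>2" by simp
    ultimately have "1 + (real_of_int (n + k))\<^sup>2 \<le> (2 + 2 * (real_of_int k)\<^sup>2) * (1 + (real_of_int n)\<^sup>2)"
      unfolding distrib_left distrib_right mult.assoc by linarith
    then have "K * (1 + (real_of_int (n + k))\<^sup>2) \<le> K * ((2 + 2 * (real_of_int k)\<^sup>2) * (1 + (real_of_int n)\<^sup>2))"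
      using K0 by (rule mult_left_mono)
    then show ?thesis using K[of "n + k"] unfolding mult.assoc by linarith
  qed
  then show ?thesis unfolding quadratically_bounded_def by blast
qed

text \<open>The deterministic core. With \<open>P = K (1 + n^2) exp X\<close> and \<open>X\<close>
  the total over bad sites, the normalised \<open>v\<close> lies above \<open>1 / P\<close> on the
  whole stretch and below \<open>P\<close> at its end, so \<open>reduction_of_order\<close> bounds
  every solution by a multiple of \<open>P ^ 3\<close>.\<close>

lemma ln_onorm_transfer_matrix_le:
  fixes K :: nat
  assumes a: "\<And>n. a n \<noteq> 0" and C: "\<And>n. \<bar>x\<bar> + \<bar>b n\<bar> + 1 + (cmod (a n))\<^sup>2 \<le> C"
    and v: "solution a b x v" "quadratically_bounded v" "v m \<noteq> 0"
    and h: "\<And>i. h i = ln C - ln (cmod (a (int i)))"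
    and good: "\<And>i. good i \<Longrightarrow> tempered (\<lambda>n. a (n + int i)) (\<lambda>n. b (n + int i)) x K"
      "\<And>i. good i \<Longrightarrow> h i \<le> real K"
    and K: "K \<ge> 1" and n: "n \<ge> 1"
  shows "ln (onorm ((*v) (transfer_matrix a b (of_real x) n)))
     \<le> ln (16 * C * (real n + 1) * (real K * (1 + (real n)\<^sup>2)) ^ 3) + real K + h (n - 1) + 4 * bad_total good h n"
proof -
  have a_le: "cmod (a n) \<le> C" for n
  proof -
    have "0 \<le> (cmod (a n) - 1)\<^sup>2 + 1" by (simp add: add_nonneg_nonneg)
    moreover have "0 \<le> (cmod (a n))\<^sup>2" by simp
    ultimately have "2 * cmod (a n) \<le> 2 + 2 * (cmod (a n))\<^sup>2"
      unfolding power2_eq_square by (simp only: algebra_simps)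
    then show ?thesis using C[of n] abs_ge_zero[of x] abs_ge_zero[of "b n"] by linarith
  qed
  have C1: "1 \<le> C" using C[of 0] abs_ge_zero[of x] abs_ge_zero[of "b 0"] zero_le_power2[of "cmod (a 0)"] by linarith
  have exp_h: "exp (h i) = C / cmod (a (int i))" for i
    unfolding h using C1 a by (simp add: exp_diff)
  have h0: "0 \<le> h i" for i
    unfolding h using a_le[of "int i"] a[of "int i"] C1 by (simp add: ln_le_cancel_iff)
  have step: "state_norm a u (int i + 1) \<le> exp (h i) * state_norm a u (int i)"
     "state_norm a u (int i) \<le> exp (h i) * state_norm a u (int i + 1)" if "solution a b x u" for u i
    unfolding exp_h using that by (rule state_norm_step[OF _ a C])+
  define t where "t = complex_of_real (1 / state_norm a v 0)"
  define v' where "v' = (\<lambda>n. t * v n)"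
  have v0: "state_norm a v 0 \<noteq> 0" using solution_eq_0[OF v(1) a] v(3) by blast
  have v'_sol: "solution a b x v'"
    using solution_lincomb[OF v(1) v(1), of t 0] by (simp add: v'_def)
  have v'_0: "state_norm a v' 0 = 1"
    unfolding v'_def state_norm_scale t_def using v0 state_norm_nonneg[of a v 0] by (simp add: norm_divide)
  \<comment> \<open>Temperedness at site \<open>i\<close> concerns the operator shifted by
    \<open>i\<close>; by \<open>tempered_bound\<close> its constant applies to the shift of the one
    solution \<open>v\<close>. Negative \<open>j\<close> leads back to the origin, positive
    \<open>j\<close> forward.\<close>
  have tempered_at: "state_norm a v' (j + int i) \<le> real K * (1 + (real_of_int j)\<^sup>2) * state_norm a v' (int i)" if "good i" for i j
  proof -
    have "state_norm (\<lambda>n. a (n + int i)) (\<lambda>n. v (n + int i)) j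
       \<le> real K * (1 + (real_of_int j)\<^sup>2) * state_norm (\<lambda>n. a (n + int i)) (\<lambda>n. v (n + int i)) 0"
      using a a_le good(1)[OF that] solution_shift[OF v(1)] quadratically_bounded_shift[OF v(2)]
      by (intro tempered_bound[where A=C and a="\<lambda>n. a (n + int i)"]) auto
    then have "cmod t * state_norm a v (j + int i) \<le> cmod t * (real K * (1 + (real_of_int j)\<^sup>2) * state_norm a v (int i))"
      unfolding state_norm_shift by (intro mult_left_mono) auto
    then show ?thesis unfolding v'_def state_norm_scale by (simp add: mult_ac)
  qed
  define N where "N k = state_norm a v' (int k)" for k
  define X where "X = bad_total good h n"
  define P where "P = real K * (1 + (real n)\<^sup>2) * exp X"
  have X0: "0 \<le> X" unfolding X_def using h0 by (rule bad_total_ge)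
  have P0: "0 \<le> P" by (simp add: P_def)
  have lower: "1 \<le> P * N k" if "k \<le> n" for k
  proof -
    have "1 \<le> real K * (1 + (real k)\<^sup>2) * exp (\<Sum>i<k. of_bool (\<not> good (Suc i)) * h i) * N k"
    proof (rule good_sites_lower_bound[where h=h and good=good])
      show "N 0 = 1" by (simp add: N_def v'_0)
      show "N i \<le> exp (h i) * N (Suc i)" for i
        using step(2)[OF v'_sol, of i] by (simp add: N_def add.commute)
      show "N 0 \<le> real K * (1 + (real i)\<^sup>2) * N i" if "good i" for i
        using tempered_at[OF that, of "- int i"] by (simp add: N_def)
    qed (use K h0 in auto)
    also have "\<dots> \<le> P * N k"
    proof (rule mult_right_mono)
      have "(\<Sum>i<k. of_bool (\<not> good (Suc i)) * h i) \<le> (\<Sum>i<n. of_bool (\<not> good (Suc i)) * h i)"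
        using that h0 by (intro sum_mono2) auto
      also have "\<dots> \<le> X" unfolding X_def bad_total_def using h0 by (intro sum_mono mult_right_mono) auto
      finally show "real K * (1 + (real k)\<^sup>2) * exp (\<Sum>i<k. of_bool (\<not> good (Suc i)) * h i) \<le> P"
        unfolding P_def using that by (intro mult_mono add_mono power_mono) auto
    qed (simp add: N_def state_norm_nonneg)
    finally show ?thesis .
  qed
  have upper: "N n \<le> P"
  proof -
    have "N n \<le> real K * (1 + (real (n - 0))\<^sup>2) * exp (\<Sum>i=0..<n. of_bool (\<not> good i) * h i) * N 0"
    proof (rule good_sites_upper_bound[where h=h and good=good])
      show "N (Suc i) \<le> exp (h i) * N i" for i
        using step(1)[OF v'_sol, of i] by (simp add: N_def add.commute)
      show "N j \<le> real K * (1 + (real (j - i))\<^sup>2) * N i" if "good i" "i \<le> j" for i j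
        using tempered_at[OF that(1), of "int (j - i)"] that(2) by (simp add: N_def of_nat_diff)
    qed (use K h0 in \<open>auto simp: N_def state_norm_nonneg\<close>)
    also have "\<dots> \<le> P"
    proof -
      have "(\<Sum>i=0..<n. of_bool (\<not> good i) * h i) \<le> X"
        unfolding X_def bad_total_def atLeast0LessThan using h0 by (intro sum_mono mult_right_mono) auto
      then show ?thesis unfolding P_def by (simp add: N_def v'_0 mult_left_mono)
    qed
    finally show ?thesis .
  qed
  \<comment> \<open>At a good site the step is capped by definition, and at a bad site
    \<open>h i\<close> is dominated by one summand of \<open>X\<close>.\<close>
  have h_le: "h i \<le> real K + X" if "i < n" for i
  proof (cases "good i")
    case True
    then show ?thesis using good(2) X0 by (simp add: add_increasing2)
  next
    case False
    then have "h i \<le> (of_bool (\<not> good i) + of_bool (\<not> good (Suc i))) * h i"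
      using h0[of i] by (simp add: algebra_simps)
    also have "\<dots> \<le> X"
      unfolding X_def bad_total_def using h0 that by (intro member_le_sum) auto
    finally show ?thesis by simp
  qed
  let ?G = "4 * (real n + 1) * exp (real K + X) * P ^ 3"
  have G: "0 \<le> ?G" using P0 by simp
  have growth: "state_norm a w (int n) \<le> ?G * state_norm a w 0" if "solution a b x w" for w
  proof (rule reduction_of_order[OF a v'_sol that, where C="\<lambda>i. exp (h i)"])
    show "exp (h i) \<le> exp (real K + X)" if "i < n" for i using h_le[OF that] by simp
  qed (use step h0 lower upper X0 v'_0 in \<open>auto simp: N_def\<close>)
  \<comment> \<open>16 is 4 from \<open>reduction_of_order\<close>, times 2 for the two entries of
    the image, times 2 (with \<open>C\<close>) for the initial state. \<open>X\<close> occurs once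
    in the largest step and three times in \<open>P ^ 3\<close>.\<close>
  define R where "R = 16 * C * (real n + 1) * (real K * (1 + (real n)\<^sup>2)) ^ 3 * exp (real K + h (n - 1) + 4 * X)"
  have "onorm ((*v) (transfer_matrix a b (of_real x) n)) \<le> R"
  proof (rule onorm_le)
    fix \<xi> :: "complex^2"
    define u where "u = jacobi_sol a b x (\<xi> $ 1, cnj (a (- 1)) * \<xi> $ 2)"
    have u: "solution a b x u" unfolding u_def by (rule solution_jacobi_sol[OF a])
    have \<xi>: "\<xi> = vector [u 0, u (- 1)]"
      using a[of "-1"] by (simp add: vec_eq_iff forall_2 u_def jacobi_sol_0 jacobi_sol_minus1)
    have norm2: "norm (y :: complex^2) \<le> cmod (y $ 1) + cmod (y $ 2)" for y
      unfolding norm_vec_def using L2_set_le_sum[of UNIV "\<lambda>i. cmod (y $ i)"] by (simp add: sum_2)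
    \<comment> \<open>The state contains \<open>u (n - 1)\<close> only with the weight
      \<open>cnj (a (n - 1))\<close>; removing the weight costs this factor.\<close>
    have e: "exp (h (n - 1)) = C / cmod (a (int n - 1))" using n exp_h[of "n - 1"] by (simp add: of_nat_diff)
    have e1: "1 \<le> exp (h (n - 1))" using h0 by simp
    have "norm (transfer_matrix a b (of_real x) n *v \<xi>) \<le> cmod (u (int n)) + cmod (u (int n - 1))"
      unfolding \<xi> transfer_matrix_solution[OF a u] using norm2[of "vector [u (int n), u (int n - 1)]"] by simp
    also have "\<dots> \<le> exp (h (n - 1)) * state_norm a u (int n) + exp (h (n - 1)) * state_norm a u (int n)"
    proof (rule add_mono)
      have "1 * cmod (u (int n)) \<le> exp (h (n - 1)) * state_norm a u (int n)"
        using e1 by (intro mult_mono) (auto simp: state_norm_def)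
      then show "cmod (u (int n)) \<le> exp (h (n - 1)) * state_norm a u (int n)" by simp
      have "cmod (u (int n - 1)) = 1 / cmod (a (int n - 1)) * cmod (cnj (a (int n - 1)) * u (int n - 1))"
        using a[of "int n - 1"] by (simp add: norm_mult)
      also have "\<dots> \<le> exp (h (n - 1)) * state_norm a u (int n)"
        unfolding e using C1 by (intro mult_mono divide_right_mono) (auto simp: state_norm_def)
      finally show "cmod (u (int n - 1)) \<le> exp (h (n - 1)) * state_norm a u (int n)" .
    qed
    also have "\<dots> = 2 * exp (h (n - 1)) * state_norm a u (int n)" by simp
    also have "\<dots> \<le> 2 * exp (h (n - 1)) * (?G * (2 * C * norm \<xi>))"
    proof (intro mult_left_mono)
      have "state_norm a u 0 = cmod (\<xi> $ 1) + cmod (a (- 1)) * cmod (\<xi> $ 2)"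
        unfolding u_def using a by (simp add: state_norm_jacobi_sol_0 norm_mult)
      also have "\<dots> \<le> C * norm \<xi> + C * norm \<xi>"
      proof (rule add_mono)
        have "1 * cmod (\<xi> $ 1) \<le> C * norm \<xi>"
          using C1 by (intro mult_mono Finite_Cartesian_Product.norm_nth_le) auto
        then show "cmod (\<xi> $ 1) \<le> C * norm \<xi>" by simp
        show "cmod (a (- 1)) * cmod (\<xi> $ 2) \<le> C * norm \<xi>"
          using C1 by (intro mult_mono Finite_Cartesian_Product.norm_nth_le a_le) auto
      qed
      finally have "?G * state_norm a u 0 \<le> ?G * (2 * C * norm \<xi>)" using G by (intro mult_left_mono) auto
      then show "state_norm a u (int n) \<le> ?G * (2 * C * norm \<xi>)" using growth[OF u] by linarith
    qed auto
    also have "\<dots> = R * norm \<xi>"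
    proof -
      have "exp X ^ 3 = exp (3 * X)" by (simp add: exp_of_nat_mult[symmetric])
      moreover have "exp (real K + h (n - 1) + 4 * X) = exp (h (n - 1)) * exp (real K + X) * exp (3 * X)"
        by (simp add: exp_add[symmetric])
      ultimately show ?thesis unfolding R_def P_def power_mult_distrib by (simp add: mult_ac)
    qed
    finally show "norm (transfer_matrix a b (of_real x) n *v \<xi>) \<le> R * norm \<xi>" .
  qed
  then have "ln (onorm ((*v) (transfer_matrix a b (of_real x) n))) \<le> ln R"
    using onorm_transfer_matrix_lower(1)[where a=a, OF a] by (simp add: ln_mono)
  also have "ln R = ln (16 * C * (real n + 1) * (real K * (1 + (real n)\<^sup>2)) ^ 3) + (real K + h (n - 1) + 4 * X)"
  proof -
    have "0 < 1 + (real n)\<^sup>2" by (simp add: add_pos_nonneg)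
    then have "0 < 16 * C * (real n + 1) * (real K * (1 + (real n)\<^sup>2)) ^ 3" using C1 K by simp
    moreover have "ln (Z * exp y) = ln Z + y" if "0 < Z" for Z y :: real using that by (simp add: ln_mult)
    ultimately show ?thesis unfolding R_def by blast
  qed
  finally show ?thesis by (simp add: X_def)
qed

section \<open>Ergodic families\<close>

context ergodic_jacobi_family
begin

abbreviation "a_seq \<equiv> orbit_seq M T a"
abbreviation "b_seq \<equiv> orbit_seq M T b"
abbreviation "T_inv \<equiv> inv_into (space M) T"

lemma T_space: "\<omega> \<in> space M \<Longrightarrow> T \<omega> \<in> space M"
  using T_bij by (auto simp: bij_betw_def)

lemma T_inv_T: "\<omega> \<in> space M \<Longrightarrow> T_inv (T \<omega>) = \<omega>"
  using T_bij by (metis bij_betw_inv_into_left)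

lemma measurable_funpow: "f \<in> measurable M M \<Longrightarrow> f ^^ n \<in> measurable M M"
  by (induction n) (auto simp: o_def intro: measurable_compose)

lemma measurable_int_iterate [measurable]: "int_iterate M T n \<in> measurable M M"
  unfolding int_iterate_def using T_measurable T_inv_measurable measurable_funpow by simp

lemma int_iterate_space: "\<omega> \<in> space M \<Longrightarrow> int_iterate M T n \<omega> \<in> space M"
  using measurable_space[OF measurable_int_iterate] .

lemma int_iterate_T:
  assumes "\<omega> \<in> space M"
  shows "int_iterate M T n (T \<omega>) = int_iterate M T (n + 1) \<omega>"
proof (cases "n \<ge> 0")
  case True
  then show ?thesis by (simp add: int_iterate_def nat_add_distrib funpow_swap1)
next
  case False
  define k where "k = nat (- n - 1)"
  have k: "nat (- n) = Suc k" "nat (- (n + 1)) = k" using False by (auto simp: k_def)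
  have "(T_inv ^^ Suc k) (T \<omega>) = (T_inv ^^ k) \<omega>"
    using assms by (simp only: funpow_Suc_right o_def T_inv_T)
  then show ?thesis using False k by (cases "n = - 1") (auto simp: int_iterate_def)
qed

lemma orbit_seq_T: "\<omega> \<in> space M \<Longrightarrow> orbit_seq M T f (T \<omega>) n = orbit_seq M T f \<omega> (n + 1)"
  by (simp add: orbit_seq_def int_iterate_T)

lemma funpow_space: "\<omega> \<in> space M \<Longrightarrow> (T ^^ k) \<omega> \<in> space M"
  by (induction k) (auto simp: T_space)

lemma orbit_seq_funpow: "\<omega> \<in> space M \<Longrightarrow> orbit_seq M T f ((T ^^ k) \<omega>) n = orbit_seq M T f \<omega> (n + int k)"
  by (induction k arbitrary: n) (simp_all add: orbit_seq_T funpow_space algebra_simps)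

lemma distr_funpow: "f \<in> measurable M M \<Longrightarrow> distr M M f = M \<Longrightarrow> distr M M (f ^^ n) = M"
proof (induction n)
  case 0
  then show ?case by (simp add: id_def distr_id)
next
  case (Suc n)
  have "distr M M (f ^^ Suc n) = distr (distr M M (f ^^ n)) M f"
    using Suc by (subst distr_distr) (auto simp: measurable_funpow)
  then show ?case using Suc by (simp add: o_def)
qed

lemma distr_T_inv: "distr M M T_inv = M"
proof (rule measure_eqI)
  fix A assume "A \<in> sets (distr M M T_inv)"
  then have A: "A \<in> sets M" by simp
  let ?B = "T_inv -` A \<inter> space M"
  have B: "?B \<in> sets M" using A T_inv_measurable by (rule measurable_sets[rotated])
  have "T -` ?B \<inter> space M = A"
    using sets.sets_into_space[OF A] by (auto simp: T_space T_inv_T)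
  then have "emeasure M A = emeasure (distr M M T) ?B"
    using B T_measurable by (simp add: emeasure_distr)
  then show "emeasure (distr M M T_inv) A = emeasure M A"
    using A T_inv_measurable by (simp add: T_preserving emeasure_distr)
qed simp

lemma distr_int_iterate: "distr M M (int_iterate M T n) = M"
  unfolding int_iterate_def
  using distr_funpow[OF T_measurable T_preserving] distr_funpow[OF T_inv_measurable distr_T_inv] by simp

lemma integral_int_iterate:
  fixes f :: "'w \<Rightarrow> real"
  assumes [measurable]: "f \<in> borel_measurable M"
  shows "(\<integral>\<omega>. f (int_iterate M T n \<omega>) \<partial>M) = (\<integral>\<omega>. f \<omega> \<partial>M)"
    and "integrable M f \<Longrightarrow> integrable M (\<lambda>\<omega>. f (int_iterate M T n \<omega>))"
  using integral_distr[OF measurable_int_iterate assms, of n] integrable_distr[OF measurable_int_iterate, of n f]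
  by (simp_all add: distr_int_iterate)

lemma AE_int_iterate:
  assumes "AE \<omega> in M. P \<omega>"
  shows "AE \<omega> in M. P (int_iterate M T n \<omega>)"
  by (rule AE_distrD[OF measurable_int_iterate]) (subst distr_int_iterate, rule assms)

lemma measurable_a_seq [measurable]: "(\<lambda>\<omega>. a_seq \<omega> n) \<in> borel_measurable M"
  unfolding orbit_seq_def using a_measurable by measurable

lemma measurable_b_seq [measurable]: "(\<lambda>\<omega>. b_seq \<omega> n) \<in> borel_measurable M"
  unfolding orbit_seq_def using b_measurable by measurable

definition coeff_bound :: real where
  "coeff_bound = (SOME C. \<forall>\<omega>\<in>space M. cmod (a \<omega>) \<le> C \<and> \<bar>b \<omega>\<bar> \<le> C)"

lemma coeff_bound: "\<omega> \<in> space M \<Longrightarrow> cmod (a \<omega>) \<le> coeff_bound \<and> \<bar>b \<omega>\<bar> \<le> coeff_bound"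
proof -
  obtain A B where "\<forall>x\<in>a ` space M. norm x \<le> A" "\<forall>x\<in>b ` space M. norm x \<le> B"
    using a_bounded b_bounded unfolding bounded_iff by blast
  then have "\<exists>C. \<forall>\<omega>\<in>space M. cmod (a \<omega>) \<le> C \<and> \<bar>b \<omega>\<bar> \<le> C"
    by (intro exI[of _ "max A B"]) (auto simp: le_max_iff_disj)
  from someI_ex[OF this] show "\<omega> \<in> space M \<Longrightarrow> cmod (a \<omega>) \<le> coeff_bound \<and> \<bar>b \<omega>\<bar> \<le> coeff_bound"
    unfolding coeff_bound_def by blast
qed

lemma a_seq_le: "\<omega> \<in> space M \<Longrightarrow> cmod (a_seq \<omega> n) \<le> coeff_bound"
  and b_seq_le: "\<omega> \<in> space M \<Longrightarrow> \<bar>b_seq \<omega> n\<bar> \<le> coeff_bound"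
  using coeff_bound[OF int_iterate_space] by (auto simp: orbit_seq_def)

definition regular :: "'w set" where
  "regular = {\<omega> \<in> space M. \<forall>n. a_seq \<omega> n \<noteq> 0}"

lemma regular_sets [measurable]: "regular \<in> sets M"
  unfolding regular_def by measurable

lemma AE_regular: "AE \<omega> in M. \<omega> \<in> regular"
proof -
  have "AE \<omega> in M. a_seq \<omega> n \<noteq> 0" for n
    using AE_int_iterate[OF a_nonzero] by (simp add: orbit_seq_def)
  then have "AE \<omega> in M. \<forall>n. a_seq \<omega> n \<noteq> 0" unfolding AE_all_countable by blast
  then show ?thesis using AE_space by eventually_elim (simp add: regular_def)
qed

lemma T_regular:
  assumes "\<omega> \<in> space M"
  shows "T \<omega> \<in> regular \<longleftrightarrow> \<omega> \<in> regular"
proof -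
  have "(\<forall>n. a_seq \<omega> (n + 1) \<noteq> 0) \<longleftrightarrow> (\<forall>n. a_seq \<omega> n \<noteq> 0)"
    by (metis diff_add_cancel)
  then show ?thesis using assms by (simp add: regular_def orbit_seq_T T_space)
qed

definition resonant :: "'w \<Rightarrow> real \<Rightarrow> bool" where
  "resonant \<omega> x \<longleftrightarrow> \<omega> \<in> regular \<and> (\<exists>K. tempered (a_seq \<omega>) (b_seq \<omega>) x K)"

lemma resonant_iff:
  assumes "\<omega> \<in> regular"
  shows "resonant \<omega> x \<longleftrightarrow>
    (\<exists>u. solution (a_seq \<omega>) (b_seq \<omega>) x u \<and> quadratically_bounded u \<and> (\<exists>n. u n \<noteq> 0))"
  using assms tempered_exists_iff[where a="a_seq \<omega>" and A=coeff_bound] a_seq_le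
  by (auto simp: resonant_def regular_def)

lemma measurable_resonant [measurable]: "Measurable.pred (M \<Otimes>\<^sub>M borel) (\<lambda>p. resonant (fst p) (snd p))"
proof -
  have [measurable]: "{p \<in> space (M \<Otimes>\<^sub>M borel). tempered (a_seq (fst p)) (b_seq (fst p)) (snd p) K} \<in> sets (M \<Otimes>\<^sub>M borel)" for K
    by (rule measurable_tempered) measurable
  have [measurable]: "Measurable.pred (M \<Otimes>\<^sub>M borel) (\<lambda>p. fst p \<in> regular)" by measurable
  show ?thesis unfolding resonant_def by measurable
qed

lemma measurable_resonant_fixed [measurable]: "Measurable.pred M (\<lambda>\<omega>. resonant \<omega> x)"
  using measurable_compose[OF measurable_Pair2'[of x borel M] measurable_resonant] by simp

text \<open>\<open>T_ergodic\<close> asks for exact invariance, not invariance up to null sets;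
  translating the solution by one site provides it.\<close>

lemma resonant_T:
  assumes "\<omega> \<in> space M"
  shows "resonant (T \<omega>) x \<longleftrightarrow> resonant \<omega> x"
proof (cases "\<omega> \<in> regular")
  case True
  have shift: "a_seq (T \<omega>) = (\<lambda>n. a_seq \<omega> (n + 1))" "b_seq (T \<omega>) = (\<lambda>n. b_seq \<omega> (n + 1))"
    using assms by (auto simp: orbit_seq_T)
  have T: "T \<omega> \<in> regular" using True assms by (simp add: T_regular)
  show ?thesis unfolding resonant_iff[OF True] resonant_iff[OF T] shift
  proof safe
    fix u n assume u: "solution (\<lambda>n. a_seq \<omega> (n + 1)) (\<lambda>n. b_seq \<omega> (n + 1)) x u" "quadratically_bounded u" "u n \<noteq> 0"
    have "solution (a_seq \<omega>) (b_seq \<omega>) x (\<lambda>n. u (n + (- 1)))"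
      using solution_shift[OF u(1), of "- 1"] by simp
    moreover have "u (n + 1 + - 1) \<noteq> 0" using u(3) by simp
    ultimately show "\<exists>u. solution (a_seq \<omega>) (b_seq \<omega>) x u \<and> quadratically_bounded u \<and> (\<exists>n. u n \<noteq> 0)"
      using quadratically_bounded_shift[OF u(2), of "- 1"] by blast
  next
    fix u n assume u: "solution (a_seq \<omega>) (b_seq \<omega>) x u" "quadratically_bounded u" "u n \<noteq> 0"
    have "u (n - 1 + 1) \<noteq> 0" using u(3) by simp
    then show "\<exists>u. solution (\<lambda>n. a_seq \<omega> (n + 1)) (\<lambda>n. b_seq \<omega> (n + 1)) x u \<and> quadratically_bounded u \<and> (\<exists>n. u n \<noteq> 0)"
      using solution_shift[OF u(1), of 1] quadratically_bounded_shift[OF u(2), of 1] by blast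
  qed
next
  case False
  then show ?thesis using assms by (simp add: resonant_def T_regular)
qed

lemma prob_resonant: "prob {\<omega> \<in> space M. resonant \<omega> x} = 0 \<or> prob {\<omega> \<in> space M. resonant \<omega> x} = 1"
  by (rule T_ergodic) (auto simp: resonant_T T_space)

section \<open>Good sites along the orbit and vanishing of the Lyapunov exponent\<close>

definition step_const :: "real \<Rightarrow> real" where
  "step_const x = \<bar>x\<bar> + coeff_bound + 1 + coeff_bound\<^sup>2"

text \<open>The logarithm of the one-step factor of \<open>state_norm_step\<close>. It may be
  unbounded, because |a| may come close to 0, but it is integrable.\<close>

definition log_step :: "real \<Rightarrow> 'w \<Rightarrow> real" where
  "log_step x \<omega> = ln (step_const x) - ln (cmod (a \<omega>))"

text \<open>The second condition caps the step at good sites, so that the largest step on a stretch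
  is bounded by \<open>K\<close> plus the total over bad sites.\<close>

definition good_set :: "real \<Rightarrow> nat \<Rightarrow> 'w set" where
  "good_set x K = {\<omega> \<in> space M. tempered (a_seq \<omega>) (b_seq \<omega>) x K \<and> log_step x \<omega> \<le> real K}"

text \<open>The summand of \<open>bad_total\<close> at site 0, as a function of \<omega>; its values
  along the orbit are the other summands.\<close>

definition bad_step :: "real \<Rightarrow> nat \<Rightarrow> 'w \<Rightarrow> real" where
  "bad_step x K \<omega> = (of_bool (\<omega> \<notin> good_set x K) + of_bool (T \<omega> \<notin> good_set x K)) * log_step x \<omega>"

lemma coeff_bound_nonneg: "0 \<le> coeff_bound"
proof -
  obtain \<omega> where "\<omega> \<in> space M" using not_empty by blast
  then show ?thesis using coeff_bound[of \<omega>] abs_ge_zero[of "b \<omega>"] by linarith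
qed

lemma step_const_ge: "\<omega> \<in> space M \<Longrightarrow> \<bar>x\<bar> + \<bar>b_seq \<omega> n\<bar> + 1 + (cmod (a_seq \<omega> n))\<^sup>2 \<le> step_const x"
  unfolding step_const_def using a_seq_le b_seq_le by (intro add_mono power_mono) auto

lemma step_const_ge_1: "1 \<le> step_const x"
  unfolding step_const_def using coeff_bound_nonneg by simp

lemma measurable_log_step [measurable]: "log_step x \<in> borel_measurable M"
  unfolding log_step_def using a_measurable by measurable

lemma integrable_log_step: "integrable M (log_step x)"
  unfolding log_step_def using log_a_integrable by simp

lemma log_step_nonneg:
  assumes "\<omega> \<in> space M"
  shows "0 \<le> log_step x \<omega>"
proof (cases "a \<omega> = 0")
  case True
  then show ?thesis using step_const_ge_1 by (simp add: log_step_def)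
next
  case False
  have "cmod (a \<omega>) \<le> step_const x"
    using coeff_bound[OF assms] coeff_bound_nonneg zero_le_power2[of coeff_bound] unfolding step_const_def by linarith
  then show ?thesis using False step_const_ge_1[of x] by (simp add: log_step_def ln_le_cancel_iff)
qed

lemma good_set_sets [measurable]: "good_set x K \<in> sets M"
proof -
  have [measurable]: "{\<omega> \<in> space M. tempered (a_seq \<omega>) (b_seq \<omega>) x K} \<in> sets M"
    by (rule measurable_tempered) measurable
  show ?thesis unfolding good_set_def by measurable
qed

lemma good_set_mono: "K \<le> K' \<Longrightarrow> good_set x K \<subseteq> good_set x K'"
  unfolding good_set_def using tempered_mono by fastforce

lemma measurable_bad_step [measurable]: "bad_step x K \<in> borel_measurable M"
proof -
  have [measurable]: "Measurable.pred M (\<lambda>\<omega>. T \<omega> \<in> good_set x K)" "Measurable.pred M (\<lambda>\<omega>. \<omega> \<in> good_set x K)"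
    using T_measurable by measurable
  show ?thesis unfolding bad_step_def[abs_def] of_bool_def by measurable
qed

lemma bad_step_bounds:
  assumes "\<omega> \<in> space M"
  shows "0 \<le> bad_step x K \<omega>" "bad_step x K \<omega> \<le> 2 * log_step x \<omega>"
  using log_step_nonneg[OF assms, of x] unfolding bad_step_def
  by (auto intro!: mult_nonneg_nonneg mult_right_mono)

lemma integrable_bad_step: "integrable M (bad_step x K)"
proof (rule Bochner_Integration.integrable_bound)
  show "integrable M (\<lambda>\<omega>. 2 * log_step x \<omega>)" using integrable_log_step by simp
  show "AE \<omega> in M. norm (bad_step x K \<omega>) \<le> norm (2 * log_step x \<omega>)"
    using AE_space
  proof eventually_elim
    case (elim \<omega>)
    then show ?case using bad_step_bounds[of \<omega> x K] log_step_nonneg[of \<omega> x] by simp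
  qed
qed measurable

lemma AE_eventually_good:
  assumes "AE \<omega> in M. resonant \<omega> x"
  shows "AE \<omega> in M. \<forall>\<^sub>F K in sequentially. \<omega> \<in> good_set x K"
  using assms AE_space
proof eventually_elim
  case (elim \<omega>)
  then obtain K where K: "tempered (a_seq \<omega>) (b_seq \<omega>) x K" by (auto simp: resonant_def)
  obtain L :: nat where L: "log_step x \<omega> \<le> real L" using real_arch_simple by blast
  have "\<omega> \<in> good_set x (max K L)"
    using elim(2) L tempered_mono[OF _ K, of "max K L"] by (simp add: good_set_def)
  then have "\<omega> \<in> good_set x k" if "max K L \<le> k" for k using good_set_mono[OF that] by blast
  then show ?case unfolding eventually_sequentially by blast
qed

lemma AE_T:
  assumes "AE \<omega> in M. P \<omega>"
  shows "AE \<omega> in M. P (T \<omega>)"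
  by (rule AE_distrD[OF T_measurable]) (subst T_preserving, rule assms)

text \<open>Almost every point and its image under \<open>T\<close> are good for all large
  \<open>K\<close>, so the integrand is eventually 0. The dominating function
  \<open>2 * log_step\<close> is where integrability of log |a| enters.\<close>

lemma integral_bad_step_tendsto_0:
  assumes "AE \<omega> in M. resonant \<omega> x"
  shows "(\<lambda>K. \<integral>\<omega>. bad_step x K \<omega> \<partial>M) \<longlonglongrightarrow> 0"
proof -
  have "(\<lambda>K. \<integral>\<omega>. bad_step x K \<omega> \<partial>M) \<longlonglongrightarrow> (\<integral>\<omega>. 0 \<partial>M)"
  proof (rule integral_dominated_convergence[where w="\<lambda>\<omega>. 2 * log_step x \<omega>"])
    show "integrable M (\<lambda>\<omega>. 2 * log_step x \<omega>)" using integrable_log_step by simp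
    show "AE \<omega> in M. (\<lambda>K. bad_step x K \<omega>) \<longlonglongrightarrow> 0"
      using AE_eventually_good[OF assms] AE_T[OF AE_eventually_good[OF assms]]
    proof eventually_elim
      case (elim \<omega>)
      then have "\<forall>\<^sub>F K in sequentially. bad_step x K \<omega> = 0"
        by eventually_elim (simp add: bad_step_def)
      then show ?case by (rule tendsto_eventually)
    qed
    show "AE \<omega> in M. norm (bad_step x K \<omega>) \<le> 2 * log_step x \<omega>" for K
      using AE_space
    proof eventually_elim
      case (elim \<omega>)
      then show ?case using bad_step_bounds[of \<omega> x K] by simp
    qed
  qed measurable
  then show ?thesis by simp
qed

lemma int_iterate_of_nat: "int_iterate M T (int i) = T ^^ i"
  by (simp add: int_iterate_def)

abbreviation log_norm :: "real \<Rightarrow> nat \<Rightarrow> 'w \<Rightarrow> real" where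
  "log_norm x n \<omega> \<equiv> ln (onorm ((*v) (transfer_matrix (a_seq \<omega>) (b_seq \<omega>) (complex_of_real x) n)))"

definition poly_factor :: "real \<Rightarrow> nat \<Rightarrow> nat \<Rightarrow> real" where
  "poly_factor x K n = ln (16 * step_const x * (real n + 1) * (real K * (1 + (real n)\<^sup>2)) ^ 3)"

lemma poly_factor_nonneg:
  assumes "K \<ge> 1"
  shows "0 \<le> poly_factor x K n"
proof -
  have *: "1 \<le> u * v" if "1 \<le> u" "1 \<le> v" for u v :: real
    using mult_mono[OF that] that by simp
  have "1 \<le> 16 * step_const x * (real n + 1) * (real K * (1 + (real n)\<^sup>2)) ^ 3"
    using assms step_const_ge_1[of x] by (intro * one_le_power) auto
  then show ?thesis unfolding poly_factor_def by simp
qed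

lemma log_norm_le:
  assumes \<omega>: "\<omega> \<in> regular" and res: "resonant \<omega> x" and K: "K \<ge> 1" and n: "n \<ge> 1"
  shows "log_norm x n \<omega> \<le> poly_factor x K n + real K + log_step x (int_iterate M T (int (n - 1)) \<omega>)
     + 4 * (\<Sum>i<n. bad_step x K (int_iterate M T (int i) \<omega>))"
proof -
  have sp: "\<omega> \<in> space M" using \<omega> by (simp add: regular_def)
  obtain v m where v: "solution (a_seq \<omega>) (b_seq \<omega>) x v" "quadratically_bounded v" "v m \<noteq> 0"
    using res resonant_iff[OF \<omega>] by blast
  define good where "good i \<longleftrightarrow> (T ^^ i) \<omega> \<in> good_set x K" for i
  define h where "h i = log_step x ((T ^^ i) \<omega>)" for i
  have "log_norm x n \<omega> \<le> ln (16 * step_const x * (real n + 1) * (real K * (1 + (real n)\<^sup>2)) ^ 3)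
     + real K + h (n - 1) + 4 * bad_total good h n"
  proof (rule ln_onorm_transfer_matrix_le[OF _ step_const_ge[OF sp] v])
    show "a_seq \<omega> n \<noteq> 0" for n using \<omega> by (simp add: regular_def)
    show "h i = ln (step_const x) - ln (cmod (a_seq \<omega> (int i)))" for i
      by (simp add: h_def log_step_def orbit_seq_def int_iterate_of_nat)
    fix i assume i: "good i"
    have "a_seq ((T ^^ i) \<omega>) = (\<lambda>n. a_seq \<omega> (n + int i))" "b_seq ((T ^^ i) \<omega>) = (\<lambda>n. b_seq \<omega> (n + int i))"
      using sp by (auto simp: orbit_seq_funpow)
    then show "tempered (\<lambda>n. a_seq \<omega> (n + int i)) (\<lambda>n. b_seq \<omega> (n + int i)) x K" "h i \<le> real K"
      using i by (auto simp: good_def good_set_def h_def)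
  qed (use K n in auto)
  moreover have "bad_total good h n = (\<Sum>i<n. bad_step x K (int_iterate M T (int i) \<omega>))"
    unfolding bad_total_def bad_step_def good_def h_def int_iterate_of_nat by simp
  ultimately show ?thesis by (simp add: poly_factor_def h_def int_iterate_of_nat)
qed

lemma integral_log_norm_le:
  assumes res: "AE \<omega> in M. resonant \<omega> x" and K: "K \<ge> 1" and n: "n \<ge> 1"
  shows "(\<integral>\<omega>. log_norm x n \<omega> \<partial>M)
     \<le> poly_factor x K n + real K + (\<integral>\<omega>. log_step x \<omega> \<partial>M) + 4 * real n * (\<integral>\<omega>. bad_step x K \<omega> \<partial>M)"
proof -
  let ?R = "\<lambda>\<omega>. poly_factor x K n + real K + log_step x (int_iterate M T (int (n - 1)) \<omega>)
     + 4 * (\<Sum>i<n. bad_step x K (int_iterate M T (int i) \<omega>))"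
  note i = integral_int_iterate(2)[OF measurable_log_step integrable_log_step]
    integral_int_iterate(2)[OF measurable_bad_step integrable_bad_step]
  have R: "integrable M ?R"
    by (intro Bochner_Integration.integrable_add integrable_mult_right Bochner_Integration.integrable_sum i) auto
  have IR: "(\<integral>\<omega>. ?R \<omega> \<partial>M)
    = poly_factor x K n + real K + (\<integral>\<omega>. log_step x \<omega> \<partial>M) + 4 * real n * (\<integral>\<omega>. bad_step x K \<omega> \<partial>M)"
    using i by (simp add: integral_int_iterate(1) prob_space)
  show ?thesis
  proof (cases "integrable M (log_norm x n)")
    case True
    have "(\<integral>\<omega>. log_norm x n \<omega> \<partial>M) \<le> (\<integral>\<omega>. ?R \<omega> \<partial>M)"
    proof (rule integral_mono_AE[OF True R])
      show "AE \<omega> in M. log_norm x n \<omega> \<le> ?R \<omega>"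
        using AE_regular res by eventually_elim (rule log_norm_le[OF _ _ K n])
    qed
    then show ?thesis unfolding IR .
  next
    \<comment> \<open>The integral on the left is then 0 by convention, and the right-hand side is
      the integral of a nonnegative function.\<close>
    case False
    have "0 \<le> (\<integral>\<omega>. ?R \<omega> \<partial>M)"
      using poly_factor_nonneg[OF K] log_step_nonneg[OF int_iterate_space] bad_step_bounds(1)[OF int_iterate_space]
      by (intro integral_nonneg_AE AE_I2 add_nonneg_nonneg mult_nonneg_nonneg sum_nonneg) auto
    then show ?thesis unfolding IR using False by (simp add: not_integrable_integral_eq)
  qed
qed

text \<open>Taking means in \<open>onorm_transfer_matrix_lower\<close>, the two logarithms cancel by
  invariance of the measure. If \<open>log_norm\<close> is not integrable, its integral is 0 by
  convention, and the bound holds as well.\<close>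

lemma integral_log_norm_ge:
  shows "- ln 2 / 2 \<le> (\<integral>\<omega>. log_norm x n \<omega> \<partial>M)"
proof (cases "integrable M (log_norm x n)")
  case True
  let ?l = "\<lambda>\<omega>. ln (cmod (a \<omega>))"
  have [measurable]: "?l \<in> borel_measurable M" using a_measurable by measurable
  let ?R = "\<lambda>\<omega>. (?l (int_iterate M T (- 1) \<omega>) - ?l (int_iterate M T (int n - 1) \<omega>) - ln 2) / 2"
  have i: "integrable M (\<lambda>\<omega>. ?l (int_iterate M T k \<omega>))" for k
    by (rule integral_int_iterate(2)[OF _ log_a_integrable]) measurable
  have R: "integrable M ?R" using i by simp
  have "(\<integral>\<omega>. ?R \<omega> \<partial>M) = - ln 2 / 2"
    using i integral_int_iterate(1)[of ?l] by (simp add: prob_space)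
  moreover have "(\<integral>\<omega>. ?R \<omega> \<partial>M) \<le> (\<integral>\<omega>. log_norm x n \<omega> \<partial>M)"
  proof (rule integral_mono_AE[OF R True])
    show "AE \<omega> in M. ?R \<omega> \<le> log_norm x n \<omega>"
      using AE_regular
    proof eventually_elim
      case (elim \<omega>)
      then show ?case
        using onorm_transfer_matrix_lower(2)[of "a_seq \<omega>" n "b_seq \<omega>" "complex_of_real x"]
        by (simp add: regular_def orbit_seq_def)
    qed
  qed
  ultimately show ?thesis by simp
next
  case False
  then show ?thesis by (simp add: not_integrable_integral_eq)
qed

text \<open>\<open>lim\<close> is totalised, so genuine convergence has to be shown, here by
  squeezing between \<open>integral_log_norm_ge\<close> and \<open>integral_log_norm_le\<close>. In
  the upper bound \<open>K\<close> is fixed before \<open>n\<close> grows, and then every term but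
  the last is o(n).\<close>

lemma lyapunov_exponent_eq_0:
  assumes res: "AE \<omega> in M. resonant \<omega> x"
  shows "lyapunov_exponent M T a b (complex_of_real x) = 0"
proof -
  define I where "I n = (\<integral>\<omega>. log_norm x n \<omega> \<partial>M)" for n
  have "(\<lambda>n. 1 / real n * I n) \<longlonglongrightarrow> 0"
  proof (rule tendstoI)
    fix e :: real assume e: "0 < e"
    \<comment> \<open>Divided by \<open>n\<close>, the upper bound tends to 4 times this integral;
      \<open>e / 8\<close> keeps that limit below \<open>e\<close>.\<close>
    have "eventually (\<lambda>K. (\<integral>\<omega>. bad_step x K \<omega> \<partial>M) < e / 8) sequentially"
      using integral_bad_step_tendsto_0[OF res] e by (intro order_tendstoD) auto
    then have "eventually (\<lambda>K. (\<integral>\<omega>. bad_step x K \<omega> \<partial>M) < e / 8 \<and> K \<ge> 1) sequentially"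
      by (intro eventually_conj eventually_ge_at_top)
    then obtain K where K: "(\<integral>\<omega>. bad_step x K \<omega> \<partial>M) < e / 8" "K \<ge> 1"
      using eventually_happens'[OF sequentially_bot] by blast
    define \<epsilon> where "\<epsilon> = (\<integral>\<omega>. bad_step x K \<omega> \<partial>M)"
    define H where "H = (\<integral>\<omega>. log_step x \<omega> \<partial>M)"
    define c where "c = step_const x"
    define k where "k = real K"
    have ck: "c > 0" "k > 0" using step_const_ge_1[of x] K by (auto simp: c_def k_def)
    have "((\<lambda>n. 1 / real n * (ln (16 * c * (real n + 1) * (k * (1 + (real n)\<^sup>2)) ^ 3) + k + H + 4 * real n * \<epsilon>)) \<longlongrightarrow> 4 * \<epsilon>) sequentially"
      using ck by real_asymp
    then have "eventually (\<lambda>n. 1 / real n * (ln (16 * c * (real n + 1) * (k * (1 + (real n)\<^sup>2)) ^ 3) + k + H + 4 * real n * \<epsilon>) < e) sequentially"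
      by (rule order_tendstoD(2)) (use K e in \<open>simp add: \<epsilon>_def\<close>)
    moreover have "eventually (\<lambda>n. - e < 1 / real n * (- ln 2 / 2)) sequentially"
    proof -
      have "((\<lambda>n. 1 / real n * (- ln 2 / 2)) \<longlongrightarrow> 0) sequentially" by real_asymp
      then show ?thesis using e by (intro order_tendstoD) auto
    qed
    moreover have "eventually (\<lambda>n::nat. 1 \<le> n) sequentially" by (rule eventually_ge_at_top)
    ultimately show "eventually (\<lambda>n. dist (1 / real n * I n) 0 < e) sequentially"
    proof eventually_elim
      case (elim n)
      have "1 / real n * I n \<le> 1 / real n * (ln (16 * c * (real n + 1) * (k * (1 + (real n)\<^sup>2)) ^ 3) + k + H + 4 * real n * \<epsilon>)"
        using integral_log_norm_le[OF res K(2) elim(3)] unfolding I_def poly_factor_def c_def k_def H_def \<epsilon>_def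
        by (intro mult_left_mono) auto
      moreover have "1 / real n * (- ln 2 / 2) \<le> 1 / real n * I n"
        unfolding I_def by (intro mult_left_mono integral_log_norm_ge) auto
      ultimately show ?case using elim unfolding dist_real_def by linarith
    qed
  qed
  then show ?thesis unfolding lyapunov_exponent_def I_def by (rule limI)
qed

lemma AE_not_resonant:
  assumes "lyapunov_exponent M T a b (complex_of_real x) > 0"
  shows "AE \<omega> in M. \<not> resonant \<omega> x"
proof -
  have [measurable]: "{\<omega> \<in> space M. resonant \<omega> x} \<in> sets M" by measurable
  have "prob {\<omega> \<in> space M. resonant \<omega> x} \<noteq> 1"
  proof
    assume "prob {\<omega> \<in> space M. resonant \<omega> x} = 1"
    then have "AE \<omega> in M. resonant \<omega> x" by (subst (asm) prob_Collect_eq_1) measurable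
    then show False using lyapunov_exponent_eq_0 assms by simp
  qed
  then have "prob {\<omega> \<in> space M. resonant \<omega> x} = 0" using prob_resonant by blast
  then show ?thesis by (subst (asm) prob_Collect_eq_0) measurable
qed

end

text \<open>Serves to make the norm of the transfer matrix measurable. The crude Lipschitz constant
  4 is 2 summands in each of 2 coordinates.\<close>

lemma continuous_on_onorm_matrix: "continuous_on UNIV (\<lambda>A :: complex^2^2. onorm ((*v) A))"
proof -
  have entry: "norm (A *v x) \<le> (4 * norm A) * norm x" for A :: "complex^2^2" and x
  proof -
    have "cmod ((A *v x) $ i) \<le> 2 * (norm A * norm x)" for i
    proof -
      have "cmod (A $ i $ j * x $ j) \<le> norm A * norm x" for j
        unfolding norm_mult using Finite_Cartesian_Product.norm_nth_le[of A i] Finite_Cartesian_Product.norm_nth_le[of "A $ i" j]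
          Finite_Cartesian_Product.norm_nth_le[of x j] by (intro mult_mono) auto
      from this[of 1] this[of 2] show ?thesis
        using norm_triangle_ineq[of "A $ i $ 1 * x $ 1" "A $ i $ 2 * x $ 2"]
        by (simp add: matrix_vector_mult_def sum_2)
    qed
    from this[of 1] this[of 2] have "cmod ((A *v x) $ 1) + cmod ((A *v x) $ 2) \<le> (4 * norm A) * norm x"
      by (simp add: algebra_simps)
    moreover have "norm (A *v x) \<le> cmod ((A *v x) $ 1) + cmod ((A *v x) $ 2)"
      unfolding norm_vec_def[of "A *v x"] using L2_set_le_sum[of UNIV "\<lambda>i. cmod ((A *v x) $ i)"] by (simp add: sum_2)
    ultimately show ?thesis by simp
  qed
  have le: "onorm ((*v) A) \<le> onorm ((*v) B) + 4 * norm (A - B)" for A B :: "complex^2^2"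
  proof -
    have "onorm ((*v) A) = onorm (\<lambda>x. B *v x + (A - B) *v x)"
      by (simp add: matrix_vector_mult_diff_rdistrib)
    also have "\<dots> \<le> onorm ((*v) B) + onorm ((*v) (A - B))"
      by (intro onorm_triangle matrix_vector_mul_bounded_linear)
    also have "onorm ((*v) (A - B)) \<le> 4 * norm (A - B)"
      using entry by (intro onorm_le)
    finally show ?thesis by simp
  qed
  have "4-lipschitz_on UNIV (\<lambda>A :: complex^2^2. onorm ((*v) A))"
  proof (rule lipschitz_onI)
    fix A B :: "complex^2^2"
    show "dist (onorm ((*v) A)) (onorm ((*v) B)) \<le> 4 * dist A B"
      using le[of A B] le[of B A] by (simp add: dist_norm norm_minus_commute abs_le_iff)
  qed simp
  then show ?thesis by (rule lipschitz_on_continuous_on)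
qed

lemma borel_measurable_matrix:
  fixes A :: "'p \<Rightarrow> complex^2^2"
  assumes [measurable]: "\<And>i j. (\<lambda>p. A p $ i $ j) \<in> borel_measurable N"
  shows "A \<in> borel_measurable N"
  by (subst borel_measurable_euclidean_space) (auto simp: Basis_vec_def inner_axis)

section \<open>Measurability in energy and \<omega>, and the Fubini argument\<close>

context ergodic_jacobi_family
begin

lemma measurable_transfer_matrix:
  "(\<lambda>p. transfer_matrix (a_seq (snd p)) (b_seq (snd p)) (complex_of_real (fst p)) n) \<in> borel_measurable (borel \<Otimes>\<^sub>M M)"
proof (rule borel_measurable_matrix)
  have cnj_meas [measurable]: "cnj \<in> borel_measurable borel"
    by (intro borel_measurable_continuous_onI continuous_intros)
  have one_step [measurable]: "(\<lambda>p. one_step_matrix (a_seq (snd p)) (b_seq (snd p)) (complex_of_real (fst p)) k $ i $ j)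
      \<in> borel_measurable (borel \<Otimes>\<^sub>M M)" for k i j
    using exhaust_2[of i] exhaust_2[of j] unfolding one_step_matrix_def
    by (elim disjE) (simp_all, measurable)
  show "(\<lambda>p. transfer_matrix (a_seq (snd p)) (b_seq (snd p)) (complex_of_real (fst p)) n $ i $ j)
      \<in> borel_measurable (borel \<Otimes>\<^sub>M M)" for i j
  proof (induction n arbitrary: i j)
    case (Suc n)
    note [measurable] = Suc
    show ?case by (simp add: matrix_matrix_mult_def sum_2) measurable
  qed simp
qed

lemma measurable_lyapunov_exponent [measurable]:
  "(\<lambda>E. lyapunov_exponent M T a b (complex_of_real E)) \<in> borel_measurable borel"
proof -
  have "(\<lambda>p. log_norm (fst p) n (snd p)) \<in> borel_measurable (borel \<Otimes>\<^sub>M M)" for n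
    using measurable_compose[OF measurable_transfer_matrix borel_measurable_continuous_onI[OF continuous_on_onorm_matrix]]
    by measurable
  then have [measurable]: "(\<lambda>E. \<integral>\<omega>. log_norm E n \<omega> \<partial>M) \<in> borel_measurable borel" for n
    by (intro borel_measurable_lebesgue_integral) (simp add: case_prod_beta')
  show ?thesis unfolding lyapunov_exponent_def by measurable
qed

definition positive_energies :: "real set" where
  "positive_energies = {E. lyapunov_exponent M T a b (complex_of_real E) > 0}"

lemma positive_energies_borel [measurable]: "positive_energies \<in> sets borel"
  unfolding positive_energies_def by measurable

lemma measurable_jacobi_moment [measurable]:
  "(\<lambda>\<omega>. jacobi_moment (a_seq \<omega>) (b_seq \<omega>) k n m) \<in> borel_measurable M"
proof -
  have cnj_meas [measurable]: "cnj \<in> borel_measurable borel"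
    by (intro borel_measurable_continuous_onI continuous_intros)
  show ?thesis
  proof (induction k arbitrary: n)
    case (Suc k)
    note [measurable] = Suc
    show ?case by simp
  qed simp
qed

lemma jacobi_resolution_regular:
  assumes "\<omega> \<in> regular" "spectral_resolution (ergodic_jacobi_op M T a b \<omega>) E"
  shows "jacobi_resolution E (a_seq \<omega>) (b_seq \<omega>) coeff_bound"
  using assms a_seq_le b_seq_le
  by unfold_locales (auto simp: ergodic_jacobi_op_def spectral_resolution_def regular_def)

text \<open>The resolutions \<open>E \<omega>\<close> are chosen for each \<omega> separately, with
  no measurability. The moments of the basis spectral measures are nevertheless the polynomials
  \<open>jacobi_moment\<close>, whatever the choice. The point mass at 0 keeps the kernel a
  probability measure off \<open>regular\<close>.\<close>

lemma measurable_spectral_kernel: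
  assumes E: "\<And>\<omega>. \<omega> \<in> regular \<Longrightarrow> spectral_resolution (ergodic_jacobi_op M T a b \<omega>) (E \<omega>)"
  shows "(\<lambda>\<omega>. if \<omega> \<in> regular then pvm_measure (E \<omega>) (unit_seq n) else return borel 0)
    \<in> measurable M (subprob_algebra borel)"
proof (rule measurable_kernel_of_moments[where S="3 * coeff_bound"])
  let ?K = "\<lambda>\<omega>. if \<omega> \<in> regular then pvm_measure (E \<omega>) (unit_seq n) else return borel 0"
  have J: "jacobi_resolution (E \<omega>) (a_seq \<omega>) (b_seq \<omega>) coeff_bound" if "\<omega> \<in> regular" for \<omega>
    by (rule jacobi_resolution_regular[OF that E[OF that]])
  show "prob_space (?K \<omega>)" for \<omega>
    using jacobi_resolution.prob_space_pvm_unit[OF J] by (simp add: prob_space_return)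
  show "sets (?K \<omega>) = sets borel" for \<omega>
    using pvm.sets_pvm_measure[OF jacobi_resolution.axioms(1)[OF J]] by simp
  show "AE x in ?K \<omega>. \<bar>x\<bar> \<le> 3 * coeff_bound" for \<omega>
    using jacobi_resolution.pvm_unit_support[OF J] coeff_bound_nonneg by (simp add: AE_return)
  fix k
  have "(\<integral>x. x ^ k \<partial>?K \<omega>) = (if \<omega> \<in> regular then Re (jacobi_moment (a_seq \<omega>) (b_seq \<omega>) k n n) else 0 ^ k)" for \<omega>
    using jacobi_resolution.integral_power_pvm_measure(2)[OF J] by (simp add: integral_return)
  then show "(\<lambda>\<omega>. \<integral>x. x ^ k \<partial>?K \<omega>) \<in> borel_measurable M" by simp
qed

text \<open>For fixed \<omega>', the measure \<open>K \<omega>'\<close> does not involve \<omega>,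
  so the order of integration can be exchanged: at each positive energy \<open>x\<close> the set of
  \<omega> resonant at \<open>x\<close> is null by \<open>AE_not_resonant\<close>. Integrating over
  \<omega>' as well gives the claim for pairs.\<close>

lemma AE_spectral_kernel_resonant:
  assumes K [measurable]: "K \<in> measurable M (subprob_algebra borel)"
  shows "AE p in M \<Otimes>\<^sub>M M. emeasure (K (snd p)) {x \<in> positive_energies. resonant (fst p) x} = 0"
proof -
  interpret P: pair_prob_space M M ..
  have [measurable]: "Measurable.pred ((M \<Otimes>\<^sub>M M) \<Otimes>\<^sub>M borel) (\<lambda>q. resonant (fst (fst q)) (snd q))"
    using measurable_compose[OF _ measurable_resonant, of "\<lambda>q. (fst (fst q), snd q)" "(M \<Otimes>\<^sub>M M) \<Otimes>\<^sub>M borel"] by simp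
  have f [measurable]: "(\<lambda>p. emeasure (K (snd p)) {x \<in> positive_energies. resonant (fst p) x}) \<in> borel_measurable (M \<Otimes>\<^sub>M M)"
  proof (rule emeasure_measurable_subprob_algebra2)
    have "(SIGMA p:space (M \<Otimes>\<^sub>M M). {x \<in> positive_energies. resonant (fst p) x})
       = {q \<in> space ((M \<Otimes>\<^sub>M M) \<Otimes>\<^sub>M borel). snd q \<in> positive_energies \<and> resonant (fst (fst q)) (snd q)}"
      by (auto simp: space_pair_measure)
    also have "\<dots> \<in> sets ((M \<Otimes>\<^sub>M M) \<Otimes>\<^sub>M borel)" by measurable
    finally show "(SIGMA p:space (M \<Otimes>\<^sub>M M). {x \<in> positive_energies. resonant (fst p) x}) \<in> sets ((M \<Otimes>\<^sub>M M) \<Otimes>\<^sub>M borel)" .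
  qed measurable
  have zero: "(\<integral>\<^sup>+\<omega>. emeasure (K \<omega>') {x \<in> positive_energies. resonant \<omega> x} \<partial>M) = 0" if \<omega>': "\<omega>' \<in> space M" for \<omega>'
  proof -
    have sK [measurable_cong]: "sets (K \<omega>') = sets borel" and spK: "space (K \<omega>') = UNIV"
      using measurable_space[OF K \<omega>'] by (auto simp: space_subprob_algebra dest: sets_eq_imp_space_eq)
    interpret Kw: subprob_space "K \<omega>'" by (rule subprob_space_kernel[OF K \<omega>'])
    interpret Q: pair_sigma_finite M "K \<omega>'" ..
    let ?Z = "{q \<in> space (M \<Otimes>\<^sub>M borel). snd q \<in> positive_energies \<and> resonant (fst q) (snd q)}"
    have sets_eq: "sets (M \<Otimes>\<^sub>M K \<omega>') = sets (M \<Otimes>\<^sub>M borel)" by (intro sets_pair_measure_cong sK refl)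
    have Z: "?Z \<in> sets (M \<Otimes>\<^sub>M K \<omega>')" unfolding sets_eq by measurable
    have "(\<integral>\<^sup>+\<omega>. emeasure (K \<omega>') {x \<in> positive_energies. resonant \<omega> x} \<partial>M)
        = (\<integral>\<^sup>+\<omega>. emeasure (K \<omega>') (Pair \<omega> -` ?Z) \<partial>M)"
      by (intro nn_integral_cong arg_cong[where f="emeasure (K \<omega>')"]) (auto simp: space_pair_measure)
    also have "\<dots> = emeasure (M \<Otimes>\<^sub>M K \<omega>') ?Z"
      by (rule Kw.emeasure_pair_measure_alt[OF Z, symmetric])
    also have "\<dots> = (\<integral>\<^sup>+x. emeasure M ((\<lambda>\<omega>. (\<omega>, x)) -` ?Z) \<partial>K \<omega>')"
      by (rule Q.emeasure_pair_measure_alt2[OF Z])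
    also have "\<dots> = (\<integral>\<^sup>+x. 0 \<partial>K \<omega>')"
    proof (intro nn_integral_cong)
      fix x
      show "emeasure M ((\<lambda>\<omega>. (\<omega>, x)) -` ?Z) = 0"
      proof (cases "x \<in> positive_energies")
        case True
        have eq: "(\<lambda>\<omega>. (\<omega>, x)) -` ?Z = {\<omega> \<in> space M. resonant \<omega> x}"
          using True by (auto simp: space_pair_measure)
        have "AE \<omega> in M. \<not> resonant \<omega> x"
          using True by (intro AE_not_resonant) (simp add: positive_energies_def)
        then show ?thesis unfolding eq by (subst (asm) AE_iff_measurable[OF _ refl]) auto
      qed simp
    qed
    finally show ?thesis by simp
  qed
  have "(\<integral>\<^sup>+p. emeasure (K (snd p)) {x \<in> positive_energies. resonant (fst p) x} \<partial>(M \<Otimes>\<^sub>M M))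
      = (\<integral>\<^sup>+\<omega>'. (\<integral>\<^sup>+\<omega>. emeasure (K \<omega>') {x \<in> positive_energies. resonant \<omega> x} \<partial>M) \<partial>M)"
    using P.nn_integral_snd[OF f] by simp
  also have "\<dots> = (\<integral>\<^sup>+\<omega>'. 0 \<partial>M)" by (intro nn_integral_cong zero)
  finally show ?thesis using nn_integral_0_iff_AE[OF f] by simp
qed

lemma null_sets_singular_component:
  assumes "is_singular_component \<mu> \<nu>" "B \<in> sets borel" "emeasure \<mu> B = 0"
  shows "B \<in> null_sets \<nu>"
  using assms unfolding is_singular_component_def null_sets_def by auto

lemma mutually_singular_spectral_measures:
  fixes \<phi> :: "'w \<Rightarrow> int \<Rightarrow> complex" and \<mu> \<mu>s :: "'w \<Rightarrow> real measure"
  assumes spectral: "\<And>\<omega>. \<omega> \<in> regular \<Longrightarrow> is_spectral_measure (ergodic_jacobi_op M T a b \<omega>) (\<phi> \<omega>) (\<mu> \<omega>)"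
    and singular: "\<And>\<omega>. \<omega> \<in> regular \<Longrightarrow> is_singular_component (\<mu> \<omega>) (\<mu>s \<omega>)"
  shows "AE (\<omega>, \<omega>') in M \<Otimes>\<^sub>M M. mutually_singular_on positive_energies (\<mu>s \<omega>) (\<mu>s \<omega>')"
proof -
  interpret P: pair_prob_space M M ..
  obtain E where E: "\<And>\<omega>. \<omega> \<in> regular \<Longrightarrow> spectral_resolution (ergodic_jacobi_op M T a b \<omega>) (E \<omega>)"
    and \<mu>: "\<And>\<omega>. \<omega> \<in> regular \<Longrightarrow> \<mu> \<omega> = pvm_measure (E \<omega>) (\<phi> \<omega>)"
    using spectral unfolding is_spectral_measure_def by metis
  have \<phi>: "\<phi> \<omega> \<in> ell2" if "\<omega> \<in> regular" for \<omega>
    using spectral[OF that] by (simp add: is_spectral_measure_def)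
  note J = jacobi_resolution_regular[OF _ E]
  let ?K = "\<lambda>n \<omega>. if \<omega> \<in> regular then pvm_measure (E \<omega>) (unit_seq n) else return borel 0"
  let ?R = "\<lambda>\<omega>. {x \<in> positive_energies. resonant \<omega> x}"
  have "AE p in M \<Otimes>\<^sub>M M. \<forall>n. emeasure (?K n (snd p)) (?R (fst p)) = 0"
    unfolding AE_all_countable by (intro allI AE_spectral_kernel_resonant measurable_spectral_kernel E)
  moreover have "AE p in M \<Otimes>\<^sub>M M. fst p \<in> regular \<and> snd p \<in> regular"
  proof (rule P.AE_pair_measure)
    show "{p \<in> space (M \<Otimes>\<^sub>M M). fst p \<in> regular \<and> snd p \<in> regular} \<in> sets (M \<Otimes>\<^sub>M M)" by measurable
    show "AE \<omega> in M. AE \<omega>' in M. fst (\<omega>, \<omega>') \<in> regular \<and> snd (\<omega>, \<omega>') \<in> regular"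
      using AE_regular
    proof eventually_elim
      case (elim \<omega>)
      show ?case using AE_regular by eventually_elim (use elim in simp)
    qed
  qed
  ultimately show ?thesis
  proof eventually_elim
    case (elim p)
    obtain \<omega> \<omega>' where p: "p = (\<omega>, \<omega>')" by (cases p)
    have reg: "\<omega> \<in> regular" "\<omega>' \<in> regular" using elim p by auto
    have [measurable]: "Measurable.pred borel (\<lambda>x. resonant \<omega> x)"
      using measurable_compose[OF measurable_Pair1'[of \<omega> M borel] measurable_resonant] reg by (simp add: regular_def)
    have R [measurable]: "?R \<omega> \<in> sets borel" by measurable
    interpret j: jacobi_resolution "E \<omega>" "a_seq \<omega>" "b_seq \<omega>" coeff_bound by (rule J[OF reg(1) reg(1)])
    interpret j': jacobi_resolution "E \<omega>'" "a_seq \<omega>'" "b_seq \<omega>'" coeff_bound by (rule J[OF reg(2) reg(2)])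
    have "emeasure (\<mu> \<omega>') (?R \<omega>) = 0"
      unfolding \<mu>[OF reg(2)]
    \<comment> \<open>The almost sure statement concerns basis vectors only; for a fixed pair it
      passes to the arbitrary vector \<open>\<phi> \<omega>'\<close>.\<close>
    proof (rule j'.pvm_measure_absolutely_continuous[OF R _ \<phi>[OF reg(2)]])
      show "emeasure (pvm_measure (E \<omega>') (unit_seq m)) (?R \<omega>) = 0" for m
        using spec[OF elim(1), of m] reg(2) unfolding p by simp
    qed
    moreover have "emeasure (\<mu> \<omega>) (positive_energies - ?R \<omega>) = 0"
      unfolding \<mu>[OF reg(1)]
    proof (rule j.emeasure_pvm_generalized_eigenvalues)
      fix x u K n
      assume "x \<in> positive_energies - ?R \<omega>" "jacobi_op (a_seq \<omega>) (b_seq \<omega>) u = (\<lambda>n. of_real x * u n)"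
        "\<And>n. cmod (u n) \<le> K * (1 + (real_of_int n)\<^sup>2)"
      then have "solution (a_seq \<omega>) (b_seq \<omega>) x u" "quadratically_bounded u" "\<not> resonant \<omega> x"
        by (auto simp: solution_def quadratically_bounded_def)
      then show "u n = 0" using resonant_iff[OF reg(1), of x] by blast
    next
      show "positive_energies - ?R \<omega> \<in> sets borel" by measurable
    qed (rule \<phi>[OF reg(1)])
    \<comment> \<open>The separating set is the complement of \<open>?R \<omega>\<close>: the
      measure of \<omega> does not charge its nonresonant energies, and that of \<omega>' does not
      charge the resonant energies of \<omega>.\<close>
    moreover have "positive_energies \<inter> - ?R \<omega> = positive_energies - ?R \<omega>" "positive_energies - - ?R \<omega> = ?R \<omega>"
      by auto
    ultimately have "positive_energies \<inter> - ?R \<omega> \<in> null_sets (\<mu>s \<omega>)" "positive_energies - - ?R \<omega> \<in> null_sets (\<mu>s \<omega>')"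
      using null_sets_singular_component[OF singular[OF reg(1)], of "positive_energies - ?R \<omega>"]
        null_sets_singular_component[OF singular[OF reg(2)], of "?R \<omega>"] R
      by (simp_all only: sets.Diff positive_energies_borel)
    then show ?case unfolding mutually_singular_on_def p prod.case by blast
  qed
qed

end

theorem theorem1p2:
  fixes M :: "'w measure" and T :: "'w \<Rightarrow> 'w" and a :: "'w \<Rightarrow> complex" and b :: "'w \<Rightarrow> real"
    and \<phi> :: "'w \<Rightarrow> int \<Rightarrow> complex" and \<mu> \<mu>s :: "'w \<Rightarrow> real measure"
  assumes "ergodic_jacobi_family M T a b"
    and "\<And>\<omega>. \<omega> \<in> space M \<Longrightarrow> (\<forall>n. orbit_seq M T a \<omega> n \<noteq> 0) \<Longrightarrow>
           is_spectral_measure (ergodic_jacobi_op M T a b \<omega>) (\<phi> \<omega>) (\<mu> \<omega>)"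
    and "\<And>\<omega>. \<omega> \<in> space M \<Longrightarrow> (\<forall>n. orbit_seq M T a \<omega> n \<noteq> 0) \<Longrightarrow>
           is_singular_component (\<mu> \<omega>) (\<mu>s \<omega>)"
  shows "AE (\<omega>, \<omega>') in M \<Otimes>\<^sub>M M.
           mutually_singular_on {E. lyapunov_exponent M T a b (complex_of_real E) > 0}
             (\<mu>s \<omega>) (\<mu>s \<omega>')"
proof -
  interpret ergodic_jacobi_family M T a b by (rule assms(1))
  have "AE (\<omega>, \<omega>') in M \<Otimes>\<^sub>M M. mutually_singular_on positive_energies (\<mu>s \<omega>) (\<mu>s \<omega>')"
    by (rule mutually_singular_spectral_measures[where \<phi>=\<phi> and \<mu>=\<mu>])
      (auto intro: assms(2,3) simp: regular_def)
  then show ?thesis unfolding positive_energies_def .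
qed

end
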